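(* For all non-negative integers $l$ and $m$ with $(l,m)\neq(0,0)$, the following two equalities hold in $\mathcal{A}_2$: $$\sum_{\substack{ m_0+\cdots+m_{2l}=m \\ m_i\ge0\,(0\le i\le 2l) }} \zeta_{\mathcal{A}_{2}} (\{2\}^{m_0},1,\{2\}^{m_1},3,\{2\}^{m_2},\ldots,\{2\}^{m_{2l-2}},1,\{2\}^{m_{2l-1}},3,\{2\}^{m_{2l}}) =(-1)^m \biggl\{(-1)^l2^{1-2l}\binom{l+m}{l}-4 \binom{2 l+m}{2l}\biggr\} \beta_{4l+2m+1}\boldsymbol{p},$$ and $$\sum_{\substack{ m_0+\cdots+m_{2l}=m \\ m_i\ge0\,(0\le i\le 2l) }} \zeta_{\mathcal{A}_{2}}^{\star} (\{2\}^{m_0},1,\{2\}^{m_1},3,\{2\}^{m_2},\ldots,\{2\}^{m_{2l-2}},1,\{2\}^{m_{2l-1}},3,\{2\}^{m_{2l}}) =(-1)^l2^{1-2l}\binom{l+m}{l} \beta_{4l+2m+1}\boldsymbol{p}.$$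
   Context: Let $\mathcal{A}_2$ be the $\mathbb{Q}$-algebra $$\mathcal{A}_{2}:=\biggl(\prod_{p}\mathbb{Z}/p^{2}\mathbb{Z}\biggr)\bigg/\biggl(\bigoplus_{p}\mathbb{Z}/p^{2}\mathbb{Z}\biggr),$$ where $p$ runs over all prime numbers. Thus two families $(a_p)_p$ and $(b_p)_p$ define the same element if and only if $a_p=b_p$ for all but finitely many $p$, and an element of $\mathcal{A}_2$ is determined by giving its components for all but finitely many $p$. For positive integers $k_1,\dots,k_r$, the finite multiple zeta value and finite multiple zeta-star value in $\mathcal{A}_2$ are $$\zeta_{\mathcal{A}_{2}}(k_{1},\dots,k_{r}) :=\biggl(\sum_{1\le n_{1}<\cdots<n_{r}\le p-1}\frac{1}{n_{1}^{k_{1}}\cdots n_{r}^{k_{r}}}\bmod p^{2}\biggr)_{p}\in\mathcal{A}_{2},$$ $$\zeta_{\mathcal{A}_{2}}^{\star}(k_{1},\dots,k_{r}) :=\biggl(\sum_{1\le n_{1}\le \cdots\le n_{r}\le p-1}\frac{1}{n_{1}^{k_{1}}\cdots n_{r}^{k_{r}}}\bmod p^{2}\biggr)_{p}\in\mathcal{A}_{2},$$ and both are set equal to $1$ for the empty index. $\{2\}^{n}$ denotes the $n$-fold repetition $2,\ldots,2$ (empty if $n=0$). In the index in the sums, the entries $1,3,1,3,\ldots,1,3$ ($l$ ones and $l$ threes, alternating, beginning with $1$) are separated, preceded and followed by blocks $\{2\}^{m_i}$, $0\le i\le 2l$; when $l=0$ the index is just $\{2\}^{m_0}=\{2\}^m$.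 The sum runs over all tuples $(m_0,\ldots,m_{2l})$ of non-negative integers with sum $m$. $\boldsymbol{p}:=(p \bmod p^2)_p\in\mathcal{A}_2$. For an integer $k>1$, $\beta_k:=(B_{p-k}/k \bmod p^2)_p\in\mathcal{A}_2$, where $B_n$ is the $n$th Bernoulli number (the component makes sense for all but finitely many primes $p$). *)

theory Defs
  imports "HOL-Number_Theory.Number_Theory"
begin

section \<open>The ring $\mathcal{A}_2$\<close>

text \<open>
  An element of $\prod_p \mathbb{Z}/p^2\mathbb{Z}$ is represented by a family of integers
  \<open>a :: nat \<Rightarrow> int\<close>, with \<open>a p\<close> standing for its class modulo \<open>p\<^sup>2\<close>; the values of \<open>a\<close> at
  arguments that are not prime play no role.
\<close>
definition A2_eq :: "(nat \<Rightarrow> int) \<Rightarrow> (nat \<Rightarrow> int) \<Rightarrow> bool" where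
  "A2_eq a b \<longleftrightarrow> finite {p. prime p \<and> \<not> [a p = b p] (mod (int p)\<^sup>2)}"

lemma A2_eq_refl: "A2_eq a a"
  by (simp add: A2_eq_def)

lemma A2_eq_pointwise1:
  assumes "A2_eq a b"
    and "\<And>p. [a p = b p] (mod (int p)\<^sup>2) \<Longrightarrow> [c p = d p] (mod (int p)\<^sup>2)"
  shows "A2_eq c d"
proof -
  have "{p. prime p \<and> \<not> [c p = d p] (mod (int p)\<^sup>2)} \<subseteq> {p. prime p \<and> \<not> [a p = b p] (mod (int p)\<^sup>2)}"
    using assms(2) by blast
  then show ?thesis
    using assms(1) unfolding A2_eq_def by (rule finite_subset)
qed

lemma A2_eq_pointwise2:
  assumes "A2_eq a b" "A2_eq a' b'"
    and "\<And>p. [a p = b p] (mod (int p)\<^sup>2) \<Longrightarrow> [a' p = b' p] (mod (int p)\<^sup>2) \<Longrightarrow>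
           [c p = d p] (mod (int p)\<^sup>2)"
  shows "A2_eq c d"
proof -
  have "{p. prime p \<and> \<not> [c p = d p] (mod (int p)\<^sup>2)} \<subseteq>
          {p. prime p \<and> \<not> [a p = b p] (mod (int p)\<^sup>2)} \<union>
          {p. prime p \<and> \<not> [a' p = b' p] (mod (int p)\<^sup>2)}"
    using assms(3) by blast
  then show ?thesis
    using assms(1,2) unfolding A2_eq_def by (meson finite_UnI finite_subset)
qed

quotient_type A2 = "nat \<Rightarrow> int" / A2_eq
proof (rule equivpI)
  show "reflp A2_eq"
    by (simp add: reflpI A2_eq_refl)
  show "symp A2_eq"
    by (auto intro!: sympI elim: A2_eq_pointwise1 simp: cong_sym_eq)
  show "transp A2_eq"
    by (rule transpI) (erule (1) A2_eq_pointwise2, rule cong_trans)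
qed

instantiation A2 :: comm_ring_1
begin

lift_definition zero_A2 :: A2 is "\<lambda>_. 0" .

lift_definition one_A2 :: A2 is "\<lambda>_. 1" .

lift_definition plus_A2 :: "A2 \<Rightarrow> A2 \<Rightarrow> A2" is "\<lambda>a b p. a p + b p"
  by (erule (1) A2_eq_pointwise2, rule cong_add)

lift_definition minus_A2 :: "A2 \<Rightarrow> A2 \<Rightarrow> A2" is "\<lambda>a b p. a p - b p"
  by (erule (1) A2_eq_pointwise2, rule cong_diff)

lift_definition uminus_A2 :: "A2 \<Rightarrow> A2" is "\<lambda>a p. - a p"
  by (erule A2_eq_pointwise1) (simp add: cong_minus_minus_iff)

lift_definition times_A2 :: "A2 \<Rightarrow> A2 \<Rightarrow> A2" is "\<lambda>a b p. a p * b p"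
  by (erule (1) A2_eq_pointwise2, rule cong_mult)

instance
proof
  fix a b c :: A2
  show "a * b * c = a * (b * c)" "a * b = b * a" "1 * a = a" "a + b + c = a + (b + c)"
    "a + b = b + a" "0 + a = a" "- a + a = 0" "a - b = a + - b" "(a + b) * c = a * c + b * c"
    by (transfer; simp add: A2_eq_refl algebra_simps)+
  show "(0 :: A2) \<noteq> 1"
  proof (transfer, unfold A2_eq_def)
    have "{p. prime p \<and> \<not> [(0 :: int) = 1] (mod (int p)\<^sup>2)} = {p :: nat. prime p}"
      by (auto simp: cong_iff_dvd_diff power2_eq_square zmult_eq_1_iff)
    then show "infinite {p. prime p \<and> \<not> [(0 :: int) = 1] (mod (int p)\<^sup>2)}"
      using primes_infinite by simp
  qed
qed

end

section \<open>Reduction of rational numbers and the action of the rationals\<close>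

text \<open>
  For a rational \<open>x = a / b\<close> in lowest terms with \<open>b\<close> coprime to \<open>n\<close>, this is the residue of
  \<open>a * b\<^sup>-\<^sup>1\<close> modulo \<open>n\<close>. It is a meaningless value if \<open>b\<close> is not coprime to \<open>n\<close>.
\<close>
definition rat_mod :: "rat \<Rightarrow> int \<Rightarrow> int" where
  "rat_mod x n = (fst (quotient_of x) * modular_inverse n (snd (quotient_of x))) mod n"

text \<open>
  The element $(x_p \bmod p^2)_p$ for a family of rationals that are \<open>p\<close>-integral
  for all but finitely many primes \<open>p\<close>.
\<close>
lift_definition A2_of_rats :: "(nat \<Rightarrow> rat) \<Rightarrow> A2" is
  "\<lambda>x p. rat_mod (x p) ((int p)\<^sup>2)" .

definition scaleQ :: "rat \<Rightarrow> A2 \<Rightarrow> A2" (infixr "*\<^sub>Q" 75) where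
  "c *\<^sub>Q x = A2_of_rats (\<lambda>_. c) * x"

lemma rat_mod_cong_iff:
  assumes "x = of_int a / of_int b" "b \<noteq> 0" "coprime b n"
  shows "[rat_mod x n = c] (mod n) \<longleftrightarrow> [a = c * b] (mod n)"
proof -
  obtain u v where uv: "quotient_of x = (u, v)"
    by fastforce
  have v: "v > 0" and cop: "coprime u v" and x: "x = of_int u / of_int v"
    using quotient_of_denom_pos[OF uv] quotient_of_coprime[OF uv] quotient_of_div[OF uv] by auto
  have "(of_int (a * v) :: rat) = of_int (u * b)"
    using x assms v by (simp add: field_simps)
  then have eq: "a * v = u * b"
    by (simp only: of_int_eq_iff)
  then have "v dvd u * b"
    by (metis dvd_triv_right)
  then have "v dvd b"
    using cop by (simp add: coprime_commute coprime_dvd_mult_right_iff)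
  then have cv: "coprime v n"
    using assms(3) by (meson coprime_divisors dvd_refl)
  have "[rat_mod x n = c] (mod n) \<longleftrightarrow> [u * modular_inverse n v = c] (mod n)"
    by (simp add: rat_mod_def uv cong_def)
  also have "\<dots> \<longleftrightarrow> [u * modular_inverse n v * (b * v) = c * (b * v)] (mod n)"
    using assms(3) cv by (intro cong_mult_rcancel[symmetric]) (simp add: coprime_commute)
  also have "u * modular_inverse n v * (b * v) = (a * v) * (v * modular_inverse n v)"
    by (simp add: eq ac_simps)
  also have "[(a * v) * (v * modular_inverse n v) = c * (b * v)] (mod n) \<longleftrightarrow>
             [(a * v) * 1 = c * (b * v)] (mod n)"
    using cong_mult[OF cong_refl[of "a * v"] cong_modular_inverse1[OF cv]]
    by (metis cong_sym cong_trans)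
  also have "\<dots> \<longleftrightarrow> [a * v = (c * b) * v] (mod n)"
    by (simp add: ac_simps)
  also have "\<dots> \<longleftrightarrow> [a = c * b] (mod n)"
    using cv by (intro cong_mult_rcancel) (simp add: coprime_commute)
  finally show ?thesis .
qed

lemma finite_prime_not_coprime:
  fixes b :: int
  assumes "b \<noteq> 0"
  shows "finite {p. prime p \<and> \<not> coprime b ((int p)\<^sup>2)}"
proof -
  have "{p. prime p \<and> \<not> coprime b ((int p)\<^sup>2)} \<subseteq> {..nat \<bar>b\<bar>}"
  proof
    fix p :: nat
    assume "p \<in> {p. prime p \<and> \<not> coprime b ((int p)\<^sup>2)}"
    then have "int p dvd b"
      using prime_imp_coprime[of "int p" b]
      by (auto simp: coprime_commute)
    then have "int p \<le> \<bar>b\<bar>"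
      using dvd_imp_le_int[OF assms] by fastforce
    then show "p \<in> {..nat \<bar>b\<bar>}"
      by auto
  qed
  then show ?thesis
    by (rule finite_subset) simp
qed

lemma A2_eq_rat_mod:
  assumes "x = of_int a / of_int b" "b \<noteq> 0"
    and "\<And>p. prime p \<Longrightarrow> coprime b ((int p)\<^sup>2) \<Longrightarrow> [a = f p * b] (mod (int p)\<^sup>2)"
  shows "A2_eq (\<lambda>p. rat_mod x ((int p)\<^sup>2)) f"
  unfolding A2_eq_def
  by (rule finite_subset[OF _ finite_prime_not_coprime[OF assms(2)]])
     (use assms rat_mod_cong_iff in blast)

lemma A2_of_rats_one: "A2_of_rats (\<lambda>_. 1) = 1"
  by transfer (rule A2_eq_rat_mod[of _ 1 1], auto)

lemma rat_mod_quotient_of: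
  assumes "quotient_of x = (a, b)" "coprime b n"
  shows "[rat_mod x n * b = a] (mod n)"
proof -
  have "b \<noteq> 0" "x = of_int a / of_int b"
    using quotient_of_denom_pos[OF assms(1)] quotient_of_div[OF assms(1)] by auto
  then have "[a = rat_mod x n * b] (mod n)"
    using rat_mod_cong_iff[of x a b n "rat_mod x n"] assms(2) by simp
  then show ?thesis
    by (rule cong_sym)
qed

lemma A2_of_rats_const_mult: "A2_of_rats (\<lambda>_. x * y) = A2_of_rats (\<lambda>_. x) * A2_of_rats (\<lambda>_. y)"
proof transfer
  fix x y :: rat
  obtain a b c d where q: "quotient_of x = (a, b)" "quotient_of y = (c, d)"
    by fastforce
  have "b \<noteq> 0" "d \<noteq> 0" "x = of_int a / of_int b" "y = of_int c / of_int d"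
    using quotient_of_denom_pos[OF q(1)] quotient_of_denom_pos[OF q(2)]
      quotient_of_div[OF q(1)] quotient_of_div[OF q(2)] by auto
  then show "A2_eq (\<lambda>p. rat_mod (x * y) ((int p)\<^sup>2))
               (\<lambda>p. rat_mod x ((int p)\<^sup>2) * rat_mod y ((int p)\<^sup>2))"
  proof (intro A2_eq_rat_mod[of _ "a * c" "b * d"])
    fix p :: nat
    assume "coprime (b * d) ((int p)\<^sup>2)"
    then have "[(rat_mod x ((int p)\<^sup>2) * b) * (rat_mod y ((int p)\<^sup>2) * d) = a * c] (mod (int p)\<^sup>2)"
      by (intro cong_mult rat_mod_quotient_of q) auto
    then show "[a * c = rat_mod x ((int p)\<^sup>2) * rat_mod y ((int p)\<^sup>2) * (b * d)] (mod (int p)\<^sup>2)"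
      by (simp add: cong_sym_eq ac_simps)
  qed auto
qed

lemma A2_of_rats_const_add: "A2_of_rats (\<lambda>_. x + y) = A2_of_rats (\<lambda>_. x) + A2_of_rats (\<lambda>_. y)"
proof transfer
  fix x y :: rat
  obtain a b c d where q: "quotient_of x = (a, b)" "quotient_of y = (c, d)"
    by fastforce
  have "b \<noteq> 0" "d \<noteq> 0" "x = of_int a / of_int b" "y = of_int c / of_int d"
    using quotient_of_denom_pos[OF q(1)] quotient_of_denom_pos[OF q(2)]
      quotient_of_div[OF q(1)] quotient_of_div[OF q(2)] by auto
  then show "A2_eq (\<lambda>p. rat_mod (x + y) ((int p)\<^sup>2))
               (\<lambda>p. rat_mod x ((int p)\<^sup>2) + rat_mod y ((int p)\<^sup>2))"
  proof (intro A2_eq_rat_mod[of _ "a * d + c * b" "b * d"])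
    fix p :: nat
    assume "coprime (b * d) ((int p)\<^sup>2)"
    then have "[(rat_mod x ((int p)\<^sup>2) * b) * d + (rat_mod y ((int p)\<^sup>2) * d) * b = a * d + c * b]
                 (mod (int p)\<^sup>2)"
      by (intro cong_add cong_mult cong_refl rat_mod_quotient_of q) auto
    then show "[a * d + c * b = (rat_mod x ((int p)\<^sup>2) + rat_mod y ((int p)\<^sup>2)) * (b * d)]
                 (mod (int p)\<^sup>2)"
      by (simp add: cong_sym_eq algebra_simps)
  qed (auto simp: field_simps)
qed

text \<open>
  Together with \<open>c *\<^sub>Q (x * y) = (c *\<^sub>Q x) * y\<close>, which is associativity, this says that \<open>*\<^sub>Q\<close> is the
  (unique) structure of a $\mathbb{Q}$-algebra on $\mathcal{A}_2$.
\<close>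
lemma vector_space_scaleQ: "vector_space scaleQ"
  by standard
     (simp_all add: scaleQ_def A2_of_rats_one A2_of_rats_const_mult A2_of_rats_const_add algebra_simps)

section \<open>Finite multiple zeta values\<close>

text \<open>
  Indices \<open>(k\<^sub>1, \<dots>, k\<^sub>r)\<close> and summation variables \<open>(n\<^sub>1, \<dots>, n\<^sub>r)\<close> are lists, with positions
  counted from 0. For \<open>ks = []\<close> both sums consist of the empty product, so both values are 1.
\<close>
definition zeta_A2 :: "nat list \<Rightarrow> A2" where
  "zeta_A2 ks = A2_of_rats (\<lambda>p.
     \<Sum>ns | length ns = length ks \<and> set ns \<subseteq> {1..p - 1} \<and> sorted_wrt (<) ns.
       1 / (\<Prod>i<length ks. of_nat (ns ! i) ^ (ks ! i)))"

definition zeta_star_A2 :: "nat list \<Rightarrow> A2" where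
  "zeta_star_A2 ks = A2_of_rats (\<lambda>p.
     \<Sum>ns | length ns = length ks \<and> set ns \<subseteq> {1..p - 1} \<and> sorted_wrt (\<le>) ns.
       1 / (\<Prod>i<length ks. of_nat (ns ! i) ^ (ks ! i)))"

definition p_A2 :: A2 where
  "p_A2 = A2_of_rats (\<lambda>p. of_nat p)"

text \<open>
  Bernoulli numbers, by $\sum_{k=0}^{n} \binom{n+1}{k} B_k = 0$ for $n \ge 1$; here $B_1 = -1/2$.
\<close>
fun bernoulli :: "nat \<Rightarrow> rat" where
  "bernoulli 0 = 1"
| "bernoulli (Suc n) = - (\<Sum>k\<le>n. of_nat ((n + 2) choose k) * bernoulli k) / of_nat (n + 2)"

text \<open>For \<open>k > 1\<close>. The components with \<open>p \<le> k\<close>, where \<open>p - k\<close> is truncated, are irrelevant.\<close>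
definition beta_A2 :: "nat \<Rightarrow> A2" where
  "beta_A2 k = A2_of_rats (\<lambda>p. bernoulli (p - k) / of_nat k)"

text \<open>
  The index $(\{2\}^{m_0},1,\{2\}^{m_1},3,\{2\}^{m_2},\ldots,1,\{2\}^{m_{2l-1}},3,\{2\}^{m_{2l}})$
  for \<open>ms = [m\<^sub>0, \<dots>, m\<^sub>2\<^sub>l]\<close>.
\<close>
definition index_13 :: "nat \<Rightarrow> nat list \<Rightarrow> nat list" where
  "index_13 l ms = replicate (ms ! 0) 2 @
     concat (map (\<lambda>i. [1] @ replicate (ms ! (2 * i + 1)) 2 @ [3] @ replicate (ms ! (2 * i + 2)) 2)
       [0..<l])"

end

theory Submission
  imports Defs "HOL-Computational_Algebra.Formal_Power_Series" "HOL-Computational_Algebra.Polynomial_FPS"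
begin

text \<open>
  Write \<open>S(j, m)\<close> for the truncated sum over all indices that consist of \<open>m\<close> entries 2 and of
  \<open>j\<close> entries 1, 3, 1, 3, ... in this order, with arguments bounded by \<open>N = p - 1\<close>. Adding the largest
  argument one at a time, the generating function of the sums with even \<open>j\<close> is the corner entry of a
  product of two-by-two matrices \<open>1 + K\<^sub>1\<close>, ..., \<open>1 + K\<^sub>N\<close>, where
  \<open>K\<^sub>n\<close> has \<open>t / n\<^sup>2\<close> twice on its diagonal and \<open>v / n\<close>, \<open>v / n\<^sup>3\<close> off it. The star version is the
  product of the inverses of \<open>1 - K\<^sub>n\<close>. By the adjugate formula it is the ordinary version at \<open>- t\<close>,
  divided by the product of the determinants, so both equalities come from a single computation
  (lemma \<open>gen_fun_star\<close>).

  Parametrise \<open>t = - (z\<^sup>2 + w\<^sup>2)\<close>, \<open>v = 2 z w\<close>. Then the corner entry equals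
  \[ \frac{(1-z)_N (1-w)_N (1+z+w)_N}{N!^3}\;
     {}_4F_3(-N,\, z,\, w,\, z+w-N;\; z-N,\, w-N,\, 1+z+w;\; 1). \]
  This is the coefficient of \<open>x\<^sup>N\<close> in \<open>F(z,-z;1;x) F(w,-w;1;x) / (1 - x)\<close>, with hypergeometric
  functions \<open>F\<close>, after a transformation of Whipple. It is verified by creative telescoping, which shows
  that the sum and a companion satisfy the recursion of the matrix product
  (\<open>whipple_recurrence_1\<close>, \<open>whipple_recurrence_2\<close>).

  The point of this form is that for \<open>N = p - 1\<close> its parameters come in pairs that differ by \<open>p\<close>, if
  \<open>z\<close> and \<open>w\<close> in the numerator are first replaced by \<open>1 + z\<close> and \<open>1 + w\<close>. Up to the factor in front
  of the series, the \<open>n\<close>-th term with \<open>n \<ge> 1\<close> is therefore \<open>z w / ((z + n) (w + n))\<close> times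
  \<open>1 + p \<delta>\<close> modulo \<open>p\<^sup>2\<close>, where \<open>\<delta>\<close> is a sum of reciprocals over \<open>k \<le> n\<close>
  (\<open>scaled_term_eqv\<close>). Expanding in \<open>z\<close> and \<open>w\<close>, everything
  reduces to three known quantities: the elementary symmetric functions of the \<open>1 / k\<close> modulo \<open>p\<^sup>2\<close>
  (\<open>coeff_E_poly\<close>), the power sums that they determine, and the sums
  \<open>1 / (k\<^sup>a n\<^sup>b)\<close> over \<open>k \<le> n\<close> modulo \<open>p\<close> (\<open>double_harmonic_sum\<close>). Each of them is a multiple of a
  single Bernoulli number. Adding up gives \<open>whipple_sum_eqv\<close> and \<open>star_eqv\<close>.

  To avoid bivariate series, \<open>z = a X\<close> and \<open>w = X\<close> with an integer \<open>a\<close>. The coefficient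
  of a power of \<open>X\<close> is then a polynomial in \<open>a\<close> which is known modulo \<open>p\<^sup>2\<close> at \<open>p - 1\<close> points, and since
  its degree stays fixed while \<open>p\<close> grows, its coefficients are determined modulo \<open>p\<^sup>2\<close>
  (\<open>extract_coefficients\<close>). The two closed forms of the binomial sums that have to be compared are
  \<open>chebyshev_sum\<close> and \<open>even_binomial_sum\<close>.
\<close>

section \<open>Filtered rings and p-adic congruences\<close>

text \<open>
  The set \<open>I k\<close> stands for the multiples of the \<open>k\<close>-th power of \<open>p\<close> among the integral elements, and
  \<open>I 0\<close> for the integral elements themselves. The ambient ring also contains elements that
  are not integral, so fractions need not be cleared before they are reduced.
\<close>
locale filtered_ring =
  fixes I :: "nat \<Rightarrow> 'a :: comm_ring_1 set"
  assumes one_mem: "1 \<in> I 0"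
    and zero_mem: "0 \<in> I k"
    and diff_mem: "x \<in> I k \<Longrightarrow> y \<in> I k \<Longrightarrow> x - y \<in> I k"
    and mult_mem: "x \<in> I k \<Longrightarrow> y \<in> I l \<Longrightarrow> x * y \<in> I (k + l)"
    and Suc_mem: "x \<in> I (Suc k) \<Longrightarrow> x \<in> I k"
begin

definition eqv :: "nat \<Rightarrow> 'a \<Rightarrow> 'a \<Rightarrow> bool" where
  "eqv k x y \<longleftrightarrow> x - y \<in> I k"

lemma uminus_mem: "x \<in> I k \<Longrightarrow> - x \<in> I k"
  using diff_mem[OF zero_mem] by simp

lemma add_mem: "x \<in> I k \<Longrightarrow> y \<in> I k \<Longrightarrow> x + y \<in> I k"
  using diff_mem[of x k "- y"] uminus_mem by simp

lemma mem_antimono: "x \<in> I l \<Longrightarrow> k \<le> l \<Longrightarrow> x \<in> I k"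
  by (induction l) (auto simp: le_Suc_eq intro: Suc_mem)

lemma mult_mem_left: "x \<in> I 0 \<Longrightarrow> y \<in> I k \<Longrightarrow> x * y \<in> I k"
  using mult_mem[of x 0 y k] by simp

lemma mult_mem_right: "x \<in> I k \<Longrightarrow> y \<in> I 0 \<Longrightarrow> x * y \<in> I k"
  using mult_mem[of x k y 0] by simp

lemma power_mem: "x \<in> I 0 \<Longrightarrow> x ^ n \<in> I 0"
  by (induction n) (auto intro: one_mem mult_mem_left)

lemma sum_mem: "(\<And>i. i \<in> A \<Longrightarrow> f i \<in> I k) \<Longrightarrow> sum f A \<in> I k"
  by (induction A rule: infinite_finite_induct) (auto intro: zero_mem add_mem)

lemma prod_mem: "(\<And>i. i \<in> A \<Longrightarrow> f i \<in> I 0) \<Longrightarrow> prod f A \<in> I 0"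
  by (induction A rule: infinite_finite_induct) (auto intro: one_mem mult_mem_left)

lemma of_nat_mem: "of_nat n \<in> I 0"
  by (induction n) (auto intro: zero_mem one_mem add_mem)

lemma of_int_mem: "of_int n \<in> I 0"
proof -
  have "of_int n = (of_nat (nat n) - of_nat (nat (- n)) :: 'a)"
    by (cases "n \<ge> 0") simp_all
  then show ?thesis
    by (simp only: diff_mem of_nat_mem)
qed

lemma eqv_refl [simp]: "eqv k x x"
  by (simp add: eqv_def zero_mem)

lemma eqv_sym: "eqv k x y \<Longrightarrow> eqv k y x"
  using uminus_mem[of "x - y" k] by (simp add: eqv_def)

lemma eqv_trans [trans]: "eqv k x y \<Longrightarrow> eqv k y z \<Longrightarrow> eqv k x z"
  using add_mem[of "x - y" k "y - z"] by (simp add: eqv_def)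

text \<open>
  These keep calculations that mix equations and congruences away from higher-order substitution.
\<close>
lemma eqv_eq_trans [trans]: "eqv k x y \<Longrightarrow> y = z \<Longrightarrow> eqv k x z" "x = y \<Longrightarrow> eqv k y z \<Longrightarrow> eqv k x z"
  by simp_all

lemma eqv_antimono: "eqv l x y \<Longrightarrow> k \<le> l \<Longrightarrow> eqv k x y"
  by (auto simp: eqv_def intro: mem_antimono)

lemma eqv_mem: "eqv k x y \<Longrightarrow> y \<in> I k \<Longrightarrow> x \<in> I k"
  using add_mem[of "x - y" k y] by (simp add: eqv_def)

lemma eqv_add: "eqv k x y \<Longrightarrow> eqv k x' y' \<Longrightarrow> eqv k (x + x') (y + y')"
  using add_mem[of "x - y" k "x' - y'"] by (simp add: eqv_def algebra_simps)

lemma eqv_diff: "eqv k x y \<Longrightarrow> eqv k x' y' \<Longrightarrow> eqv k (x - x') (y - y')"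
  using diff_mem[of "x - y" k "x' - y'"] by (simp add: eqv_def algebra_simps)

lemma eqv_minus: "eqv k x y \<Longrightarrow> eqv k (- x) (- y)"
  using eqv_diff[of k 0 0 x y] by simp

lemma eqv_sum: "(\<And>i. i \<in> A \<Longrightarrow> eqv k (f i) (g i)) \<Longrightarrow> eqv k (sum f A) (sum g A)"
  using sum_mem[of A "\<lambda>i. f i - g i" k] by (simp add: eqv_def sum_subtractf)

lemma eqv_scale: "c \<in> I l \<Longrightarrow> eqv k x y \<Longrightarrow> eqv (l + k) (c * x) (c * y)"
  using mult_mem[of c l "x - y" k] by (simp add: eqv_def algebra_simps)

lemma eqv_scale0: "c \<in> I 0 \<Longrightarrow> eqv k x y \<Longrightarrow> eqv k (c * x) (c * y)"
  using eqv_scale[of c 0 k] by simp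

lemma eqv_mult:
  assumes "eqv k x y" "eqv k x' y'" "x' \<in> I 0" "y \<in> I 0"
  shows "eqv k (x * x') (y * y')"
proof -
  have "x * x' - y * y' = x' * (x - y) + y * (x' - y')"
    by (simp add: algebra_simps)
  also have "\<dots> \<in> I k"
    using assms by (auto simp: eqv_def intro!: add_mem mult_mem_left)
  finally show ?thesis
    by (simp add: eqv_def)
qed

text \<open>
  Modulo \<open>I 2\<close> the multiplication of elements close to 1 is the addition of their deviations from 1.
  All expansions to first order in \<open>p\<close> below use this.
\<close>
lemma eqv_prod_1_plus:
  assumes "\<And>i. i \<in> A \<Longrightarrow> f i \<in> I 1"
  shows "eqv 2 (\<Prod>i\<in>A. 1 + f i) (1 + (\<Sum>i\<in>A. f i))"
  using assms
proof (induction A rule: infinite_finite_induct)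
  case (insert x A)
  have f: "f x \<in> I 0" "sum f A \<in> I 1"
    using insert by (auto intro: Suc_mem sum_mem)
  have "eqv 2 ((1 + f x) * (\<Prod>i\<in>A. 1 + f i)) ((1 + f x) * (1 + (\<Sum>i\<in>A. f i)))"
    using insert f by (intro eqv_scale0) (auto intro: add_mem one_mem)
  also have "eqv 2 \<dots> (1 + (f x + sum f A))"
    using mult_mem[of "f x" 1 "sum f A" 1] insert f by (simp add: eqv_def algebra_simps numeral_2_eq_2)
  finally show ?case
    using insert by simp
qed auto

lemma eqv_one_plus_mult:
  assumes "eqv 2 x (1 + u)" "eqv 2 y (1 + v)" "u \<in> I 1" "v \<in> I 1"
  shows "eqv 2 (x * y) (1 + (u + v))"
proof -
  have v: "1 + v \<in> I 0" and u: "1 + u \<in> I 0"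
    using assms one_mem Suc_mem by (auto intro: add_mem)
  have y: "y \<in> I 0"
    using eqv_mem[OF eqv_antimono[OF assms(2)] v] by simp
  have "x * y - (1 + (u + v)) = (x - (1 + u)) * y + (1 + u) * (y - (1 + v)) + u * v"
    by (simp add: algebra_simps)
  also have "\<dots> \<in> I 2"
  proof -
    have "(x - (1 + u)) * y \<in> I 2" "(1 + u) * (y - (1 + v)) \<in> I 2"
      using assms(1,2) mult_mem_right[OF _ y] mult_mem_left[OF u] by (simp_all only: eqv_def)
    moreover have "u * v \<in> I 2"
      using mult_mem[OF assms(3,4)] by (simp only: one_add_one)
    ultimately show ?thesis
      by (simp only: add_mem)
  qed
  finally show ?thesis
    by (simp add: eqv_def)
qed

end

definition padic :: "nat \<Rightarrow> nat \<Rightarrow> rat set" where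
  "padic p k = {of_int a / of_int b * of_nat p ^ k | a b. \<not> int p dvd b}"

text \<open>
  Only the first \<open>D\<close> coefficients are controlled. The final identity is needed in a fixed degree
  for all large \<open>p\<close>, and coefficients of degree about \<open>p\<close> do not follow the same pattern.
\<close>
definition fps_padic :: "nat \<Rightarrow> nat \<Rightarrow> nat \<Rightarrow> rat fps set" where
  "fps_padic D p k = {f. \<forall>i<D. fps_nth f i \<in> padic p k}"

lemma padicI: "x = of_int a / of_int b * of_nat p ^ k \<Longrightarrow> \<not> int p dvd b \<Longrightarrow> x \<in> padic p k"
  unfolding padic_def by blast

lemma filtered_ring_padic:
  assumes "prime p"
  shows "filtered_ring (padic p)"
proof
  have pp: "prime (int p)" using assms by simp
  have p1: "\<not> int p dvd 1" using prime_gt_1_nat[OF assms] by simp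
  show "1 \<in> padic p 0"
    using p1 by (intro padicI[of _ 1 1]) simp_all
  show "0 \<in> padic p k" for k
    using p1 by (intro padicI[of _ 0 1]) simp_all
  show "x - y \<in> padic p k" if xy: "x \<in> padic p k" "y \<in> padic p k" for x y k
  proof -
    obtain a b c d where *: "x = of_int a / of_int b * of_nat p ^ k" "\<not> int p dvd b"
      "y = of_int c / of_int d * of_nat p ^ k" "\<not> int p dvd d"
      using xy unfolding padic_def by blast
    then have "b \<noteq> 0" "d \<noteq> 0" by auto
    then have "x - y = of_int (a * d - c * b) / of_int (b * d) * of_nat p ^ k"
      unfolding *(1,3) by (simp add: field_simps)
    moreover have "\<not> int p dvd b * d"
      using * pp by (simp add: prime_dvd_mult_iff)
    ultimately show ?thesis by (rule padicI)
  qed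
  show "x * y \<in> padic p (k + l)" if xy: "x \<in> padic p k" "y \<in> padic p l" for x y k l
  proof -
    obtain a b c d where *: "x = of_int a / of_int b * of_nat p ^ k" "\<not> int p dvd b"
      "y = of_int c / of_int d * of_nat p ^ l" "\<not> int p dvd d"
      using xy unfolding padic_def by blast
    then have "x * y = of_int (a * c) / of_int (b * d) * of_nat p ^ (k + l)"
      by (simp add: power_add)
    moreover have "\<not> int p dvd b * d"
      using * pp by (simp add: prime_dvd_mult_iff)
    ultimately show ?thesis by (rule padicI)
  qed
  show "x \<in> padic p k" if x: "x \<in> padic p (Suc k)" for x k
  proof -
    obtain a b where *: "x = of_int a / of_int b * of_nat p ^ Suc k" "\<not> int p dvd b"
      using x unfolding padic_def by blast
    then have "x = of_int (a * int p) / of_int b * of_nat p ^ k"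
      by simp
    then show ?thesis using *(2) by (rule padicI)
  qed
qed

lemma filtered_ring_fps_padic:
  assumes "prime p"
  shows "filtered_ring (fps_padic D p)"
proof -
  interpret filtered_ring "padic p" using assms by (rule filtered_ring_padic)
  show ?thesis
  proof
    show "x * y \<in> fps_padic D p (k + l)"
      if "x \<in> fps_padic D p k" "y \<in> fps_padic D p l" for x y k l
    proof (unfold fps_padic_def, intro CollectI allI impI)
      fix i assume "i < D"
      then show "fps_nth (x * y) i \<in> padic p (k + l)"
        using that unfolding fps_mult_nth fps_padic_def by (intro sum_mem mult_mem) auto
    qed
    show "x \<in> fps_padic D p k" if "x \<in> fps_padic D p (Suc k)" for x k
      using that Suc_mem unfolding fps_padic_def by blast
  qed (auto simp: fps_padic_def one_mem zero_mem diff_mem)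
qed

locale odd_prime =
  fixes p :: nat
  assumes prime: "prime p" and gt_2: "p > 2"
begin

sublocale R: filtered_ring "padic p"
  by (rule filtered_ring_padic) (rule prime)

lemma p_mem: "of_nat p \<in> padic p 1"
  using gt_2 by (intro padicI[of _ 1 1]) simp_all

lemma inverse_mem: "\<not> p dvd n \<Longrightarrow> 1 / of_nat n \<in> padic p 0"
  by (intro padicI[of _ 1 "int n"]) simp_all

lemma inverse_less_mem: "0 < n \<Longrightarrow> n < p \<Longrightarrow> 1 / of_nat n \<in> padic p 0"
  by (rule inverse_mem) (simp add: nat_dvd_not_less)

lemma divide_mem: "x \<in> padic p k \<Longrightarrow> 0 < n \<Longrightarrow> n < p \<Longrightarrow> x / of_nat n \<in> padic p k"
  using R.mult_mem_right[of x k "1 / of_nat n"] inverse_less_mem by simp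

lemma mem_p_cancel: "of_nat p * x \<in> padic p (Suc k) \<longleftrightarrow> x \<in> padic p k"
proof
  assume "of_nat p * x \<in> padic p (Suc k)"
  then obtain a b where *: "of_nat p * x = of_int a / of_int b * of_nat p ^ Suc k" "\<not> int p dvd b"
    unfolding padic_def by blast
  then have "b \<noteq> 0" by auto
  with * have "x = of_int a / of_int b * of_nat p ^ k"
    using gt_2 by (simp add: field_simps)
  then show "x \<in> padic p k"
    using *(2) by (rule padicI)
next
  assume "x \<in> padic p k"
  then show "of_nat p * x \<in> padic p (Suc k)"
    using R.mult_mem[OF p_mem] by simp
qed

lemma of_int_mem_padic_iff: "of_int a \<in> padic p k \<longleftrightarrow> int p ^ k dvd a"
proof
  assume "of_int a \<in> padic p k"
  then obtain c d where *: "(of_int a :: rat) = of_int c / of_int d * of_nat p ^ k" "\<not> int p dvd d"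
    unfolding padic_def by blast
  then have "d \<noteq> 0" by auto
  with * have "(of_int (a * d) :: rat) = of_int (c * int p ^ k)"
    by (simp add: field_simps)
  then have "a * d = c * int p ^ k"
    by (simp only: of_int_eq_iff)
  moreover have "coprime (int p ^ k) d"
    using * prime by (simp add: prime_imp_coprime coprime_power_left_iff)
  ultimately show "int p ^ k dvd a"
    using coprime_dvd_mult_left_iff[of "int p ^ k" d a] by simp
next
  assume "int p ^ k dvd a"
  then obtain c where "a = int p ^ k * c" ..
  then have "rat_of_int a = of_int c / of_int 1 * of_nat p ^ k"
    by simp
  moreover have "\<not> int p dvd 1"
    using gt_2 by simp
  ultimately show "of_int a \<in> padic p k"
    by (rule padicI)
qed

lemma of_int_eqv_iff: "R.eqv k (of_int a) (of_int b) \<longleftrightarrow> [a = b] (mod int p ^ k)"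
  unfolding R.eqv_def cong_iff_dvd_diff of_int_mem_padic_iff[symmetric] of_int_diff ..

lemma of_nat_eqv_iff: "R.eqv k (of_nat a) (of_nat b) \<longleftrightarrow> [a = b] (mod p ^ k)"
  using of_int_eqv_iff[of k "int a" "int b"]
  unfolding of_int_of_nat_eq of_nat_power[symmetric] cong_int_iff .

end

section \<open>Bernoulli numbers and harmonic sums modulo p\<close>

unbundle fps_syntax

lemma bernoulli_recurrence:
  assumes "n \<ge> 1"
  shows "(\<Sum>k\<le>n. of_nat (Suc n choose k) * bernoulli k) = 0"
proof (cases n)
  case (Suc m)
  have [simp]: "(2 + of_nat m :: rat) \<noteq> 0"
    by (metis add_2_eq_Suc of_nat_Suc of_nat_add of_nat_neq_0 of_nat_numeral)
  have "(\<Sum>k\<le>n. of_nat (Suc n choose k) * bernoulli k) =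
          (\<Sum>k\<le>m. of_nat (Suc (Suc m) choose k) * bernoulli k) + of_nat (m + 2) * bernoulli (Suc m)"
    by (simp only: Suc sum.atMost_Suc binomial_Suc_n) simp
  also have "\<dots> = 0"
    by simp
  finally show ?thesis .
qed (use assms in auto)

declare bernoulli.simps(2) [simp del]

text \<open>
  The generating function turns identities between Bernoulli numbers into manipulations of
  exponential series.
\<close>
lemma fps_bernoulli: "Abs_fps (\<lambda>n. bernoulli n / fact n) * (fps_exp 1 - 1) = fps_X"
proof (rule fps_ext)
  fix n
  show "(Abs_fps (\<lambda>n. bernoulli n / fact n) * (fps_exp 1 - 1)) $ n = (fps_X :: rat fps) $ n"
  proof (cases n)
    case (Suc m)
    have "(Abs_fps (\<lambda>n. bernoulli n / fact n) * (fps_exp 1 - 1)) $ n =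
            (\<Sum>k\<le>m. bernoulli k / fact k * (1 / fact (n - k)))"
      unfolding fps_mult_nth Suc atMost_atLeast0[symmetric] sum.atMost_Suc
      by (auto intro!: sum.cong)
    also have "\<dots> = (\<Sum>k\<le>m. of_nat (Suc m choose k) * bernoulli k) / fact n"
      unfolding sum_divide_distrib Suc
      by (intro sum.cong refl) (simp add: binomial_fact)
    also have "\<dots> = fps_X $ n"
      using bernoulli_recurrence[of m] Suc by (cases "m = 0") auto
    finally show ?thesis .
  qed simp
qed

lemma fps_exp_minus_1_neq_0: "fps_exp (1 :: rat) - 1 \<noteq> 0"
proof
  assume "fps_exp (1 :: rat) - 1 = 0"
  then have "(fps_exp (1 :: rat) - 1) $ 1 = 0 $ 1" by simp
  then show False by simp
qed

text \<open>
  The series \<open>X / (e\<^sup>X - 1)\<close> takes the value \<open>X / (e\<^sup>X - 1) + X\<close> at \<open>- X\<close>.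
\<close>
lemma bernoulli_odd_eq_0:
  assumes "odd n" "n \<noteq> 1"
  shows "bernoulli n = 0"
proof -
  let ?B = "Abs_fps (\<lambda>n. bernoulli n / fact n)"
  let ?B' = "Abs_fps (\<lambda>n. (-1) ^ n * bernoulli n / fact n)"
  have "?B' * (fps_exp (-1) - 1) = - fps_X"
  proof (rule fps_ext)
    fix n
    have "(?B' * (fps_exp (-1) - 1)) $ n = (-1) ^ n * (?B * (fps_exp 1 - 1)) $ n"
      unfolding fps_mult_nth sum_distrib_left
      by (intro sum.cong) (auto simp: power_add[symmetric])
    also have "\<dots> = (- fps_X) $ n"
      by (simp add: fps_bernoulli)
    finally show "(?B' * (fps_exp (-1) - 1)) $ n = (- fps_X) $ n" .
  qed
  moreover have exp1: "fps_exp (-1) * fps_exp (1::rat) = 1"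
    by (simp add: fps_exp_add_mult[symmetric])
  then have "fps_exp (-1) - 1 = - (fps_exp (-1) * (fps_exp (1::rat) - 1))"
    by (simp add: algebra_simps)
  ultimately have "?B' * fps_exp (-1) * (fps_exp 1 - 1) = ?B * (fps_exp 1 - 1)"
    by (simp add: fps_bernoulli mult.assoc)
  then have "?B' * fps_exp (-1) = ?B"
    using fps_exp_minus_1_neq_0 by simp
  then have "?B' * (fps_exp (-1) * fps_exp 1) = ?B * (fps_exp 1 - 1) + ?B"
    by (simp add: algebra_simps)
  then have "?B' = fps_X + ?B"
    unfolding exp1 fps_bernoulli by simp
  then have "?B' $ n = (fps_X + ?B) $ n"
    by simp
  then show ?thesis
    using assms by simp
qed

text \<open>
  This is the coefficient of \<open>X\<close> to the power \<open>m + 1\<close> in the geometric sum of the series \<open>e\<^sup>k\<^sup>X\<close>, multiplied by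
  \<open>X = B(X) (e\<^sup>X - 1)\<close>.
\<close>
lemma faulhaber:
  "(\<Sum>k<n. of_nat k ^ m) =
     (\<Sum>j\<le>m. of_nat (Suc m choose j) * bernoulli j * of_nat n ^ (Suc m - j)) / of_nat (Suc m)"
proof -
  let ?B = "Abs_fps (\<lambda>n. bernoulli n / fact n)"
  let ?n = "of_nat n :: rat"
  have "(fps_exp 1 - 1) * (\<Sum>k<n. fps_exp (1 :: rat) ^ k) = fps_exp 1 ^ n - 1"
    by (rule power_diff_1_eq[symmetric])
  then have "(fps_exp 1 - 1) * (\<Sum>k<n. fps_exp (of_nat k :: rat)) = fps_exp ?n - 1"
    by (simp add: fps_exp_power_mult)
  then have "fps_X * (\<Sum>k<n. fps_exp (of_nat k)) = ?B * (fps_exp ?n - 1)"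
    unfolding fps_bernoulli[symmetric] by (simp add: mult.assoc)
  then have "(fps_X * (\<Sum>k<n. fps_exp (of_nat k))) $ Suc m = (?B * (fps_exp ?n - 1)) $ Suc m"
    by simp
  moreover have "(fps_X * (\<Sum>k<n. fps_exp (of_nat k))) $ Suc m = (\<Sum>k<n. of_nat k ^ m) / (fact m :: rat)"
    by (simp add: fps_sum_nth sum_divide_distrib)
  moreover have "(?B * (fps_exp ?n - 1)) $ Suc m =
      (\<Sum>j\<le>m. bernoulli j / fact j * (?n ^ (Suc m - j) / fact (Suc m - j)))"
    unfolding fps_mult_nth[of ?B] atMost_atLeast0[symmetric] sum.atMost_Suc
    by (auto intro!: sum.cong)
  ultimately have "(\<Sum>k<n. of_nat k ^ m) =
      fact m * (\<Sum>j\<le>m. bernoulli j / fact j * (?n ^ (Suc m - j) / fact (Suc m - j)))"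
    by (simp add: field_simps)
  also have "\<dots> = (\<Sum>j\<le>m. of_nat (Suc m choose j) * bernoulli j * ?n ^ (Suc m - j)) / of_nat (Suc m)"
    unfolding sum_distrib_left sum_divide_distrib
    by (intro sum.cong refl) (simp add: binomial_fact field_simps del: of_nat_Suc)
  finally show ?thesis .
qed

context odd_prime
begin

text \<open>
  The recursion only divides by numbers that are at most \<open>n + 1\<close>.
\<close>
lemma bernoulli_mem: "n + 1 < p \<Longrightarrow> bernoulli n \<in> padic p 0"
proof (induction n rule: less_induct)
  case (less n)
  show ?case
  proof (cases n)
    case (Suc m)
    have "bernoulli n = (- (\<Sum>k\<le>m. of_nat ((m + 2) choose k) * bernoulli k)) / of_nat (m + 2)"
      unfolding Suc bernoulli.simps(2) ..
    also have "\<dots> \<in> padic p 0"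
      using less Suc
      by (intro divide_mem R.uminus_mem R.sum_mem R.mult_mem_left R.of_nat_mem) auto
    finally show ?thesis .
  qed (auto intro: R.one_mem)
qed

definition beta :: "nat \<Rightarrow> rat" where
  "beta w = bernoulli (p - w) / of_nat w"

lemma beta_mem: "1 < w \<Longrightarrow> w < p \<Longrightarrow> beta w \<in> padic p 0"
  unfolding beta_def by (intro divide_mem bernoulli_mem) auto

lemma odd_p: "odd p"
  using prime gt_2 prime_odd_nat by blast

text \<open>
  Here \<open>p - w\<close> is odd, and it is not 1.
\<close>
lemma beta_even: "even w \<Longrightarrow> w + 1 < p \<Longrightarrow> beta w = 0"
  unfolding beta_def using odd_p by (subst bernoulli_odd_eq_0) auto

lemma fermat: "\<not> p dvd n \<Longrightarrow> R.eqv 1 (of_nat n ^ (p - 1)) 1"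
  using fermat_theorem[OF prime, of n] of_nat_eqv_iff[of 1 "n ^ (p - 1)" 1] by simp

lemma not_dvd: "n \<in> {1..<p} \<Longrightarrow> \<not> p dvd n"
  by (auto dest: dvd_imp_le)

text \<open>
  In Faulhaber's formula every term contains \<open>p\<close>, and the Bernoulli numbers that occur are integral.
\<close>
lemma sum_powers_less:
  assumes "1 \<le> m" "m < p - 1"
  shows "(\<Sum>n\<in>{1..<p}. of_nat n ^ m) \<in> padic p 1"
proof -
  have "{..<p} = insert 0 {1..<p}"
    using gt_2 by auto
  then have "(\<Sum>n\<in>{1..<p}. of_nat n ^ m) = (\<Sum>n<p. of_nat n ^ m :: rat)"
    using assms by simp
  also have "\<dots> \<in> padic p 1"
    unfolding faulhaber
  proof (intro divide_mem R.sum_mem R.mult_mem_left bernoulli_mem R.of_nat_mem)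
    fix j assume "j \<in> {..m}"
    then have "(of_nat p ^ (Suc m - j) :: rat) = of_nat p * of_nat p ^ (m - j)"
      by (simp add: Suc_diff_le)
    then show "of_nat p ^ (Suc m - j) \<in> padic p 1"
      using R.mult_mem_right[OF p_mem] R.of_nat_mem[of "p ^ (m - j)"] by simp
  qed (use assms in auto)
  finally show ?thesis .
qed

lemma sum_powers:
  "R.eqv 1 (\<Sum>n\<in>{1..<p}. of_nat n ^ m) (if (p - 1) dvd m then - 1 else 0)"
proof -
  let ?r = "m mod (p - 1)"
  have "R.eqv 1 (\<Sum>n\<in>{1..<p}. of_nat n ^ m) (\<Sum>n\<in>{1..<p}. of_nat n ^ ?r)"
  proof (rule R.eqv_sum)
    fix n assume n: "n \<in> {1..<p}"
    have "[(n ^ (p - 1)) ^ (m div (p - 1)) * n ^ ?r = 1 ^ (m div (p - 1)) * n ^ ?r] (mod p)"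
      using fermat_theorem[OF prime not_dvd[OF n]] by (intro cong_mult cong_pow cong_refl)
    then have "[n ^ m = n ^ ?r] (mod p)"
      by (simp flip: power_mult power_add)
    then show "R.eqv 1 (of_nat n ^ m) (of_nat n ^ ?r)"
      using of_nat_eqv_iff[of 1 "n ^ m" "n ^ ?r"] by simp
  qed
  also have "R.eqv 1 (\<Sum>n\<in>{1..<p}. of_nat n ^ ?r) (if (p - 1) dvd m then - 1 else 0)"
  proof (cases "?r = 0")
    case True
    then have "(\<Sum>n\<in>{1..<p}. of_nat n ^ ?r) - (if (p - 1) dvd m then - 1 else 0) = (of_nat p :: rat)"
      using gt_2 by (simp add: dvd_eq_mod_eq_0 of_nat_diff)
    then show ?thesis
      unfolding R.eqv_def using p_mem by simp
  next
    case False
    then show ?thesis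
      unfolding R.eqv_def using sum_powers_less[of ?r] gt_2 by (simp add: dvd_eq_mod_eq_0)
  qed
  finally show ?thesis .
qed

lemma inverse_power_mem: "n \<in> {1..<p} \<Longrightarrow> 1 / of_nat n ^ j \<in> padic p 0"
  using inverse_mem[of "n ^ j"] not_dvd[of n] prime_dvd_power_nat[OF prime, of n j] by auto

lemma inverse_power:
  assumes "n \<in> {1..<p}" "j \<le> p - 1"
  shows "R.eqv 1 (1 / of_nat n ^ j) (of_nat n ^ (p - 1 - j))"
proof -
  have "R.eqv 1 (1 / of_nat n ^ j * 1) (1 / of_nat n ^ j * of_nat n ^ (p - 1))"
    using inverse_power_mem[of n j] not_dvd assms fermat[of n]
    by (intro R.eqv_scale0 R.eqv_sym[OF fermat]) auto
  also have "1 / of_nat n ^ j * of_nat n ^ (p - 1) = (of_nat n ^ (p - 1 - j) :: rat)"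
  proof -
    have "of_nat n ^ (p - 1) = (of_nat n ^ j * of_nat n ^ (p - 1 - j) :: rat)"
      unfolding power_add[symmetric] using assms by (intro arg_cong[of _ _ "power _"]) simp
    then show ?thesis
      using assms by simp
  qed
  finally show ?thesis by simp
qed

lemma power_sum_inverse_mem:
  assumes "1 \<le> j" "j < p - 1"
  shows "(\<Sum>n\<in>{1..<p}. 1 / of_nat n ^ j) \<in> padic p 1"
proof (rule R.eqv_mem)
  show "R.eqv 1 (\<Sum>n\<in>{1..<p}. 1 / of_nat n ^ j) (\<Sum>n\<in>{1..<p}. of_nat n ^ (p - 1 - j))"
    using assms by (intro R.eqv_sum inverse_power) auto
  show "(\<Sum>n\<in>{1..<p}. of_nat n ^ (p - 1 - j)) \<in> padic p 1"
    using assms by (intro sum_powers_less) auto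
qed

text \<open>
  Modulo \<open>p\<close> the upper entry is \<open>- (a + 1)\<close>, so this is the reflection formula for negative upper entries.
\<close>
lemma binomial_reflect:
  assumes "a + c < p"
  shows "R.eqv 1 (of_nat ((p - 1 - a) choose c)) ((-1) ^ c * of_nat ((a + c) choose c))"
  using assms
proof (induction c)
  case (Suc c)
  let ?x = "of_nat ((p - 1 - a) choose c) :: rat" and ?y = "of_nat ((a + c) choose c) :: rat"
  have 1: "of_nat ((p - 1 - a) choose Suc c) = of_nat (p - Suc (a + c)) * ?x / of_nat (Suc c)"
  proof -
    have "Suc c * ((p - 1 - a) choose Suc c) = ((p - 1 - a) - c) * ((p - 1 - a) choose c)"
      using binomial_absorption[of c "p - 1 - a"] binomial_absorb_comp[of "p - 1 - a" c] by simp
    then have "Suc c * ((p - 1 - a) choose Suc c) = (p - Suc (a + c)) * ((p - 1 - a) choose c)"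
      by simp
    then have "of_nat (Suc c) * of_nat ((p - 1 - a) choose Suc c) = of_nat (p - Suc (a + c)) * ?x"
      by (simp only: of_nat_mult[symmetric])
    then show ?thesis
      by (simp add: field_simps)
  qed
  have 2: "of_nat ((a + Suc c) choose Suc c) = of_nat (Suc (a + c)) * ?y / of_nat (Suc c)"
  proof -
    have "Suc c * ((a + Suc c) choose Suc c) = Suc (a + c) * ((a + c) choose c)"
      using Suc_times_binomial[of c "a + c"] by simp
    then have "of_nat (Suc c) * of_nat ((a + Suc c) choose Suc c) = of_nat (Suc (a + c)) * ?y"
      by (simp only: of_nat_mult[symmetric])
    then show ?thesis
      by (simp add: field_simps)
  qed
  have "R.eqv 1 (of_nat (p - Suc (a + c)) * ?x) (- of_nat (Suc (a + c)) * ((-1) ^ c * ?y))"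
  proof (rule R.eqv_mult)
    have "of_nat (p - Suc (a + c)) - (- of_nat (Suc (a + c))) = (of_nat p :: rat)"
      using Suc.prems by (simp add: of_nat_diff)
    then show "R.eqv 1 (of_nat (p - Suc (a + c))) (- of_nat (Suc (a + c)))"
      unfolding R.eqv_def using p_mem by simp
    show "R.eqv 1 ?x ((-1) ^ c * ?y)"
      using Suc by simp
  qed (auto intro!: R.of_nat_mem R.uminus_mem simp del: of_nat_Suc)
  then have "R.eqv 1 (1 / of_nat (Suc c) * (of_nat (p - Suc (a + c)) * ?x))
     (1 / of_nat (Suc c) * (- of_nat (Suc (a + c)) * ((-1) ^ c * ?y)))"
    using Suc.prems by (intro R.eqv_scale0 inverse_less_mem) auto
  moreover have "1 / of_nat (Suc c) * (of_nat (p - Suc (a + c)) * ?x) = of_nat ((p - 1 - a) choose Suc c)"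
    unfolding 1 by simp
  moreover have "1 / of_nat (Suc c) * (- of_nat (Suc (a + c)) * ((-1) ^ c * ?y)) =
      (-1) ^ Suc c * of_nat ((a + Suc c) choose Suc c)"
    unfolding 2 by (simp del: of_nat_Suc)
  ultimately show ?case
    by simp
qed simp

text \<open>
  By Fermat's theorem \<open>1 / k\<^sup>a\<close> may be replaced by \<open>k\<close> to the power \<open>p - 1 - a\<close>. Faulhaber's formula evaluates the inner
  sum as a polynomial in \<open>n\<close>, and summing over \<open>n\<close> retains only the term whose exponent is divisible
  by \<open>p - 1\<close>. It carries the Bernoulli number with index \<open>p - a - b\<close>. The terms with \<open>k = n\<close> contribute
  a power sum, which vanishes modulo \<open>p\<close>.
\<close>
lemma double_harmonic_sum:
  assumes "1 \<le> a" "1 \<le> b" "a + b + 1 < p"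
  shows "R.eqv 1 (\<Sum>n\<in>{1..<p}. \<Sum>k\<in>{1..n}. 1 / (of_nat k ^ a * of_nat n ^ b))
           ((-1) ^ b * of_nat ((a + b) choose a) * beta (a + b))"
proof -
  define m where "m = p - 1 - a"
  have m: "1 \<le> m" "Suc m < p" "Suc m = p - a"
    using assms by (auto simp: m_def)
  \<comment> \<open>The coefficients of Faulhaber's polynomial for the exponent \<open>m\<close>.\<close>
  define c where "c j = of_nat (Suc m choose j) * bernoulli j / of_nat (Suc m)" for j
  have c_mem: "c j \<in> padic p 0" if "j \<le> m" for j
    unfolding c_def using that m
    by (intro divide_mem R.mult_mem_left R.of_nat_mem bernoulli_mem) auto
  have "R.eqv 1 (\<Sum>n\<in>{1..<p}. \<Sum>k\<in>{1..n}. 1 / (of_nat k ^ a * of_nat n ^ b))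
          (\<Sum>n\<in>{1..<p}. of_nat n ^ (p - 1 - b) * (\<Sum>k<n. of_nat k ^ m) + 1 / of_nat n ^ (a + b))"
  proof (rule R.eqv_sum)
    fix n assume n: "n \<in> {1..<p}"
    have "{1..n} = insert n {1..<n}"
      using n by auto
    then have "(\<Sum>k\<in>{1..n}. 1 / (of_nat k ^ a * of_nat n ^ b)) =
        1 / of_nat n ^ b * (\<Sum>k\<in>{1..<n}. 1 / of_nat k ^ a) + (1 / of_nat n ^ (a + b) :: rat)"
      by (simp add: sum_distrib_left power_add mult.commute)
    also have "R.eqv 1 \<dots> (of_nat n ^ (p - 1 - b) * (\<Sum>k\<in>{1..<n}. of_nat k ^ m) + 1 / of_nat n ^ (a + b))"
      unfolding m_def using n assms
      by (intro R.eqv_add R.eqv_mult R.eqv_refl inverse_power R.eqv_sum R.sum_mem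
            R.power_mem R.of_nat_mem inverse_power_mem) auto
    also have "(\<Sum>k\<in>{1..<n}. of_nat k ^ m) = (\<Sum>k<n. of_nat k ^ m :: rat)"
      by (rule sum.mono_neutral_left) (use m in \<open>auto simp: Suc_le_eq\<close>)
    finally show "R.eqv 1 (\<Sum>k\<in>{1..n}. 1 / (of_nat k ^ a * of_nat n ^ b))
                     (of_nat n ^ (p - 1 - b) * (\<Sum>k<n. of_nat k ^ m) + 1 / of_nat n ^ (a + b))" .
  qed
  also have "R.eqv 1 \<dots> (\<Sum>n\<in>{1..<p}. of_nat n ^ (p - 1 - b) * (\<Sum>k<n. of_nat k ^ m))"
    using power_sum_inverse_mem[of "a + b"] assms by (simp add: R.eqv_def sum.distrib)
  also have "(\<Sum>n\<in>{1..<p}. of_nat n ^ (p - 1 - b) * (\<Sum>k<n. of_nat k ^ m)) =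
     (\<Sum>n\<in>{1..<p}. \<Sum>j\<le>m. c j * of_nat n ^ (p - 1 - b + (Suc m - j)))"
    unfolding faulhaber sum_distrib_left sum_divide_distrib
    by (intro sum.cong refl) (simp only: c_def power_add divide_inverse ac_simps)
  also have "\<dots> = (\<Sum>j\<le>m. c j * (\<Sum>n\<in>{1..<p}. of_nat n ^ (p - 1 - b + (Suc m - j))))"
    unfolding sum_distrib_left by (rule sum.swap)
  also have "R.eqv 1 \<dots> (\<Sum>j\<le>m. c j * (if (p - 1) dvd (p - 1 - b + (Suc m - j)) then -1 else 0))"
    by (intro R.eqv_sum R.eqv_scale0 c_mem sum_powers) auto
  also have "\<dots> = (\<Sum>j\<le>m. if j = p - a - b then - c j else 0)"
  proof (intro sum.cong refl)
    fix j assume j: "j \<in> {..m}"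
    have "(p - 1) dvd (p - 1 - b + (Suc m - j)) \<longleftrightarrow> j = p - a - b"
    proof
      assume "(p - 1) dvd (p - 1 - b + (Suc m - j))"
      then obtain q where q: "p - 1 - b + (Suc m - j) = (p - 1) * q" ..
      have "p - 1 - b + (Suc m - j) < (p - 1) * 2" "p - 1 - b + (Suc m - j) > 0"
        using assms m by auto
      then have "q < 2" "q > 0"
        unfolding q by auto
      then have "q = 1" by simp
      then show "j = p - a - b"
        using q assms m j by simp
    next
      assume "j = p - a - b"
      then have "p - 1 - b + (Suc m - j) = p - 1"
        using m assms by simp
      then show "(p - 1) dvd (p - 1 - b + (Suc m - j))" by simp
    qed
    then show "c j * (if (p - 1) dvd (p - 1 - b + (Suc m - j)) then -1 else 0) =
                 (if j = p - a - b then - c j else 0)"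
      by simp
  qed
  also have "\<dots> = - c (p - a - b)"
    using assms m by (simp add: sum.delta)
  also have "\<dots> = (- (1 / of_nat b) * bernoulli (p - (a + b))) * of_nat ((p - 1 - a) choose (b - 1))"
  proof -
    have "(Suc m choose (p - a - b)) = (Suc m choose b)"
      using binomial_symmetric[of b "Suc m"] m assms by simp
    moreover have "b * (Suc m choose b) = Suc m * (m choose (b - 1))"
      using Suc_times_binomial[of "b - 1" m] assms by simp
    then have "of_nat b * of_nat (Suc m choose b) = (of_nat (Suc m) * of_nat (m choose (b - 1)) :: rat)"
      by (simp only: of_nat_mult[symmetric])
    then have "of_nat (Suc m choose b) / of_nat (Suc m) = (of_nat (m choose (b - 1)) / of_nat b :: rat)"
      using assms by (simp add: field_simps del: of_nat_Suc)
    moreover have "c (p - a - b) =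
        of_nat (Suc m choose (p - a - b)) / of_nat (Suc m) * bernoulli (p - (a + b))"
      by (simp add: c_def)
    ultimately show ?thesis
      by (simp add: m_def del: of_nat_Suc)
  qed
  also have "R.eqv 1 \<dots> ((- (1 / of_nat b) * bernoulli (p - (a + b))) *
      ((-1) ^ (b - 1) * of_nat ((a + (b - 1)) choose (b - 1))))"
    using assms by (intro R.eqv_scale0 binomial_reflect R.mult_mem_left R.uminus_mem
        inverse_less_mem bernoulli_mem) auto
  also have "\<dots> = (-1) ^ b * of_nat ((a + b) choose a) * beta (a + b)"
  proof -
    have "b * ((a + b) choose b) = (a + b) * ((a + (b - 1)) choose (b - 1))"
      using Suc_times_binomial[of "b - 1" "a + b - 1"] assms by simp
    then have "of_nat b * of_nat ((a + b) choose b) =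
        (of_nat (a + b) * of_nat ((a + (b - 1)) choose (b - 1)) :: rat)"
      by (simp only: of_nat_mult[symmetric])
    then have "of_nat ((a + (b - 1)) choose (b - 1)) / of_nat b = (of_nat ((a + b) choose b) / of_nat (a + b) :: rat)"
      using assms by (simp add: field_simps del: of_nat_add)
    moreover have "(a + b) choose a = (a + b) choose b"
      using binomial_symmetric[of a "a + b"] by simp
    moreover have "(-1 :: rat) ^ b = - ((-1) ^ (b - 1))"
      using assms by (cases b) auto
    moreover have "(- (1 / of_nat b) * B) * (s * C) = - s * (C / of_nat b) * B" for B C s :: rat
      by simp
    ultimately show ?thesis
      by (simp only: beta_def) simp
  qed
  finally show ?thesis .
qed

end

section \<open>The elementary symmetric functions of 1, 1/2, ..., 1/(p-1) modulo the square of p\<close>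

text \<open>
  Both sides contain the product of \<open>r + k\<close> over a range of \<open>k\<close>, and the shift telescopes.
\<close>
lemma prod_one_plus_shift:
  fixes r :: "'a :: field_char_0"
  shows "(r + 1) * (\<Prod>k\<in>{1..<Suc n}. 1 + (r + 1) / of_nat k) * r =
           r * (\<Prod>k\<in>{1..<Suc n}. 1 + r / of_nat k) * (of_nat (Suc n) + r)"
proof (induction n)
  case (Suc n)
  let ?P = "\<lambda>r n. \<Prod>k\<in>{1..<Suc n}. 1 + r / of_nat k :: 'a"
  have step: "?P x (Suc n) = ?P x n * ((of_nat (Suc n) + x) / of_nat (Suc n))" for x
    by (simp add: field_simps del: of_nat_Suc)
  have "(r + 1) * ?P (r + 1) (Suc n) * r =
      ((r + 1) * ?P (r + 1) n * r) * ((of_nat (Suc n) + (r + 1)) / of_nat (Suc n))"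
    unfolding step by (simp add: mult_ac del: of_nat_Suc)
  also have "\<dots> = r * ?P r (Suc n) * (of_nat (Suc n) + (r + 1))"
    unfolding Suc step by (simp add: mult_ac del: of_nat_Suc)
  finally show ?case
    by (simp add: add_ac)
qed (simp add: algebra_simps)

context odd_prime
begin

text \<open>
  Summation of the polynomial over all nonzero residues with weight \<open>n\<close> to the power \<open>- i\<close> picks out the coefficients whose index is
  congruent to \<open>i\<close> modulo \<open>p - 1\<close>.
\<close>
lemma weighted_power_sum:
  assumes c: "\<And>j. j \<in> {1..p} \<Longrightarrow> c j \<in> padic p k"
    and vanish: "\<And>n. n \<in> {1..<p} \<Longrightarrow> (\<Sum>j\<in>{1..p}. c j * of_nat n ^ j) \<in> padic p (Suc k)"
    and i: "i < p"
  shows "(\<Sum>j\<in>{1..p}. c j * (if (p - 1) dvd (p - 1 - i + j) then 1 else 0)) \<in> padic p (Suc k)"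
proof -
  let ?d = "\<lambda>j. if (p - 1) dvd (p - 1 - i + j) then -1 else 0 :: rat"
  have "(\<Sum>n\<in>{1..<p}. of_nat n ^ (p - 1 - i) * (\<Sum>j\<in>{1..p}. c j * of_nat n ^ j)) \<in> padic p (Suc k)"
    using R.of_nat_mem by (intro R.sum_mem R.mult_mem_left vanish R.power_mem) auto
  also have "(\<Sum>n\<in>{1..<p}. of_nat n ^ (p - 1 - i) * (\<Sum>j\<in>{1..p}. c j * of_nat n ^ j)) =
      (\<Sum>n\<in>{1..<p}. \<Sum>j\<in>{1..p}. c j * of_nat n ^ (p - 1 - i + j))"
    by (simp only: sum_distrib_left power_add ac_simps)
  also have "\<dots> = (\<Sum>j\<in>{1..p}. c j * (\<Sum>n\<in>{1..<p}. of_nat n ^ (p - 1 - i + j)))"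
    unfolding sum_distrib_left by (rule sum.swap)
  finally have "(\<Sum>j\<in>{1..p}. c j * (\<Sum>n\<in>{1..<p}. of_nat n ^ (p - 1 - i + j))) \<in> padic p (Suc k)" .
  moreover have "R.eqv (k + 1) (\<Sum>j\<in>{1..p}. c j * ?d j)
      (\<Sum>j\<in>{1..p}. c j * (\<Sum>n\<in>{1..<p}. of_nat n ^ (p - 1 - i + j)))"
    by (intro R.eqv_sum R.eqv_scale c R.eqv_sym[OF sum_powers])
  ultimately have "(\<Sum>j\<in>{1..p}. c j * ?d j) \<in> padic p (Suc k)"
    using R.eqv_mem by simp
  from R.uminus_mem[OF this] show ?thesis
    unfolding sum_negf[symmetric] by (simp add: if_distrib cong: if_cong)
qed

lemma dvd_shift_iff:
  assumes "i \<in> {1..<p}" "j \<in> {1..p}"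
  shows "(p - 1) dvd (p - 1 - i + j) \<longleftrightarrow> j = i \<or> i = 1 \<and> j = p"
proof
  assume "(p - 1) dvd (p - 1 - i + j)"
  then obtain q where q: "p - 1 - i + j = (p - 1) * q" ..
  have "p - 1 - i + j < (p - 1) * 3" "p - 1 - i + j > 0"
    using assms gt_2 by auto
  then have "q < 3" "q > 0"
    unfolding q by auto
  then consider "q = 1" | "q = 2" by linarith
  then show "j = i \<or> i = 1 \<and> j = p"
    using q assms by cases auto
next
  assume "j = i \<or> i = 1 \<and> j = p"
  then have "p - 1 - i + j = p - 1 \<or> p - 1 - i + j = (p - 1) * 2"
    using assms gt_2 by auto
  then show "(p - 1) dvd (p - 1 - i + j)"
    by auto
qed

text \<open>
  Only the indices 1 and \<open>p\<close> are congruent modulo \<open>p - 1\<close>, so all other coefficients are determined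
  individually by the values at the residues.
\<close>
lemma coefficients_vanish:
  assumes c: "\<And>j. j \<in> {1..p} \<Longrightarrow> c j \<in> padic p k"
    and vanish: "\<And>n. n \<in> {1..<p} \<Longrightarrow> (\<Sum>j\<in>{1..p}. c j * of_nat n ^ j) \<in> padic p (Suc k)"
  shows "i \<in> {2..<p} \<Longrightarrow> c i \<in> padic p (Suc k)"
    and "c 1 + c p \<in> padic p (Suc k)"
proof -
  assume i: "i \<in> {2..<p}"
  have "(\<Sum>j\<in>{1..p}. c j * (if (p - 1) dvd (p - 1 - i + j) then 1 else 0)) =
      (\<Sum>j\<in>{1..p}. if j = i then c j else 0)"
    using i by (intro sum.cong refl) (subst dvd_shift_iff, auto)
  also have "\<dots> = c i"
    using i by (subst sum.delta) auto
  finally show "c i \<in> padic p (Suc k)"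
    using weighted_power_sum[of c k i] c vanish i by simp
next
  have "(\<Sum>j\<in>{1..p}. c j * (if (p - 1) dvd (p - 1 - 1 + j) then 1 else 0)) =
      (\<Sum>j\<in>{1..p}. (if j = 1 then c j else 0) + (if j = p then c j else 0))"
    using gt_2 by (intro sum.cong refl) (subst dvd_shift_iff, auto)
  also have "\<dots> = c 1 + c p"
    using gt_2 unfolding sum.distrib by (simp add: sum.delta)
  finally show "c 1 + c p \<in> padic p (Suc k)"
    using weighted_power_sum[of c k 1] c vanish gt_2 by simp
qed

text \<open>
  Each step gains one power of \<open>p\<close>. The shift by two degrees moves all coefficients into the range in which
  \<open>coefficients_vanish\<close> separates them.
\<close>
lemma polynomial_vanish:
  assumes "\<And>i. i \<le> D \<Longrightarrow> c i \<in> padic p 0" "D + 3 \<le> p"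
    and "\<And>n. n \<in> {1..<p} \<Longrightarrow> (\<Sum>i\<le>D. c i * of_nat n ^ i) \<in> padic p k"
    and "i \<le> D"
  shows "c i \<in> padic p k"
  using assms(3,4)
proof (induction k arbitrary: i)
  case (Suc k)
  define c' where "c' j = (if j \<in> {2..D + 2} then c (j - 2) else 0)" for j
  have c_mem: "c i \<in> padic p k" if "i \<le> D" for i
    using Suc.prems that by (intro Suc.IH) (auto intro: R.Suc_mem)
  have "c' (i + 2) \<in> padic p (Suc k)"
  proof (rule coefficients_vanish(1))
    show "c' j \<in> padic p k" for j
      unfolding c'_def using c_mem by (auto intro: R.zero_mem)
    fix n assume n: "n \<in> {1..<p}"
    have "(\<Sum>j\<in>{1..p}. c' j * of_nat n ^ j) = (\<Sum>j\<in>{0+2..D+2}. c' j * of_nat n ^ j)"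
      using assms(2) by (intro sum.mono_neutral_right) (auto simp: c'_def)
    also have "\<dots> = (\<Sum>i\<le>D. c' (i + 2) * of_nat n ^ (i + 2))"
      unfolding sum.shift_bounds_cl_nat_ivl atMost_atLeast0 ..
    also have "\<dots> = of_nat n ^ 2 * (\<Sum>i\<le>D. c i * of_nat n ^ i)"
      unfolding sum_distrib_left by (intro sum.cong) (auto simp: c'_def power_add power2_eq_square)
    also have "\<dots> \<in> padic p (Suc k)"
      using Suc.prems n by (intro R.mult_mem_left R.power_mem R.of_nat_mem) auto
    finally show "(\<Sum>j\<in>{1..p}. c' j * of_nat n ^ j) \<in> padic p (Suc k)" .
  qed (use Suc.prems assms(2) in auto)
  then show ?case
    using Suc.prems by (simp add: c'_def)
qed (use assms(1) in auto)

text \<open>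
  The coefficients are the elementary symmetric functions of 1, 1/2, ..., 1/(p-1).
\<close>
definition E_poly :: "rat poly" where
  "E_poly = (\<Prod>k\<in>{1..<p}. [:1, 1 / of_nat k:])"

lemma poly_E_poly: "poly E_poly x = (\<Prod>k\<in>{1..<p}. 1 + x / of_nat k)"
  by (simp add: E_poly_def poly_prod)

lemma degree_E_poly: "degree E_poly = p - 1"
proof -
  have "degree E_poly = (\<Sum>k\<in>{1..<p}. degree [:1, 1 / rat_of_nat k:])"
    unfolding E_poly_def by (rule degree_prod_eq_sum_degree) auto
  also have "\<dots> = (\<Sum>k\<in>{1..<p}. 1)"
    by (intro sum.cong) auto
  finally show ?thesis by simp
qed

lemma coeff_E_poly_0: "coeff E_poly 0 = 1"
  by (simp add: poly_E_poly flip: poly_0_coeff_0)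

lemma coeff_E_poly_top: "coeff E_poly (p - 1) = 1 / fact (p - 1)"
proof -
  have "coeff E_poly (p - 1) = lead_coeff E_poly"
    by (simp add: degree_E_poly)
  also have "\<dots> = (\<Prod>k\<in>{1..<p}. 1 / of_nat k)"
    unfolding E_poly_def lead_coeff_prod by (intro prod.cong) auto
  also have "{1..<p} = {1..p - 1}"
    using gt_2 by auto
  finally show ?thesis
    by (simp add: fact_prod prod_dividef)
qed

lemma coeff_E_poly_mem: "coeff E_poly j \<in> padic p 0"
proof -
  have "coeff (\<Prod>k\<in>A. [:1, 1 / rat_of_nat k:]) j \<in> padic p 0" if "A \<subseteq> {1..<p}" for A j
    using finite_subset[OF that finite_atLeastLessThan] that
  proof (induction A arbitrary: j rule: finite_induct)
    case (insert k A)
    then have "1 / rat_of_nat k \<in> padic p 0"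
      by (intro inverse_less_mem) auto
    then have "coeff [:1, 1 / rat_of_nat k:] i \<in> padic p 0" for i
      by (auto simp: coeff_pCons R.one_mem R.zero_mem split: nat.split)
    then have "coeff ([:1, 1 / rat_of_nat k:] * (\<Prod>k\<in>A. [:1, 1 / rat_of_nat k:])) j \<in> padic p 0"
      unfolding coeff_mult using insert by (intro R.sum_mem R.mult_mem_left) auto
    then show ?case
      unfolding prod.insert[OF insert(1,2)] .
  qed (auto simp: R.one_mem R.zero_mem)
  then show ?thesis
    unfolding E_poly_def by simp
qed

text \<open>
  The left-hand side is \<open>p (p + 1) \<cdots> (p + r - 1) / (r - 1)!\<close>. Its quotients for consecutive \<open>r\<close> are
  \<open>1 + p / r\<close>, and it is itself divisible by \<open>p\<close>.
\<close>
lemma E_poly_at_residue: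
  assumes "r \<in> {1..<p}"
  shows "R.eqv 2 (of_nat r * poly E_poly (of_nat r)) (of_nat p)"
proof -
  let ?f = "\<lambda>r. of_nat r * poly E_poly (of_nat r)"
  have "?f (Suc n) \<in> padic p 1 \<and> R.eqv 2 (?f (Suc n)) (of_nat p)" if "Suc n < p" for n
    using that
  proof (induction n)
    case 0
    have "(\<Prod>k\<in>{1..<Suc n}. 1 + 1 / rat_of_nat k) = of_nat (Suc n)" for n
      by (induction n) (simp_all add: field_simps)
    from this[of "p - 1"] have "?f 1 = of_nat p"
      using gt_2 by (simp add: poly_E_poly)
    then show ?case
      using p_mem by simp
  next
    case (Suc n)
    let ?r = "of_nat (Suc n) :: rat"
    have "?f (Suc (Suc n)) * ?r = ?f (Suc n) * (of_nat p + ?r)"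
      using prod_one_plus_shift[of ?r "p - 1"] gt_2 by (simp add: poly_E_poly add_ac)
    then have *: "?f (Suc (Suc n)) = ?f (Suc n) + 1 / ?r * (?f (Suc n) * of_nat p)"
    proof -
      have "x = y + 1 / r * (y * q)" if "x * r = y * (q + r)" "r \<noteq> 0" for x y q r :: rat
        using that by (simp add: field_simps)
      then show ?thesis
        using \<open>?f (Suc (Suc n)) * ?r = ?f (Suc n) * (of_nat p + ?r)\<close> of_nat_neq_0 by blast
    qed
    have "?f (Suc n) * of_nat p \<in> padic p 2"
      using R.mult_mem[OF _ p_mem, of "?f (Suc n)" 1] Suc by (simp add: numeral_2_eq_2)
    moreover have "1 / ?r \<in> padic p 0"
      using Suc.prems by (intro inverse_less_mem) auto
    ultimately have "1 / ?r * (?f (Suc n) * of_nat p) \<in> padic p 2"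
      by (rule R.mult_mem_left[rotated])
    then have "R.eqv 2 (?f (Suc (Suc n))) (?f (Suc n))"
      unfolding * R.eqv_def by simp
    then have 1: "R.eqv 2 (?f (Suc (Suc n))) (of_nat p)"
      using Suc R.eqv_trans by simp
    then have "R.eqv 1 (?f (Suc (Suc n))) (of_nat p)"
      by (rule R.eqv_antimono) simp
    then show ?case
      using 1 p_mem R.eqv_mem by blast
  qed
  from this[of "r - 1"] assms show ?thesis by auto
qed

lemma wilson: "1 / fact (p - 1) + 1 \<in> padic p 1"
proof -
  have "[fact (p - 1) = -1] (mod int p)"
    using wilson_theorem[OF prime] by simp
  then have "R.eqv 1 (of_int (fact (p - 1))) (of_int (-1))"
    unfolding of_int_eqv_iff by simp
  then have "fact (p - 1) + 1 \<in> padic p 1"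
    by (simp add: R.eqv_def)
  moreover have "1 / of_nat (fact (p - 1)) \<in> padic p 0"
    using gt_2 by (intro inverse_mem) (simp add: prime_dvd_fact_iff[OF prime])
  ultimately have "1 / of_nat (fact (p - 1)) * (fact (p - 1) + 1) \<in> padic p 1"
    by (intro R.mult_mem_left)
  then show ?thesis
    by (simp add: field_simps)
qed

text \<open>
  At a residue \<open>r\<close> the polynomial \<open>X E(X)\<close> takes the value \<open>p\<close> modulo \<open>p\<^sup>2\<close>, and \<open>p\<close> times Faulhaber's
  polynomial for the exponent \<open>p - 1\<close> takes the value \<open>p (r - 1)\<close>. So the sum of the two, minus \<open>p X\<close>, vanishes
  at all nonzero residues modulo \<open>p\<^sup>2\<close>. As its degree is at most \<open>p\<close>, its coefficients in the degrees
  2, ..., \<open>p - 1\<close> vanish modulo \<open>p\<^sup>2\<close>, and comparing coefficients gives the claim. All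
  Bernoulli numbers that enter have an index below \<open>p\<close>.
\<close>
lemma coeff_E_poly:
  assumes "1 \<le> j" "j + 2 < p"
  shows "R.eqv 2 (coeff E_poly j) (- (of_nat p * beta (Suc j)))"
proof -
  \<comment> \<open>The coefficients of \<open>X E(X) + p S(X) - p X\<close>, where \<open>S\<close> is Faulhaber's polynomial.\<close>
  define w where
    "w i = coeff E_poly (i - 1) + of_nat (p choose (p - i)) * bernoulli (p - i) - (if i = 1 then of_nat p else 0)" for i
  have W: "(\<Sum>i\<in>{1..p}. w i * of_nat r ^ i) =
      of_nat r * poly E_poly (of_nat r) + of_nat p * (\<Sum>k<r. of_nat k ^ (p - 1)) - of_nat p * of_nat r" for r
  proof -
    have "of_nat r * poly E_poly (of_nat r) = (\<Sum>i\<le>p - 1. coeff E_poly i * of_nat r ^ Suc i)"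
      by (simp add: poly_altdef degree_E_poly sum_distrib_left mult_ac)
    also have "\<dots> = (\<Sum>i\<in>{1..p}. coeff E_poly (i - 1) * of_nat r ^ i)"
      by (rule sum.reindex_bij_witness[of _ "\<lambda>i. i - 1" Suc]) (use gt_2 in auto)
    finally have 1: "of_nat r * poly E_poly (of_nat r) = (\<Sum>i\<in>{1..p}. coeff E_poly (i - 1) * of_nat r ^ i)" .
    have "of_nat p * (\<Sum>k<r. of_nat k ^ (p - 1)) =
        (\<Sum>j\<le>p - 1. of_nat (p choose j) * bernoulli j * of_nat r ^ (p - j))"
    proof -
      have "Suc (p - 1) = p" using gt_2 by simp
      then show ?thesis
        unfolding faulhaber by simp
    qed
    also have "\<dots> = (\<Sum>i\<in>{1..p}. of_nat (p choose (p - i)) * bernoulli (p - i) * of_nat r ^ i)"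
      by (rule sum.reindex_bij_witness[of _ "\<lambda>i. p - i" "\<lambda>i. p - i"]) (use gt_2 in auto)
    finally have 2: "of_nat p * (\<Sum>k<r. of_nat k ^ (p - 1)) =
        (\<Sum>i\<in>{1..p}. of_nat (p choose (p - i)) * bernoulli (p - i) * of_nat r ^ i)" .
    have "(\<Sum>i\<in>{1..p}. (if i = 1 then of_nat p else 0) * of_nat r ^ i) =
        (\<Sum>i\<in>{1..p}. if i = 1 then of_nat p * of_nat r ^ i else 0 :: rat)"
      by (intro sum.cong) auto
    also have "\<dots> = of_nat p * of_nat r"
      using gt_2 by (subst sum.delta) auto
    finally show ?thesis
      unfolding 1 2 w_def ring_distribs sum.distrib sum_subtractf by simp
  qed
  have W_mem: "(\<Sum>i\<in>{1..p}. w i * of_nat r ^ i) \<in> padic p 2" if r: "r \<in> {1..<p}" for r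
  proof -
    have "(\<Sum>k<r. of_nat k ^ (p - 1)) = (\<Sum>k\<in>{1..<r}. of_nat k ^ (p - 1) :: rat)"
      by (rule sum.mono_neutral_right) (use gt_2 in \<open>auto simp: Suc_le_eq\<close>)
    also have "R.eqv 1 \<dots> (\<Sum>k\<in>{1..<r}. 1)"
      using r by (intro R.eqv_sum fermat not_dvd) auto
    also have "(\<Sum>k\<in>{1..<r}. 1) = (of_nat r - 1 :: rat)"
      using r by (simp add: of_nat_diff)
    finally have "R.eqv 2 (of_nat p * (\<Sum>k<r. of_nat k ^ (p - 1))) (of_nat p * (of_nat r - 1))"
      using R.eqv_scale[OF p_mem, of 1] by (simp add: numeral_2_eq_2)
    from R.eqv_diff[OF R.eqv_add[OF E_poly_at_residue[OF r] this] R.eqv_refl[of 2 "of_nat p * of_nat r"]]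
    show ?thesis
      unfolding W by (simp add: R.eqv_def algebra_simps)
  qed
  \<comment> \<open>The leading coefficient needs Wilson's theorem: its index is congruent to 1 modulo \<open>p - 1\<close>,
    so the values at the residues only determine the sum \<open>w 1 + w p\<close>.\<close>
  have w_p: "w p \<in> padic p 1"
    using wilson coeff_E_poly_top gt_2 by (simp add: w_def)
  have w0: "w i \<in> padic p 0" if "i \<in> {2..p}" for i
    unfolding w_def using that
    by (auto intro!: R.add_mem R.mult_mem_left R.of_nat_mem coeff_E_poly_mem bernoulli_mem)
  have "{1..p} = insert 1 {2..p}"
    using gt_2 by auto
  then have "w 1 = (\<Sum>i\<in>{1..p}. w i * of_nat 1 ^ i) - (\<Sum>i\<in>{2..p}. w i)"
    by simp
  also have "\<dots> \<in> padic p 0"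
  proof (rule R.diff_mem)
    show "(\<Sum>i\<in>{1..p}. w i * of_nat 1 ^ i) \<in> padic p 0"
      using R.mem_antimono[OF W_mem[of 1], of 0] gt_2 by simp
    show "(\<Sum>i\<in>{2..p}. w i) \<in> padic p 0"
      by (rule R.sum_mem) (rule w0)
  qed
  \<comment> \<open>The coefficient \<open>w 1\<close> contains \<open>p\<close> times the Bernoulli number of index \<open>p - 1\<close>. It is
    integral because the other coefficients and the value at 1 are.\<close>
  finally have w0': "w i \<in> padic p 0" if "i \<in> {1..p}" for i
    using that w0[of i] by (cases "i = 1") auto
  have W_mem1: "(\<Sum>i\<in>{1..p}. w i * of_nat r ^ i) \<in> padic p (Suc 0)" if "r \<in> {1..<p}" for r
    using R.mem_antimono[OF W_mem[OF that], of 1] by simp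
  have w1: "w i \<in> padic p 1" if "i \<in> {2..<p}" for i
    using coefficients_vanish(1)[OF w0' W_mem1 that] by simp
  have "w 1 + w p \<in> padic p 1"
    using coefficients_vanish(2)[OF w0' W_mem1] by simp
  from R.diff_mem[OF this w_p] have "w 1 \<in> padic p 1"
    by simp
  then have w1': "w i \<in> padic p 1" if "i \<in> {1..p}" for i
    using that w1[of i] w_p by (cases "i = 1"; cases "i = p") auto
  have "w (Suc j) \<in> padic p (Suc 1)"
  proof (rule coefficients_vanish(1)[OF w1'])
    show "(\<Sum>i\<in>{1..p}. w i * of_nat n ^ i) \<in> padic p (Suc 1)" if "n \<in> {1..<p}" for n
      using W_mem[OF that] by (simp add: numeral_2_eq_2)
  qed (use assms in auto)
  then have "R.eqv 2 (coeff E_poly j) (- (of_nat (p choose (p - Suc j)) * bernoulli (p - Suc j)))"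
    using assms by (simp add: w_def R.eqv_def numeral_2_eq_2)
  also have "of_nat (p choose (p - Suc j)) * bernoulli (p - Suc j) =
      of_nat p * (beta (Suc j) * of_nat ((p - 1) choose j))"
  proof -
    have "(p choose (p - Suc j)) = (p choose Suc j)"
      using binomial_symmetric[of "Suc j" p] assms by simp
    moreover have "Suc j * (p choose Suc j) = p * ((p - 1) choose j)"
      using Suc_times_binomial[of j "p - 1"] gt_2 by simp
    then have "of_nat (Suc j) * of_nat (p choose Suc j) = (of_nat p * of_nat ((p - 1) choose j) :: rat)"
      by (simp only: of_nat_mult[symmetric])
    ultimately show ?thesis
      by (simp add: beta_def field_simps del: of_nat_Suc)
  qed
  also have "R.eqv 2 (- \<dots>) (- (of_nat p * (beta (Suc j) * (-1) ^ j)))"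
    using assms R.eqv_scale[OF p_mem R.eqv_scale0[OF beta_mem binomial_reflect[of 0 j]]]
    by (intro R.eqv_minus) (simp add: numeral_2_eq_2)
  also have "beta (Suc j) * (-1) ^ j = beta (Suc j)"
    using beta_even[of "Suc j"] assms by (cases "even j") auto
  finally show ?thesis .
qed

end

section \<open>A terminating balanced hypergeometric sum\<close>

text \<open>
  This is \<open>N!\<^sup>3\<close> times the \<open>n\<close>-th term of the balanced sum
  \[ \frac{(1-z)_N (1-w)_N (1+z+w)_N}{N!^3} \sum_n
     \frac{(-N)_n (z)_n (w)_n (z+w-N)_n}{n!\, (z-N)_n (w-N)_n (1+z+w)_n}, \]
  in which the denominators have been cancelled, so that the term is a polynomial in \<open>z\<close> and \<open>w\<close>.
\<close>
definition whipple_term :: "'a :: {idom, semiring_char_0} \<Rightarrow> 'a \<Rightarrow> nat \<Rightarrow> nat \<Rightarrow> 'a" where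
  "whipple_term z w N n =
     (-1) ^ n * of_nat (N choose n) * pochhammer z n * pochhammer w n *
     pochhammer (1 - z) (N - n) * pochhammer (1 - w) (N - n) *
     pochhammer (z + w - of_nat N) n * pochhammer (1 + z + w + of_nat n) (N - n)"

text \<open>
  The recursion of the matrix product couples two sequences. The terms weighted with this factor sum
  up to the second one.
\<close>
definition whipple_weight :: "'a :: {idom, semiring_char_0} \<Rightarrow> 'a \<Rightarrow> nat \<Rightarrow> nat \<Rightarrow> 'a" where
  "whipple_weight z w N n = z * w * of_nat N - of_nat n * (z + w) - of_nat n ^ 2"

text \<open>
  What remains of the telescoping relation when the common hypergeometric factor is divided out. Here
  \<open>s = z + w\<close>, \<open>r = z w\<close> and \<open>m = N - n\<close>; in terms of these the identity is small enough to be
  expanded.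
\<close>
lemma certificate_polynomial_1:
  fixes m n r s :: "'a :: comm_ring_1"
  shows "(m + n) * (m\<^sup>2 - m * s + r) * (s - (m + n)) * (s + (m + n)) -
     m * (s - m) * ((m + n) ^ 3 - (s\<^sup>2 - 2 * r) * (m + n) + 2 * (r * (m + n - 1) - n * s - n\<^sup>2)
        - (r + n * s + n\<^sup>2) * (3 * (m + n) - s - 2 * (n + 1)))
     + n * (m\<^sup>2 - m * s + r) * (s + n) * (3 * (m + n) - s - 2 * n) = 0"
  by (simp add: algebra_simps power2_eq_square power3_eq_cube)

lemma certificate_polynomial_2:
  fixes m n r s :: "'a :: comm_ring_1"
  shows "(m + n) * (m\<^sup>2 - m * s + r) * (s - (m + n)) * (s + (m + n)) * (r * (m + n) - n * s - n\<^sup>2) -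
     m * (s - m) * (2 * r\<^sup>2 * (m + n)\<^sup>2 +
        ((m + n) ^ 3 - (s\<^sup>2 - 2 * r) * (m + n)) * (r * (m + n - 1) - n * s - n\<^sup>2)
        - (r + n * s + n\<^sup>2) * ((m + n) * (r * (3 * (m + n) - s - 2 * (n + 1)) + s\<^sup>2 - (m + n)\<^sup>2)))
     + n * (m\<^sup>2 - m * s + r) * (s + n) * ((m + n) * (r * (3 * (m + n) - s - 2 * n) + s\<^sup>2 - (m + n)\<^sup>2)) = 0"
  by (simp add: algebra_simps power2_eq_square power3_eq_cube)

context
  fixes z w :: "'a :: {idom, semiring_char_0}"
begin

lemma whipple_ratio_0:
  "whipple_term z w (Suc M) 0 =
     whipple_term z w M 0 * ((of_nat (Suc M) - z) * (of_nat (Suc M) - w) * (of_nat (Suc M) + z + w))"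
  by (simp add: whipple_term_def pochhammer_Suc algebra_simps)

lemma whipple_ratio_top:
  "whipple_term z w (Suc M) (Suc M) =
     whipple_term z w M M * ((z + of_nat M) * (w + of_nat M) * (of_nat (Suc M) - z - w))"
proof -
  have "pochhammer (z + w - of_nat (Suc M)) (Suc M) =
      (z + w - of_nat (Suc M)) * pochhammer (z + w - of_nat M) M"
    by (simp add: pochhammer_rec algebra_simps)
  moreover have "of_nat (Suc M) - z - w = - (z + w - of_nat (Suc M))"
    by simp
  ultimately show ?thesis
    unfolding whipple_term_def pochhammer_Suc[of z] pochhammer_Suc[of w]
    by (simp only: power_Suc diff_self_eq_0 pochhammer_0 binomial_n_n of_nat_1 mult_1_left mult_1_right
          mult_minus_left mult_minus_right mult_ac)
qed

text \<open>
  The three terms that meet in the telescoping relation are polynomial multiples of one quantity \<open>q\<close>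
  as soon as the binomial coefficients are multiplied by \<open>N\<close>.
\<close>
lemma whipple_ratio_inner:
  obtains q where
    "of_nat (Suc (Suc (k + d))) * whipple_term z w (Suc (k + d)) (Suc k) =
       q * (of_nat (Suc d) * (z + w - of_nat (Suc d)))"
    "of_nat (Suc (Suc (k + d))) * whipple_term z w (Suc (Suc (k + d))) (Suc k) =
       q * (of_nat (Suc (Suc (k + d))) * (of_nat (Suc d) - z) * (of_nat (Suc d) - w) *
         (z + w - of_nat (Suc (Suc (k + d)))) * (z + w + of_nat (Suc (Suc (k + d)))))"
    "of_nat (Suc (Suc (k + d))) *
         (whipple_term z w (Suc (k + d)) k * ((z + of_nat k) * (w + of_nat k))) =
       - q * (of_nat (Suc k) * (of_nat (Suc d) - z) * (of_nat (Suc d) - w) * (z + w + of_nat (Suc k)))"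
proof
  let ?N = "Suc (Suc (k + d))" and ?M = "Suc (k + d)" and ?n = "Suc k" and ?s = "z + w"
  \<comment> \<open>The common part of the products; the binomial coefficients are expressed by the largest one.\<close>
  define q where "q = of_nat (?N choose ?n) * ((-1) ^ ?n * pochhammer z ?n * pochhammer w ?n *
     pochhammer (1 - z) d * pochhammer (1 - w) d *
     pochhammer (?s - of_nat ?M) k * pochhammer (1 + ?s + of_nat ?n) d)"
  have c1: "of_nat ?N * of_nat (?M choose ?n) = (of_nat (Suc d) * of_nat (?N choose ?n) :: 'a)"
    unfolding of_nat_mult[symmetric] of_nat_eq_iff
    using binomial_absorb_comp[of ?N ?n] by simp
  have c2: "of_nat ?N * of_nat (?M choose k) = (of_nat ?n * of_nat (?N choose ?n) :: 'a)"
    unfolding of_nat_mult[symmetric] of_nat_eq_iff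
    using Suc_times_binomial[of k ?M] by simp
  have s1: "pochhammer (?s - of_nat ?M) ?n = pochhammer (?s - of_nat ?M) k * (?s - of_nat (Suc d))"
    by (simp add: pochhammer_Suc algebra_simps)
  have s2: "pochhammer (?s - of_nat ?N) ?n = (?s - of_nat ?N) * pochhammer (?s - of_nat ?M) k"
    by (simp add: pochhammer_rec algebra_simps)
  have s3: "pochhammer (1 + ?s + of_nat ?n) (Suc d) = pochhammer (1 + ?s + of_nat ?n) d * (?s + of_nat ?N)"
    by (simp add: pochhammer_Suc algebra_simps)
  have s4: "pochhammer (1 + ?s + of_nat k) (Suc d) = (?s + of_nat ?n) * pochhammer (1 + ?s + of_nat ?n) d"
    by (simp add: pochhammer_rec algebra_simps)
  have x1: "pochhammer (1 - x) (Suc d) = pochhammer (1 - x) d * (of_nat (Suc d) - x)" for x :: 'a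
    by (simp add: pochhammer_Suc algebra_simps)
  have x2: "pochhammer x ?n = pochhammer x k * (x + of_nat k)" for x :: 'a
    by (rule pochhammer_Suc)
  have d: "?M - ?n = d" "?N - ?n = Suc d" "?M - k = Suc d"
    by auto
  have assoc: "1 + z + w + x = 1 + ?s + x" for x
    by (simp add: add.assoc)
  show "of_nat ?N * whipple_term z w ?M ?n = q * (of_nat (Suc d) * (?s - of_nat (Suc d)))"
  proof -
    have "of_nat ?N * whipple_term z w ?M ?n = (of_nat ?N * of_nat (?M choose ?n)) *
        ((-1) ^ ?n * pochhammer z ?n * pochhammer w ?n * pochhammer (1 - z) d * pochhammer (1 - w) d *
         (pochhammer (?s - of_nat ?M) ?n) * pochhammer (1 + ?s + of_nat ?n) d)"
      unfolding whipple_term_def d assoc by (simp only: mult_ac)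
    then show ?thesis
      unfolding c1 s1 q_def by (simp only: mult_ac)
  qed
  show "of_nat ?N * whipple_term z w ?N ?n =
      q * (of_nat ?N * (of_nat (Suc d) - z) * (of_nat (Suc d) - w) * (?s - of_nat ?N) * (?s + of_nat ?N))"
    unfolding whipple_term_def d assoc x1 s2 s3 q_def by (simp only: mult_ac)
  show "of_nat ?N * (whipple_term z w ?M k * ((z + of_nat k) * (w + of_nat k))) =
      - q * (of_nat ?n * (of_nat (Suc d) - z) * (of_nat (Suc d) - w) * (?s + of_nat ?n))"
  proof -
    have "of_nat ?N * (whipple_term z w ?M k * ((z + of_nat k) * (w + of_nat k))) =
      (of_nat ?N * of_nat (?M choose k)) * ((-1) ^ k *
        (pochhammer z k * (z + of_nat k)) * (pochhammer w k * (w + of_nat k)) *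
        pochhammer (1 - z) (Suc d) * pochhammer (1 - w) (Suc d) *
        pochhammer (?s - of_nat ?M) k * pochhammer (1 + ?s + of_nat k) (Suc d))"
      unfolding whipple_term_def d assoc by (simp only: mult_ac)
    also have "\<dots> = - q * (of_nat ?n * (of_nat (Suc d) - z) * (of_nat (Suc d) - w) * (?s + of_nat ?n))"
      unfolding c2 x1 s4 x2[symmetric] q_def power_Suc by (simp only: mult_minus_left mult_minus_right mult_1_left mult_ac minus_minus)
    finally show ?thesis .
  qed
qed

lemma whipple_ratios:
  fixes k d :: nat
  defines "m \<equiv> of_nat (Suc d) :: 'a" and "n \<equiv> of_nat (Suc k) :: 'a"
  obtains q where
    "(m + n) * whipple_term z w (Suc (k + d)) (Suc k) = q * (m * (z + w - m))"
    "(m + n) * whipple_term z w (Suc (Suc (k + d))) (Suc k) =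
       q * ((m + n) * (m\<^sup>2 - m * (z + w) + z * w) * (z + w - (m + n)) * (z + w + (m + n)))"
    "(m + n) * (whipple_term z w (Suc (k + d)) k * ((z + of_nat k) * (w + of_nat k))) =
       - q * (n * (m\<^sup>2 - m * (z + w) + z * w) * (z + w + n))"
proof -
  have N: "of_nat (Suc (Suc (k + d))) = m + n"
    by (simp add: m_def n_def)
  have uv: "x * (m - z) * (m - w) = x * (m\<^sup>2 - m * (z + w) + z * w)" for x
    by (simp add: algebra_simps power2_eq_square)
  show ?thesis
    by (rule whipple_ratio_inner[of k d, folded m_def n_def, unfolded N uv]) (rule that)
qed

lemma telescoping:
  fixes F g :: "nat \<Rightarrow> 'a"
  assumes "F 0 = - g 0" "\<And>k. k < M \<Longrightarrow> F (Suc k) = g k - g (Suc k)" "F (Suc M) = g M"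
  shows "(\<Sum>n\<le>Suc M. F n) = 0"
proof -
  have "(\<Sum>n\<le>k. F n) = - g k" if "k \<le> M" for k
    using that assms(1,2) by (induction k) auto
  from this[of M] assms(3) show ?thesis by simp
qed

lemma sum_linear:
  fixes T f :: "nat \<Rightarrow> 'a"
  shows "(\<Sum>n\<in>A. T n * (u + v * f n)) = u * (\<Sum>n\<in>A. T n) + v * (\<Sum>n\<in>A. T n * f n)"
  by (simp add: sum_distrib_left sum.distrib distrib_left mult_ac)

lemma whipple_term_beyond: "n > N \<Longrightarrow> whipple_term z w N n = 0"
  by (simp add: whipple_term_def binomial_eq_0)

text \<open>
  Creative telescoping with the certificate \<open>C\<close>. The function \<open>g\<close> in the proof is what telescopes. Inside
  the range the relation between neighbouring terms is the polynomial identity \<open>inner\<close>; at the two ends of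
  the range one of the terms is missing and the relation is \<open>bottom\<close> or \<open>top\<close>.
\<close>
lemma whipple_summation:
  fixes M :: nat and W a C :: "'a \<Rightarrow> 'a"
  defines "N \<equiv> of_nat (Suc M) :: 'a"
  assumes bottom: "W 0 * ((N - z) * (N - w) * (N + z + w)) - a 0 = - (z * w * C 1)"
    and inner: "\<And>m n. m + n = N \<Longrightarrow>
      (m + n) * (m\<^sup>2 - m * (z + w) + z * w) * (z + w - (m + n)) * (z + w + (m + n)) * W n
      - m * (z + w - m) * (a n - (z * w + n * (z + w) + n\<^sup>2) * C (n + 1))
      + n * (m\<^sup>2 - m * (z + w) + z * w) * (z + w + n) * C n = 0"
    and top: "W N * (N - z - w) = C N"
  shows "(\<Sum>n\<le>Suc M. whipple_term z w (Suc M) n * W (of_nat n)) =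
         (\<Sum>n\<le>M. whipple_term z w M n * a (of_nat n))"
proof -
  let ?T = "whipple_term z w"
  define g where "g n = ?T M n * ((z + of_nat n) * (w + of_nat n)) * C (of_nat (Suc n))" for n
  have "(\<Sum>n\<le>Suc M. ?T (Suc M) n * W (of_nat n) - ?T M n * a (of_nat n)) = 0"
  proof (rule telescoping[where g = g])
    have "?T (Suc M) 0 * W (of_nat 0) - ?T M 0 * a (of_nat 0) =
        ?T M 0 * (W 0 * ((N - z) * (N - w) * (N + z + w)) - a 0)"
      unfolding whipple_ratio_0 N_def[symmetric] by (simp add: algebra_simps)
    then show "?T (Suc M) 0 * W (of_nat 0) - ?T M 0 * a (of_nat 0) = - g 0"
      unfolding bottom g_def by simp
    have "?T (Suc M) (Suc M) * W N = ?T M M * ((z + of_nat M) * (w + of_nat M)) * (W N * (N - z - w))"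
      unfolding whipple_ratio_top N_def[symmetric] by (simp only: mult_ac)
    then show "?T (Suc M) (Suc M) * W (of_nat (Suc M)) - ?T M (Suc M) * a (of_nat (Suc M)) = g M"
      unfolding N_def[symmetric] top g_def by (simp add: whipple_term_beyond)
    fix k assume "k < M"
    then obtain d where M: "M = Suc (k + d)"
      by (metis add_Suc less_imp_Suc_add)
    define m n r s where "m = (of_nat (Suc d) :: 'a)" and "n = (of_nat (Suc k) :: 'a)"
      and r: "r = z * w" and s: "s = z + w"
    obtain q where q:
      "(m + n) * ?T M (Suc k) = q * (m * (s - m))"
      "(m + n) * ?T (Suc M) (Suc k) = q * ((m + n) * (m\<^sup>2 - m * s + r) * (s - (m + n)) * (s + (m + n)))"
      "(m + n) * (?T M k * ((z + of_nat k) * (w + of_nat k))) = - q * (n * (m\<^sup>2 - m * s + r) * (s + n))"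
      unfolding M m_def n_def r s by (rule whipple_ratios)
    have N: "m + n = N" "of_nat (Suc (Suc k)) = n + 1"
      by (simp_all add: M N_def m_def n_def)
    have "(z + n) * (w + n) = r + n * s + n\<^sup>2"
      by (simp add: r s power2_eq_square algebra_simps)
    then have g: "g (Suc k) = ?T M (Suc k) * ((r + n * s + n\<^sup>2) * C (n + 1))"
        "g k = ?T M k * ((z + of_nat k) * (w + of_nat k)) * C n"
      unfolding g_def N n_def[symmetric] by (simp_all add: mult_ac)
    have "(m + n) * (?T (Suc M) (Suc k) * W n - ?T M (Suc k) * a n - (g k - g (Suc k))) =
      (m + n) * ?T (Suc M) (Suc k) * W n
       - ((m + n) * ?T M (Suc k)) * (a n - (r + n * s + n\<^sup>2) * C (n + 1))
       - ((m + n) * (?T M k * ((z + of_nat k) * (w + of_nat k)))) * C n"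
      unfolding g by (simp only: right_diff_distrib mult_ac) (simp add: algebra_simps)
    also have "\<dots> = q * ((m + n) * (m\<^sup>2 - m * s + r) * (s - (m + n)) * (s + (m + n)) * W n
       - m * (s - m) * (a n - (r + n * s + n\<^sup>2) * C (n + 1))
       + n * (m\<^sup>2 - m * s + r) * (s + n) * C n)"
    proof -
      have "q * A * x - q * B * y - - q * D * u = q * (A * x - B * y + D * u)" for A B D x y u
        by (simp add: algebra_simps)
      then show ?thesis
        unfolding q .
    qed
    also have "\<dots> = 0"
      using inner[OF N(1)] unfolding r[symmetric] s[symmetric] by simp
    finally have "(m + n) * (?T (Suc M) (Suc k) * W n - ?T M (Suc k) * a n - (g k - g (Suc k))) = 0" .
    moreover have "m + n \<noteq> 0"
      unfolding N(1) N_def by (rule of_nat_neq_0)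
    ultimately show "?T (Suc M) (Suc k) * W (of_nat (Suc k)) - ?T M (Suc k) * a (of_nat (Suc k)) = g k - g (Suc k)"
      unfolding n_def[symmetric] by simp
  qed
  then show ?thesis
    by (simp add: sum_subtractf whipple_term_beyond)
qed

text \<open>
  The certificate \<open>3 N - s - 2 n\<close> is the linear polynomial in \<open>n\<close> forced by the poles of the term
  ratio at \<open>n = N\<close> and \<open>n = N - s\<close>. The certificate in \<open>whipple_recurrence_2\<close> arises in the same way.
\<close>
lemma whipple_recurrence_1:
  fixes M :: nat
  defines "N \<equiv> of_nat (Suc M) :: 'a"
  shows "(\<Sum>n\<le>Suc M. whipple_term z w (Suc M) n) =
    (N ^ 3 - (z\<^sup>2 + w\<^sup>2) * N) * (\<Sum>n\<le>M. whipple_term z w M n) +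
    2 * (\<Sum>n\<le>M. whipple_term z w M n * whipple_weight z w M n)"
proof -
  define r s where rs: "r = z * w" "s = z + w"
  have sq: "z\<^sup>2 + w\<^sup>2 = s\<^sup>2 - 2 * r"
    by (simp add: rs power2_eq_square algebra_simps)
  define a where "a n = (N ^ 3 - (s\<^sup>2 - 2 * r) * N) + 2 * (r * (N - 1) - n * s - n\<^sup>2)" for n
  define C where "C n = 3 * N - s - 2 * n" for n
  have "(\<Sum>n\<le>Suc M. whipple_term z w (Suc M) n * 1) = (\<Sum>n\<le>M. whipple_term z w M n * a (of_nat n))"
  proof (rule whipple_summation[where C = C], fold N_def)
    show "1 * ((N - z) * (N - w) * (N + z + w)) - a 0 = - (z * w * C 1)"
      by (simp add: a_def C_def rs algebra_simps power2_eq_square power3_eq_cube)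
    fix m n assume "m + n = N"
    then show "(m + n) * (m\<^sup>2 - m * (z + w) + z * w) * (z + w - (m + n)) * (z + w + (m + n)) * 1
      - m * (z + w - m) * (a n - (z * w + n * (z + w) + n\<^sup>2) * C (n + 1))
      + n * (m\<^sup>2 - m * (z + w) + z * w) * (z + w + n) * C n = 0"
      using certificate_polynomial_1[of m n s r] unfolding a_def C_def rs by simp
  qed (simp add: C_def rs)
  moreover have "r * (N - 1) - of_nat n * s - (of_nat n)\<^sup>2 = whipple_weight z w M n" for n
    by (simp add: whipple_weight_def rs N_def)
  ultimately show ?thesis
    unfolding a_def sq sum_linear by simp
qed

lemma whipple_recurrence_2:
  fixes M :: nat
  defines "N \<equiv> of_nat (Suc M) :: 'a"
  shows "(\<Sum>n\<le>Suc M. whipple_term z w (Suc M) n * whipple_weight z w (Suc M) n) =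
    2 * (z * w)\<^sup>2 * N\<^sup>2 * (\<Sum>n\<le>M. whipple_term z w M n) +
    (N ^ 3 - (z\<^sup>2 + w\<^sup>2) * N) * (\<Sum>n\<le>M. whipple_term z w M n * whipple_weight z w M n)"
proof -
  define r s where rs: "r = z * w" "s = z + w"
  have sq: "z\<^sup>2 + w\<^sup>2 = s\<^sup>2 - 2 * r"
    by (simp add: rs power2_eq_square algebra_simps)
  define W where "W n = r * N - n * s - n\<^sup>2" for n
  define W' where "W' n = r * (N - 1) - n * s - n\<^sup>2" for n
  define a where "a n = 2 * r\<^sup>2 * N\<^sup>2 + (N ^ 3 - (s\<^sup>2 - 2 * r) * N) * W' n" for n
  define C where "C n = N * (r * (3 * N - s - 2 * n) + s\<^sup>2 - N\<^sup>2)" for n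
  have "(\<Sum>n\<le>Suc M. whipple_term z w (Suc M) n * W (of_nat n)) = (\<Sum>n\<le>M. whipple_term z w M n * a (of_nat n))"
  proof (rule whipple_summation[where C = C], fold N_def)
    show "W 0 * ((N - z) * (N - w) * (N + z + w)) - a 0 = - (z * w * C 1)"
      by (simp add: a_def C_def W_def W'_def rs algebra_simps power2_eq_square power3_eq_cube)
    fix m n assume "m + n = N"
    then show "(m + n) * (m\<^sup>2 - m * (z + w) + z * w) * (z + w - (m + n)) * (z + w + (m + n)) * W n
      - m * (z + w - m) * (a n - (z * w + n * (z + w) + n\<^sup>2) * C (n + 1))
      + n * (m\<^sup>2 - m * (z + w) + z * w) * (z + w + n) * C n = 0"
      using certificate_polynomial_2[of m n s r] unfolding a_def C_def W_def W'_def rs by simp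
  next
    show "W N * (N - z - w) = C N"
      by (simp add: C_def W_def rs algebra_simps power2_eq_square)
  qed
  moreover have "W (of_nat n) = whipple_weight z w (Suc M) n" for n
    by (simp add: W_def whipple_weight_def rs N_def)
  moreover have "W' (of_nat n) = whipple_weight z w M n" for n
    by (simp add: W'_def whipple_weight_def rs N_def)
  ultimately show ?thesis
    unfolding a_def sq sum_linear by (simp add: rs)
qed

end

section \<open>Power series of harmonic sums\<close>

locale fps_prime = odd_prime +
  fixes D :: nat
  assumes D_less: "D + 5 < p"
begin

sublocale F: filtered_ring "fps_padic D p"
  by (rule filtered_ring_fps_padic) (rule prime)

abbreviation lin :: "rat \<Rightarrow> rat fps" where
  "lin c \<equiv> fps_const c * fps_X"

text \<open>
  The expansion of \<open>1 / (n + c X)\<close>.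
\<close>
definition recip :: "nat \<Rightarrow> rat \<Rightarrow> rat fps" where
  "recip n c = Abs_fps (\<lambda>i. (- c) ^ i / of_nat n ^ Suc i)"

definition E_series :: "rat \<Rightarrow> rat fps" where
  "E_series c = Abs_fps (\<lambda>i. c ^ i * coeff E_poly i)"

text \<open>
  Even indices carry no information, as the coefficients \<open>beta\<close> vanish there. Leaving them out makes
  the series exactly odd in \<open>c\<close>. Index 1 is excluded since \<open>beta 1\<close> is not integral.
\<close>
definition beta_series :: "rat \<Rightarrow> rat fps" where
  "beta_series c = Abs_fps (\<lambda>i. if odd i \<and> i \<noteq> 1 then beta i * c ^ i else 0)"

text \<open>
  The image of \<open>beta_series c\<close> under \<open>X\<close> times the derivative.
\<close>
definition beta_theta_series :: "rat \<Rightarrow> rat fps" where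
  "beta_theta_series c = Abs_fps (\<lambda>i. if odd i \<and> i \<noteq> 1 then of_nat i * beta i * c ^ i else 0)"

definition single_sum :: "rat \<Rightarrow> rat fps" where
  "single_sum c = (\<Sum>n\<in>{1..<p}. recip n c)"

definition double_sum :: "rat \<Rightarrow> rat \<Rightarrow> rat fps" where
  "double_sum a y = (\<Sum>n\<in>{1..<p}. \<Sum>k\<in>{1..n}. recip n a * recip k y)"

lemma fps_memI: "(\<And>i. i < D \<Longrightarrow> fps_nth f i \<in> padic p k) \<Longrightarrow> f \<in> fps_padic D p k"
  by (simp add: fps_padic_def)

lemma fps_eqvI:
  assumes "\<And>i. i < D \<Longrightarrow> R.eqv k (fps_nth f i) (fps_nth g i)"
  shows "F.eqv k f g"
  using assms by (auto simp: F.eqv_def R.eqv_def fps_padic_def)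

lemma fps_const_mem: "c \<in> padic p k \<Longrightarrow> fps_const c \<in> fps_padic D p k"
  by (auto intro!: fps_memI simp: R.zero_mem)

lemma fps_X_mem: "fps_X \<in> fps_padic D p 0"
  by (auto intro!: fps_memI simp: R.zero_mem R.one_mem fps_X_def)

lemma lin_mem: "c \<in> padic p 0 \<Longrightarrow> lin c \<in> fps_padic D p 0"
  by (intro F.mult_mem_left fps_const_mem fps_X_mem)

lemma p_fps_mem: "of_nat p \<in> fps_padic D p 1"
  unfolding fps_of_nat[symmetric] by (intro fps_const_mem p_mem)

lemma lin_mult_nth: "fps_nth (lin c * f) i = (if i = 0 then 0 else c * fps_nth f (i - 1))"
  by (simp add: mult.assoc)

lemma lin_add: "lin (a + b) = lin a + lin b"
  by (simp add: distrib_right flip: fps_const_add)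

lemma lin_uminus: "lin (- a) = - lin a"
  by (simp flip: fps_const_neg)

lemma lin_diff: "lin (a - b) = lin a - lin b"
  by (simp add: left_diff_distrib flip: fps_const_sub)

lemma beta_series_uminus: "beta_series (- c) = - beta_series c"
  by (rule fps_ext) (auto simp: beta_series_def)

lemma beta_series_0: "beta_series 0 = 0"
  by (rule fps_ext) (auto simp: beta_series_def)

lemma recip_inverse:
  assumes "n > 0"
  shows "recip n c * (of_nat n + lin c) = 1"
proof (rule fps_ext)
  fix i
  have "fps_nth (recip n c * (of_nat n + lin c)) i =
      of_nat n * fps_nth (recip n c) i + fps_nth (lin c * recip n c) i"
    by (simp add: algebra_simps flip: fps_of_nat)
  also have "\<dots> = fps_nth 1 i"
    unfolding lin_mult_nth using assms by (cases i) (auto simp: recip_def field_simps)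
  finally show "fps_nth (recip n c * (of_nat n + lin c)) i = fps_nth 1 i" .
qed

lemma recip_mem: "c \<in> padic p 0 \<Longrightarrow> n \<in> {1..<p} \<Longrightarrow> recip n c \<in> fps_padic D p 0"
proof (rule fps_memI)
  fix i assume "c \<in> padic p 0" "n \<in> {1..<p}"
  then have "(- c) ^ i * (1 / of_nat n ^ Suc i) \<in> padic p 0"
    by (intro R.mult_mem_left R.power_mem R.uminus_mem inverse_power_mem) auto
  then show "fps_nth (recip n c) i \<in> padic p 0"
    by (simp add: recip_def)
qed

lemma E_series_eq_prod: "E_series c = (\<Prod>k\<in>{1..<p}. 1 + fps_const (1 / of_nat k) * lin c)"
proof -
  have "E_series c = fps_of_poly (pcompose E_poly [:0, c:])"
    by (rule fps_ext) (simp add: E_series_def coeff_pcompose_linear)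
  also have "\<dots> = (\<Prod>k\<in>{1..<p}. fps_of_poly [:1, c / of_nat k:])"
    by (simp add: E_poly_def pcompose_prod pcompose_pCons fps_of_poly_prod)
  also have "\<dots> = (\<Prod>k\<in>{1..<p}. 1 + fps_const (1 / of_nat k) * lin c)"
    by (intro prod.cong refl) (simp add: fps_of_poly_pCons mult_ac)
  finally show ?thesis .
qed

lemma E_series_mem: "c \<in> padic p 0 \<Longrightarrow> E_series c \<in> fps_padic D p 0"
  by (intro fps_memI) (auto simp: E_series_def intro!: R.mult_mem_left R.power_mem coeff_E_poly_mem)

lemma E_series_minus_1_mem:
  assumes "c \<in> padic p 0"
  shows "E_series c - 1 \<in> fps_padic D p 1"
proof (rule fps_memI)
  fix i assume i: "i < D"
  show "fps_nth (E_series c - 1) i \<in> padic p 1"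
  proof (cases "i = 0")
    case False
    have "R.eqv 1 (coeff E_poly i) (- (of_nat p * beta (Suc i)))"
      using False i D_less by (intro R.eqv_antimono[OF coeff_E_poly]) auto
    moreover have "of_nat p * beta (Suc i) \<in> padic p 1"
      using beta_mem[of "Suc i"] False i D_less p_mem by (intro R.mult_mem_right) auto
    ultimately have "coeff E_poly i \<in> padic p 1"
      by (blast intro: R.eqv_mem R.uminus_mem)
    then show ?thesis
      using assms False R.mult_mem_left[OF R.power_mem, of c] by (simp add: E_series_def)
  qed (simp add: E_series_def coeff_E_poly_0 R.zero_mem)
qed

text \<open>
  The factor \<open>lin c\<close> shifts the index by one, so that \<open>beta\<close> and the power of \<open>c\<close> have the same index
  and the right-hand side depends on \<open>c\<close> only through \<open>beta_series\<close>. The factors in the next lemmas serve the same purpose.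
\<close>
lemma lin_E_series:
  assumes "c \<in> padic p 0"
  shows "F.eqv 2 (lin c * (E_series c - 1)) (- (of_nat p * beta_series c))"
proof (rule fps_eqvI)
  fix i assume i: "i < D"
  consider "i = 0" | "i = 1" | j where "i = Suc j" "j \<ge> 1"
    by (cases i) force+
  then show "R.eqv 2 (fps_nth (lin c * (E_series c - 1)) i) (fps_nth (- (of_nat p * beta_series c)) i)"
  proof cases
    case 3
    have "R.eqv 2 (c ^ i * coeff E_poly j) (c ^ i * (- (of_nat p * beta (Suc j))))"
      using 3 i D_less assms by (intro R.eqv_scale0 coeff_E_poly R.power_mem) auto
    also have "c ^ i * (- (of_nat p * beta (Suc j))) = fps_nth (- (of_nat p * beta_series c)) i"
      using beta_even[of i] 3 i D_less by (auto simp: beta_series_def mult_ac simp flip: fps_of_nat)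
    also have "c ^ i * coeff E_poly j = fps_nth (lin c * (E_series c - 1)) i"
      unfolding lin_mult_nth using 3 by (simp add: E_series_def)
    finally show ?thesis .
  qed (auto simp: lin_mult_nth E_series_def coeff_E_poly_0 beta_series_def simp flip: fps_of_nat)
qed

lemma single_sum_mem:
  assumes "c \<in> padic p 0"
  shows "single_sum c \<in> fps_padic D p 1"
proof (rule fps_memI)
  fix i assume "i < D"
  then have "(- c) ^ i * (\<Sum>n\<in>{1..<p}. 1 / of_nat n ^ Suc i) \<in> padic p 1"
    using assms D_less
    by (intro R.mult_mem_left R.power_mem R.uminus_mem power_sum_inverse_mem) auto
  then show "fps_nth (single_sum c) i \<in> padic p 1"
    by (simp add: single_sum_def recip_def fps_sum_nth sum_distrib_left)
qed

text \<open>
  Every factor \<open>1 + c X / k\<close> has the logarithmic derivative \<open>c / (k + c X)\<close>.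
\<close>
lemma log_derivative_E_series: "fps_X * fps_deriv (E_series c) = lin c * single_sum c * E_series c"
proof -
  let ?f = "\<lambda>k. 1 + fps_const (1 / of_nat k) * lin c"
  have "fps_X * fps_deriv (\<Prod>k\<in>A. ?f k) = lin c * (\<Sum>k\<in>A. recip k c) * (\<Prod>k\<in>A. ?f k)"
    if "A \<subseteq> {1..<p}" for A
    using finite_subset[OF that finite_atLeastLessThan] that
  proof (induction A rule: finite_induct)
    case (insert k A)
    then have k: "k > 0" by auto
    have "?f k = fps_const (1 / of_nat k) * (of_nat k + lin c)"
      using k by (simp add: distrib_left flip: fps_of_nat)
    then have "recip k c * ?f k = fps_const (1 / of_nat k) * (recip k c * (of_nat k + lin c))"
      by (simp add: mult_ac)
    then have 1: "recip k c * ?f k = fps_const (1 / of_nat k)"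
      using k recip_inverse by simp
    have 2: "fps_X * fps_deriv (?f k) = lin c * fps_const (1 / of_nat k)"
      by simp
    have "fps_X * fps_deriv (?f k * (\<Prod>k\<in>A. ?f k)) =
        fps_X * fps_deriv (?f k) * (\<Prod>k\<in>A. ?f k) + ?f k * (fps_X * fps_deriv (\<Prod>k\<in>A. ?f k))"
      by (simp only: fps_deriv_mult) (simp only: algebra_simps)
    also have "\<dots> = lin c * (recip k c * ?f k) * (\<Prod>k\<in>A. ?f k) +
        ?f k * (lin c * (\<Sum>k\<in>A. recip k c) * (\<Prod>k\<in>A. ?f k))"
    proof -
      have "fps_X * fps_deriv (\<Prod>k\<in>A. ?f k) = lin c * (\<Sum>k\<in>A. recip k c) * (\<Prod>k\<in>A. ?f k)"
        using insert by blast
      then show ?thesis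
        unfolding 2 1 by (simp only:)
    qed
    also have "\<dots> = lin c * (recip k c + (\<Sum>k\<in>A. recip k c)) * (?f k * (\<Prod>k\<in>A. ?f k))"
      by (simp only: algebra_simps)
    finally show ?case
      unfolding prod.insert[OF insert(1,2)] sum.insert[OF insert(1,2)] .
  qed simp
  then show ?thesis
    unfolding single_sum_def E_series_eq_prod by simp
qed

text \<open>
  Modulo \<open>p\<^sup>2\<close> the logarithmic derivative of \<open>E_series c\<close> equals its derivative, because the series is 1
  modulo \<open>p\<close> and the power sums vanish modulo \<open>p\<close>.
\<close>
lemma lin_single_sum:
  assumes "c \<in> padic p 0"
  shows "F.eqv 2 ((lin c)\<^sup>2 * single_sum c) (- (of_nat p * (beta_theta_series c - beta_series c)))"
proof -
  have "(lin c)\<^sup>2 * single_sum c * (E_series c - 1) \<in> fps_padic D p 2"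
    using F.mult_mem[OF F.mult_mem_left[OF F.power_mem[OF lin_mem[OF assms], of 2] single_sum_mem[OF assms]]
        E_series_minus_1_mem[OF assms]]
    unfolding one_add_one .
  then have "F.eqv 2 ((lin c)\<^sup>2 * single_sum c * E_series c) ((lin c)\<^sup>2 * single_sum c)"
    by (simp add: F.eqv_def algebra_simps)
  from F.eqv_sym[OF this]
  have "F.eqv 2 ((lin c)\<^sup>2 * single_sum c) (lin c * (lin c * single_sum c * E_series c))"
    by (simp only: power2_eq_square mult_ac)
  also have "lin c * (lin c * single_sum c * E_series c) = lin c * (fps_X * fps_deriv (E_series c))"
    unfolding log_derivative_E_series ..
  also have "F.eqv 2 \<dots> (- (of_nat p * (beta_theta_series c - beta_series c)))"
  proof (rule fps_eqvI)
    fix i assume i: "i < D"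
    consider "i = 0" | "i = 1" | j where "i = Suc (Suc j)"
      by (metis One_nat_def not0_implies_Suc)
    then show "R.eqv 2 (fps_nth (lin c * (fps_X * fps_deriv (E_series c))) i)
                 (fps_nth (- (of_nat p * (beta_theta_series c - beta_series c))) i)"
    proof cases
      case 3
      have "R.eqv 2 (of_nat (Suc j) * c ^ i * coeff E_poly (Suc j))
           (of_nat (Suc j) * c ^ i * (- (of_nat p * beta i)))"
        unfolding 3 using 3 i D_less assms
        by (intro R.eqv_scale0 coeff_E_poly R.mult_mem_left R.of_nat_mem R.power_mem) auto
      also have "of_nat (Suc j) * c ^ i * (- (of_nat p * beta i)) = fps_nth (- (of_nat p * (beta_theta_series c - beta_series c))) i"
        using beta_even[of i] 3 i D_less
        by (auto simp: beta_series_def beta_theta_series_def algebra_simps simp flip: fps_of_nat)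
      also have "of_nat (Suc j) * c ^ i * coeff E_poly (Suc j) = fps_nth (lin c * (fps_X * fps_deriv (E_series c))) i"
        unfolding lin_mult_nth using 3 by (simp add: E_series_def mult_ac)
      finally show ?thesis .
    qed (auto simp: lin_mult_nth beta_series_def beta_theta_series_def simp flip: fps_of_nat)
  qed
  finally show ?thesis .
qed

lemma double_sum_nth:
  assumes "i < D" "a \<in> padic p 0" "y \<in> padic p 0"
  shows "R.eqv 1 (fps_nth (double_sum a y) i)
    (\<Sum>j\<le>i. (- a) ^ j * (- y) ^ (i - j) * ((-1) ^ Suc j * of_nat ((i + 2) choose (Suc j)) * beta (i + 2)))"
proof -
  have "fps_nth (double_sum a y) i = (\<Sum>n\<in>{1..<p}. \<Sum>k\<in>{1..n}. \<Sum>j\<le>i.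
      (- a) ^ j * (- y) ^ (i - j) * (1 / (of_nat k ^ Suc (i - j) * of_nat n ^ Suc j)))"
    unfolding double_sum_def fps_sum_nth fps_mult_nth recip_def atMost_atLeast0
    by (intro sum.cong refl) (simp add: mult_ac)
  also have "\<dots> = (\<Sum>n\<in>{1..<p}. \<Sum>j\<le>i. \<Sum>k\<in>{1..n}. 
      (- a) ^ j * (- y) ^ (i - j) * (1 / (of_nat k ^ Suc (i - j) * of_nat n ^ Suc j)))"
    by (rule sum.cong[OF refl]) (rule sum.swap)
  also have "\<dots> = (\<Sum>j\<le>i. (- a) ^ j * (- y) ^ (i - j) *
      (\<Sum>n\<in>{1..<p}. \<Sum>k\<in>{1..n}. 1 / (of_nat k ^ Suc (i - j) * of_nat n ^ Suc j)))"
    unfolding sum_distrib_left by (rule sum.swap)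
  also have "R.eqv 1 \<dots> (\<Sum>j\<le>i. (- a) ^ j * (- y) ^ (i - j) *
      ((-1) ^ Suc j * of_nat ((Suc (i - j) + Suc j) choose Suc (i - j)) * beta (Suc (i - j) + Suc j)))"
    using assms D_less
    by (intro R.eqv_sum R.eqv_scale0 double_harmonic_sum R.mult_mem_left R.power_mem R.uminus_mem) auto
  also have "\<dots> = (\<Sum>j\<le>i. (- a) ^ j * (- y) ^ (i - j) *
      ((-1) ^ Suc j * of_nat ((i + 2) choose (Suc j)) * beta (i + 2)))"
  proof (intro sum.cong refl)
    fix j assume "j \<in> {..i}"
    then have "Suc (i - j) + Suc j = i + 2" "(i + 2) choose (i + 2 - Suc j) = (i + 2) choose Suc j" "Suc (i - j) = i + 2 - Suc j"
      using binomial_symmetric[of "Suc j" "i + 2"] by auto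
    then show "(- a) ^ j * (- y) ^ (i - j) *
      ((-1) ^ Suc j * of_nat ((Suc (i - j) + Suc j) choose Suc (i - j)) * beta (Suc (i - j) + Suc j)) =
      (- a) ^ j * (- y) ^ (i - j) * ((-1) ^ Suc j * of_nat ((i + 2) choose (Suc j)) * beta (i + 2))"
      by simp
  qed
  finally show ?thesis .
qed

text \<open>
  The coefficients of \<open>double_sum_nth\<close> are those of the binomial expansion of a power of \<open>a - y\<close>
  without its two extreme terms.
\<close>
lemma lin_double_sum:
  assumes "a \<in> padic p 0" "y \<in> padic p 0"
  shows "F.eqv 1 (lin a * lin y * double_sum a y) (beta_series (a - y) - beta_series a + beta_series y)"
proof (rule fps_eqvI)
  fix I assume I: "I < D"
  consider "I = 0" | "I = 1" | i where "I = Suc (Suc i)"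
    by (metis One_nat_def not0_implies_Suc)
  then show "R.eqv 1 (fps_nth (lin a * lin y * double_sum a y) I) (fps_nth (beta_series (a - y) - beta_series a + beta_series y) I)"
  proof cases
    case 3
    have "fps_nth (lin a * lin y * double_sum a y) I = a * y * fps_nth (double_sum a y) i"
      unfolding mult.assoc[of "lin a"] lin_mult_nth using 3 by simp
    also have "R.eqv 1 \<dots> (a * y * (\<Sum>j\<le>i. (- a) ^ j * (- y) ^ (i - j) *
        ((-1) ^ Suc j * of_nat ((i + 2) choose (Suc j)) * beta (i + 2))))"
      using 3 I assms by (intro R.eqv_scale0 double_sum_nth R.mult_mem_left) auto
    also have "a * y * (\<Sum>j\<le>i. (- a) ^ j * (- y) ^ (i - j) *
        ((-1) ^ Suc j * of_nat ((i + 2) choose (Suc j)) * beta (i + 2))) =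
        beta I * (\<Sum>j\<le>i. of_nat (I choose Suc j) * a ^ Suc j * (- y) ^ (I - Suc j))"
      unfolding sum_distrib_left
    proof (intro sum.cong refl)
      fix j assume j: "j \<in> {..i}"
      have "(- a) ^ j * (-1) ^ j = a ^ j"
        by (subst power_mult_distrib[symmetric]) simp
      then have "(- a) ^ j * (-1) ^ Suc j = - (a ^ j)"
        by simp
      moreover have "(- y) ^ (I - Suc j) = - y * (- y) ^ (i - j)"
        using j 3 by (simp add: Suc_diff_le)
      ultimately show "a * y * ((- a) ^ j * (- y) ^ (i - j) *
          ((-1) ^ Suc j * of_nat ((i + 2) choose (Suc j)) * beta (i + 2))) =
         beta I * (of_nat (I choose Suc j) * a ^ Suc j * (- y) ^ (I - Suc j))"
        using 3 by (simp add: mult_ac)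
    qed
    also have "(\<Sum>j\<le>i. of_nat (I choose Suc j) * a ^ Suc j * (- y) ^ (I - Suc j)) =
        (a - y) ^ I - (- y) ^ I - a ^ I"
    proof -
      have "(a - y) ^ I = (a + (- y)) ^ I" by simp
      also have "\<dots> = (\<Sum>k\<le>I. of_nat (I choose k) * a ^ k * (- y) ^ (I - k))"
        by (rule binomial_ring)
      also have "\<dots> = (- y) ^ I + (\<Sum>j\<le>Suc i. of_nat (I choose Suc j) * a ^ Suc j * (- y) ^ (I - Suc j))"
        unfolding 3 by (subst sum.atMost_Suc_shift) simp
      also have "(\<Sum>j\<le>Suc i. of_nat (I choose Suc j) * a ^ Suc j * (- y) ^ (I - Suc j)) =
          (\<Sum>j\<le>i. of_nat (I choose Suc j) * a ^ Suc j * (- y) ^ (I - Suc j)) + a ^ I"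
        unfolding 3 sum.atMost_Suc binomial_n_n by simp
      finally show ?thesis
        by (simp only: algebra_simps)
    qed
    also have "beta I * ((a - y) ^ I - (- y) ^ I - a ^ I) = fps_nth (beta_series (a - y) - beta_series a + beta_series y) I"
      using 3 I D_less beta_even[of I] by (auto simp: beta_series_def algebra_simps)
    finally show ?thesis .
  qed (auto simp: mult.assoc lin_mult_nth beta_series_def)
qed

text \<open>
  For \<open>y = 0\<close> the formula \<open>lin_double_sum\<close> degenerates. This is its limit after division by \<open>y\<close>.
\<close>
lemma lin_double_sum_0:
  assumes "a \<in> padic p 0"
  shows "F.eqv 1 ((lin a)\<^sup>2 * double_sum a 0) (- beta_theta_series a)"
proof (rule fps_eqvI)
  fix I assume I: "I < D"
  consider "I = 0" | "I = 1" | i where "I = Suc (Suc i)"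
    by (metis One_nat_def not0_implies_Suc)
  then show "R.eqv 1 (fps_nth ((lin a)\<^sup>2 * double_sum a 0) I) (fps_nth (- beta_theta_series a) I)"
  proof cases
    case 3
    have "fps_nth ((lin a)\<^sup>2 * double_sum a 0) I = a * a * fps_nth (double_sum a 0) i"
      unfolding power2_eq_square mult.assoc[of "lin a"] lin_mult_nth using 3 by simp
    also have "R.eqv 1 \<dots> (a * a * (\<Sum>j\<le>i. (- a) ^ j * (- 0) ^ (i - j) *
        ((-1) ^ Suc j * of_nat ((i + 2) choose (Suc j)) * beta (i + 2))))"
      using 3 I assms by (intro R.eqv_scale0 double_sum_nth R.mult_mem_left R.zero_mem) auto
    also have "(\<Sum>j\<le>i. (- a) ^ j * (- 0) ^ (i - j) *
        ((-1) ^ Suc j * of_nat ((i + 2) choose (Suc j)) * beta (i + 2))) =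
        (\<Sum>j\<le>i. if j = i then - (a ^ i) * of_nat I * beta I else 0)"
    proof (intro sum.cong refl)
      fix j assume "j \<in> {..i}"
      moreover have "(- a) ^ i * (-1) ^ i = a ^ i"
        by (subst power_mult_distrib[symmetric]) simp
      then have "(- a) ^ i * (-1) ^ Suc i = - (a ^ i)"
        by simp
      moreover have "(i + 2) choose (Suc i) = I"
        using 3 by simp
      ultimately show "(- a) ^ j * (- 0) ^ (i - j) *
          ((-1) ^ Suc j * of_nat ((i + 2) choose (Suc j)) * beta (i + 2)) =
          (if j = i then - (a ^ i) * of_nat I * beta I else 0)"
      proof (cases "j = i")
        case True
        have "(- a) ^ i * (- 0) ^ (i - i) * ((-1) ^ Suc i * of_nat ((i + 2) choose (Suc i)) * beta (i + 2)) =
            ((- a) ^ i * (-1) ^ Suc i) * of_nat ((i + 2) choose (Suc i)) * beta (i + 2)"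
          by (simp only: diff_self_eq_0 power_0 mult_1_right mult_ac)
        also have "\<dots> = - (a ^ i) * of_nat I * beta I"
          unfolding \<open>(- a) ^ i * (-1) ^ Suc i = - (a ^ i)\<close> \<open>(i + 2) choose (Suc i) = I\<close> using 3 by simp
        finally show ?thesis
          using True by (simp only: if_True refl)
      qed (use \<open>j \<in> {..i}\<close> in \<open>simp add: power_0_left\<close>)
    qed
    also have "a * a * \<dots> = fps_nth (- beta_theta_series a) I"
      using 3 I D_less beta_even[of I] by (auto simp: beta_theta_series_def algebra_simps)
    finally show ?thesis .
  qed (auto simp: power2_eq_square mult.assoc lin_mult_nth beta_theta_series_def)
qed

end

section \<open>The hypergeometric sum modulo the square of p\<close>

lemma pochhammer_minus_of_nat:
  "n \<le> N \<Longrightarrow> pochhammer (- of_nat N :: 'a :: {comm_ring_1, semiring_char_0}) n = (-1) ^ n * fact n * of_nat (N choose n)"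
proof (induction n)
  case (Suc n)
  have "Suc n * (N choose Suc n) = (N - n) * (N choose n)"
    using binomial_absorption[of n N] binomial_absorb_comp[of N n] by simp
  then have *: "of_nat (Suc n) * of_nat (N choose Suc n) = (of_nat (N - n) * of_nat (N choose n) :: 'a)"
    by (simp only: of_nat_mult[symmetric])
  have "(-1) ^ Suc n * fact (Suc n) * of_nat (N choose Suc n) =
      (-1) ^ Suc n * fact n * (of_nat (Suc n) * of_nat (N choose Suc n) :: 'a)"
    by (simp add: mult_ac del: of_nat_Suc)
  also have "\<dots> = pochhammer (- of_nat N) n * (- of_nat N + of_nat n)"
    unfolding * using Suc by (simp add: of_nat_diff algebra_simps)
  finally show ?case
    by (simp add: pochhammer_Suc)
qed simp

context fps_prime
begin

lemma pochhammer_E_series: "pochhammer (1 + lin c) (p - 1) = fact (p - 1) * E_series c"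
proof -
  have "fact (p - 1) * E_series c = (\<Prod>k\<in>{1..<p}. of_nat k) * E_series c"
    by (simp add: fact_prod atLeastLessThanSuc_atLeastAtMost[symmetric] Suc_diff_Suc prime prime_gt_0_nat del: prod_constant)
  also have "\<dots> = (\<Prod>k\<in>{1..<p}. of_nat k + lin c)"
    unfolding E_series_eq_prod prod.distrib[symmetric]
    by (intro prod.cong refl) (auto simp: distrib_left simp flip: fps_of_nat)
  also have "\<dots> = (\<Prod>i = 0..<p - 1. 1 + lin c + of_nat i)"
    by (rule prod.reindex_bij_witness[of _ Suc "\<lambda>k. k - 1"]) (use gt_2 in \<open>auto simp: of_nat_diff\<close>)
  finally show ?thesis
    by (simp add: pochhammer_prod)
qed

text \<open>
  The factor by which the product of the \<open>c X + i\<close> over \<open>1 \<le> i \<le> n\<close> changes when every factor is decreased by \<open>p\<close>.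
\<close>
definition defect :: "nat \<Rightarrow> rat \<Rightarrow> rat fps" where
  "defect n c = (\<Prod>i\<in>{1..n}. 1 - of_nat p * recip i c)"

lemma defect_Suc: "defect (Suc n) c = defect n c * (1 - of_nat p * recip (Suc n) c)"
  by (simp add: defect_def)

lemma defect_factor:
  assumes "n > 0"
  shows "(lin c + of_nat n) * (1 - of_nat p * recip n c) = lin c + of_nat n - of_nat p"
proof -
  have "(lin c + of_nat n) * (1 - of_nat p * recip n c) =
      lin c + of_nat n - of_nat p * (recip n c * (of_nat n + lin c))"
    by (simp only: algebra_simps mult_1_left)
  then show ?thesis
    unfolding recip_inverse[OF assms] by simp
qed

lemma pochhammer_shift_up:
  "pochhammer (lin c - of_nat (p - 1)) n = pochhammer (1 + lin c) n * defect n c"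
proof (induction n)
  case (Suc n)
  have "lin c - of_nat (p - 1) + of_nat n = (lin c + of_nat (Suc n)) * (1 - of_nat p * recip (Suc n) c)"
    unfolding defect_factor[OF zero_less_Suc] using gt_2 by (simp add: of_nat_diff)
  then show ?case
    unfolding pochhammer_Suc defect_Suc Suc by (simp add: mult_ac add_ac)
qed (simp add: defect_def)

lemma pochhammer_shift_down:
  "n < p \<Longrightarrow> pochhammer (1 - lin c + of_nat (p - 1 - n)) n = (-1) ^ n * pochhammer (1 + lin c) n * defect n c"
proof (induction n)
  case (Suc n)
  have "1 - lin c + of_nat (p - 1 - Suc n) = - (lin c + of_nat (Suc n) - of_nat p)"
    using Suc.prems by (simp add: of_nat_diff)
  then have 1: "1 - lin c + of_nat (p - 1 - Suc n) = - ((lin c + of_nat (Suc n)) * (1 - of_nat p * recip (Suc n) c))"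
    unfolding defect_factor[OF zero_less_Suc] .
  have "of_nat (p - 1 - n) = (of_nat (p - 1 - Suc n) + 1 :: rat fps)"
    using Suc.prems by (simp add: of_nat_diff)
  then have "pochhammer (1 - lin c + of_nat (p - 1 - Suc n)) (Suc n) =
      (1 - lin c + of_nat (p - 1 - Suc n)) * pochhammer (1 - lin c + of_nat (p - 1 - n)) n"
    by (simp add: pochhammer_rec add_ac)
  then show ?case
    unfolding 1 using Suc by (simp add: pochhammer_Suc defect_Suc mult_ac add_ac)
qed (simp add: defect_def)

text \<open>
  The factors \<open>k - c X\<close> with \<open>k = p - i\<close> are, up to sign, the \<open>i + c X\<close> decreased by \<open>p\<close>. So the last \<open>n\<close>
  factors of \<open>(1 - c X) \<cdots> (p - 1 - c X)\<close> agree with a rising factorial up to \<open>defect\<close>.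
\<close>
lemma pochhammer_split_factor:
  assumes "n \<in> {1..<p}"
  shows "pochhammer (lin c) n * pochhammer (1 - lin c) (p - 1 - n) * defect n c =
           (-1) ^ n * (lin c * recip n c * (fact (p - 1) * E_series (- c)))"
proof -
  obtain m where n: "n = Suc m"
    using assms by (cases n) auto
  have "recip n c * pochhammer (1 + lin c) n = pochhammer (1 + lin c) m * (recip n c * (of_nat n + lin c))"
    by (simp add: n pochhammer_Suc algebra_simps)
  also have "\<dots> = pochhammer (1 + lin c) m"
    using recip_inverse[of n c] n by simp
  finally have 1: "pochhammer (lin c) n = lin c * (recip n c * pochhammer (1 + lin c) n)"
    by (simp add: n pochhammer_rec[of "lin c"] add_ac)
  have "fact (p - 1) * E_series (- c) = pochhammer (1 - lin c) (p - 1)"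
    unfolding pochhammer_E_series[symmetric] lin_uminus by simp
  also have "\<dots> = pochhammer (1 - lin c) (p - 1 - n) * pochhammer (1 - lin c + of_nat (p - 1 - n)) n"
    using assms pochhammer_product[of "p - 1 - n" "p - 1" "1 - lin c"] by simp
  also have "\<dots> = (-1) ^ n * (pochhammer (1 - lin c) (p - 1 - n) * pochhammer (1 + lin c) n * defect n c)"
    using pochhammer_shift_down[of n c] assms by (simp add: mult_ac)
  finally have "(-1) ^ n * (fact (p - 1) * E_series (- c)) =
      pochhammer (1 - lin c) (p - 1 - n) * pochhammer (1 + lin c) n * defect n c"
    by (simp add: mult.assoc[symmetric] flip: power_mult_distrib)
  then have "(-1) ^ n * (lin c * recip n c * (fact (p - 1) * E_series (- c))) =
      lin c * recip n c * (pochhammer (1 - lin c) (p - 1 - n) * pochhammer (1 + lin c) n * defect n c)"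
    by (simp only: mult_ac)
  then show ?thesis
    unfolding 1 by (simp only: mult_ac)
qed

lemma binomial_defect:
  assumes "n < p"
  shows "(-1) ^ n * of_nat ((p - 1) choose n) = defect n 0"
proof -
  have "fact n * defect n 0 = pochhammer (lin 0 - of_nat (p - 1)) n"
    unfolding pochhammer_shift_up by (simp add: pochhammer_fact)
  also have "\<dots> = fact n * ((-1) ^ n * of_nat ((p - 1) choose n))"
    using pochhammer_minus_of_nat[of n "p - 1", where 'a = "rat fps"] assms by (simp add: mult_ac)
  finally show ?thesis
    by simp
qed

text \<open>
  The value of the factor in front of the hypergeometric series.
\<close>
abbreviation E_product :: "rat \<Rightarrow> rat \<Rightarrow> rat fps" where
  "E_product a b \<equiv> E_series (- a) * E_series (- b) * E_series (a + b)"

definition scaled_term :: "rat \<Rightarrow> rat \<Rightarrow> nat \<Rightarrow> rat fps" where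
  "scaled_term a b n = fps_const (1 / fact (p - 1) ^ 3) * whipple_term (lin a) (lin b) (p - 1) n"

definition whipple_sum :: "rat \<Rightarrow> rat \<Rightarrow> rat fps" where
  "whipple_sum a b = (\<Sum>n\<le>p - 1. scaled_term a b n)"

lemma fact_cubed: "fps_const (1 / fact (p - 1) ^ 3) * (fact (p - 1) * fact (p - 1) * fact (p - 1)) = (1 :: rat fps)"
proof -
  have "(fact (p - 1) :: rat fps) = fps_const (fact (p - 1))"
    by (metis fps_of_nat of_nat_fact)
  then show ?thesis
    by (simp add: power3_eq_cube)
qed

lemma fact_cubed_cancel:
  "fps_const (1 / fact (p - 1) ^ 3) * (fact (p - 1) * fact (p - 1) * fact (p - 1) * f) = (f :: rat fps)"
  using fact_cubed by (simp only: mult.assoc[symmetric] mult_1_left)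

lemma scaled_term_0: "scaled_term a b 0 = E_product a b"
proof -
  have "whipple_term (lin a) (lin b) (p - 1) 0 =
      pochhammer (1 + lin (- a)) (p - 1) * pochhammer (1 + lin (- b)) (p - 1) * pochhammer (1 + lin (a + b)) (p - 1)"
    by (simp add: whipple_term_def lin_uminus lin_add add.assoc)
  also have "\<dots> = (fact (p - 1) * fact (p - 1) * fact (p - 1)) * E_product a b"
    unfolding pochhammer_E_series by (simp only: mult_ac)
  finally show ?thesis
    unfolding scaled_term_def by (simp only: fact_cubed_cancel)
qed

text \<open>
  All Pochhammer symbols combine to the prefactor, and the four defects record the pairs of
  parameters that differ by \<open>p\<close>.
\<close>
lemma scaled_term_defect:
  assumes n: "n \<in> {1..<p}"
  shows "scaled_term a b n * (defect n a * defect n b) =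
    lin a * recip n a * (lin b * recip n b) * E_product a b * (defect n 0 * defect n (a + b))"
proof -
  have s: "lin a + lin b - x = lin (a + b) - x" "1 + lin a + lin b + x = 1 + lin (a + b) + x" for x
    by (simp_all add: lin_add)
  have 1: "pochhammer (lin (a + b) - of_nat (p - 1)) n * pochhammer (1 + lin (a + b) + of_nat n) (p - 1 - n) =
      fact (p - 1) * E_series (a + b) * defect n (a + b)"
  proof -
    have "fact (p - 1) * E_series (a + b) =
        pochhammer (1 + lin (a + b)) n * pochhammer (1 + lin (a + b) + of_nat n) (p - 1 - n)"
      unfolding pochhammer_E_series[symmetric] using n by (intro pochhammer_product) auto
    then show ?thesis
      unfolding pochhammer_shift_up by (simp only: mult_ac)
  qed
  have "whipple_term (lin a) (lin b) (p - 1) n * (defect n a * defect n b) =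
     ((-1) ^ n * of_nat ((p - 1) choose n)) *
     (pochhammer (lin a) n * pochhammer (1 - lin a) (p - 1 - n) * defect n a) *
     (pochhammer (lin b) n * pochhammer (1 - lin b) (p - 1 - n) * defect n b) *
     (pochhammer (lin (a + b) - of_nat (p - 1)) n * pochhammer (1 + lin (a + b) + of_nat n) (p - 1 - n))"
    unfolding whipple_term_def s by (simp only: mult_ac)
  also have "\<dots> = defect n 0 *
      ((-1) ^ n * (lin a * recip n a * (fact (p - 1) * E_series (- a)))) *
      ((-1) ^ n * (lin b * recip n b * (fact (p - 1) * E_series (- b)))) *
      (fact (p - 1) * E_series (a + b) * defect n (a + b))"
    using n unfolding pochhammer_split_factor[OF n] 1 by (subst binomial_defect) auto
  also have "\<dots> = ((-1) ^ n * (-1) ^ n) * ((fact (p - 1) * fact (p - 1) * fact (p - 1)) *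
      (lin a * recip n a * (lin b * recip n b) * E_product a b * (defect n 0 * defect n (a + b))))"
    by (simp only: mult_ac)
  also have "(-1) ^ n * (-1) ^ n = (1 :: rat fps)"
    by (simp flip: power_mult_distrib)
  finally have "whipple_term (lin a) (lin b) (p - 1) n * (defect n a * defect n b) =
     (fact (p - 1) * fact (p - 1) * fact (p - 1)) *
      (lin a * recip n a * (lin b * recip n b) * E_product a b * (defect n 0 * defect n (a + b)))"
    by simp
  then show ?thesis
    unfolding scaled_term_def mult.assoc[of "fps_const (1 / fact (p - 1) ^ 3)"]
    by (simp only: fact_cubed_cancel)
qed

definition recip_sum :: "nat \<Rightarrow> rat \<Rightarrow> rat fps" where
  "recip_sum n c = (\<Sum>k\<in>{1..n}. recip k c)"

lemma recip_sum_mem: "c \<in> padic p 0 \<Longrightarrow> n < p \<Longrightarrow> recip_sum n c \<in> fps_padic D p 0"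
  unfolding recip_sum_def by (intro F.sum_mem recip_mem) auto

lemma p_recip_sum_mem: "c \<in> padic p 0 \<Longrightarrow> n < p \<Longrightarrow> of_nat p * recip_sum n c \<in> fps_padic D p 1"
  by (intro F.mult_mem_right p_fps_mem recip_sum_mem)

lemma defect_eqv:
  assumes "c \<in> padic p 0" "n < p"
  shows "F.eqv 2 (defect n c) (1 + - (of_nat p * recip_sum n c))"
proof -
  have "defect n c = (\<Prod>i\<in>{1..n}. 1 + - (of_nat p * recip i c))"
    by (simp add: defect_def)
  also have "F.eqv 2 \<dots> (1 + (\<Sum>i\<in>{1..n}. - (of_nat p * recip i c)))"
    using assms by (intro F.eqv_prod_1_plus F.uminus_mem F.mult_mem_right p_fps_mem recip_mem) auto
  also have "(\<Sum>i\<in>{1..n}. - (of_nat p * recip i c)) = - (of_nat p * recip_sum n c)"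
    by (simp add: recip_sum_def sum_negf sum_distrib_left)
  finally show ?thesis .
qed

lemma pochhammer_mem: "f \<in> fps_padic D p 0 \<Longrightarrow> pochhammer f n \<in> fps_padic D p 0"
  unfolding pochhammer_prod by (intro F.prod_mem F.add_mem F.of_nat_mem)

lemma scaled_term_mem:
  assumes "a \<in> padic p 0" "b \<in> padic p 0"
  shows "scaled_term a b n \<in> fps_padic D p 0"
proof -
  have "1 / fact (p - 1) \<in> padic p 0"
    using gt_2 inverse_mem[of "fact (p - 1)"] by (simp add: prime_dvd_fact_iff[OF prime])
  from R.power_mem[OF this, of 3] have "1 / fact (p - 1) ^ 3 \<in> padic p 0"
    by (simp add: power_one_over)
  moreover have "(-1 :: rat fps) ^ n \<in> fps_padic D p 0"
    by (intro F.power_mem F.uminus_mem F.one_mem)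
  ultimately show ?thesis
    unfolding scaled_term_def whipple_term_def using assms
    by (intro F.mult_mem_left fps_const_mem pochhammer_mem F.diff_mem F.add_mem lin_mem F.of_nat_mem F.one_mem)
qed

definition delta :: "nat \<Rightarrow> rat \<Rightarrow> rat \<Rightarrow> rat fps" where
  "delta n a b = recip_sum n a + recip_sum n b - recip_sum n (a + b) - recip_sum n 0"

text \<open>
  Modulo \<open>p\<^sup>2\<close> each defect equals \<open>1 - p \<sigma>\<close>, where \<open>\<sigma>\<close> is a sum of reciprocals.
\<close>
lemma scaled_term_eqv:
  assumes a: "a \<in> padic p 0" and b: "b \<in> padic p 0" and n: "n \<in> {1..<p}"
  shows "F.eqv 2 (scaled_term a b n)
    (E_product a b * (lin a * lin b * (recip n a * recip n b) * (1 + of_nat p * delta n a b)))"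
proof -
  let ?x = "of_nat p * recip_sum n a" and ?y = "of_nat p * recip_sum n b"
    and ?u = "of_nat p * recip_sum n (a + b)" and ?v = "of_nat p * recip_sum n 0"
  have ab: "a + b \<in> padic p 0" and n': "n < p"
    using a b n by (auto intro: R.add_mem)
  note mem = p_recip_sum_mem[OF a n'] p_recip_sum_mem[OF b n'] p_recip_sum_mem[OF ab n'] p_recip_sum_mem[OF R.zero_mem n']
  have xy: "F.eqv 2 (1 + (?x + ?y)) (1 + (?x + ?y))"
    by simp
  have "F.eqv 2 (defect n a * defect n b * (1 + (?x + ?y))) (1 + ((- ?x + - ?y) + (?x + ?y)))"
    by (intro F.eqv_one_plus_mult defect_eqv F.add_mem F.uminus_mem mem a b n' xy)
  then have 1: "F.eqv 2 (defect n a * defect n b * (1 + (?x + ?y))) 1"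
    by simp
  have "F.eqv 2 (defect n 0 * defect n (a + b) * (1 + (?x + ?y))) (1 + ((- ?v + - ?u) + (?x + ?y)))"
    by (intro F.eqv_one_plus_mult defect_eqv F.add_mem F.uminus_mem mem R.zero_mem ab n' xy)
  then have 2: "F.eqv 2 (defect n 0 * defect n (a + b) * (1 + (?x + ?y))) (1 + of_nat p * delta n a b)"
    by (simp add: delta_def algebra_simps)
  have "F.eqv 2 (scaled_term a b n * 1) (scaled_term a b n * (defect n a * defect n b * (1 + (?x + ?y))))"
    by (intro F.eqv_scale0 scaled_term_mem a b F.eqv_sym[OF 1])
  also have "scaled_term a b n * (defect n a * defect n b * (1 + (?x + ?y))) =
      lin a * recip n a * (lin b * recip n b) * E_product a b * (defect n 0 * defect n (a + b) * (1 + (?x + ?y)))"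
    unfolding mult.assoc[symmetric] scaled_term_defect[OF n, unfolded mult.assoc[symmetric]] ..
  also have "F.eqv 2 \<dots> (lin a * recip n a * (lin b * recip n b) * E_product a b * (1 + of_nat p * delta n a b))"
    by (intro F.eqv_scale0 2 F.mult_mem_left lin_mem recip_mem E_series_mem a b n R.uminus_mem ab)
  finally show ?thesis
    by (simp only: mult_1_right mult_1_left mult_ac)
qed

lemma E_product_minus_1:
  assumes "a \<in> padic p 0" "b \<in> padic p 0"
  shows "F.eqv 2 (E_product a b) (1 + ((E_series (- a) - 1) + (E_series (- b) - 1) + (E_series (a + b) - 1)))"
    and "E_product a b - 1 \<in> fps_padic D p 1"
proof -
  have mem: "E_series (- a) - 1 \<in> fps_padic D p 1" "E_series (- b) - 1 \<in> fps_padic D p 1" "E_series (a + b) - 1 \<in> fps_padic D p 1"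
    by (simp_all only: E_series_minus_1_mem R.uminus_mem R.add_mem assms)
  have refl: "F.eqv 2 (E_series c) (1 + (E_series c - 1))" for c
    by simp
  show *: "F.eqv 2 (E_product a b) (1 + ((E_series (- a) - 1) + (E_series (- b) - 1) + (E_series (a + b) - 1)))"
    by (intro F.eqv_one_plus_mult refl mem F.add_mem)
  have "E_product a b - 1 = (E_product a b - (1 + ((E_series (- a) - 1) + (E_series (- b) - 1) + (E_series (a + b) - 1)))) +
      ((E_series (- a) - 1) + (E_series (- b) - 1) + (E_series (a + b) - 1))"
    by simp
  also have "\<dots> \<in> fps_padic D p 1"
    using * F.mem_antimono[of _ 2 1] by (intro F.add_mem mem) (auto simp: F.eqv_def)
  finally show "E_product a b - 1 \<in> fps_padic D p 1" .
qed

definition correction :: "rat \<Rightarrow> rat \<Rightarrow> rat fps" where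
  "correction a b = (\<Sum>n\<in>{1..<p}. lin a * lin b * (recip n a * recip n b) * (1 + of_nat p * delta n a b))"

lemma sum_recip_recip_mem:
  assumes "a \<in> padic p 0" "b \<in> padic p 0"
  shows "(\<Sum>n\<in>{1..<p}. recip n a * recip n b) \<in> fps_padic D p 1"
proof (rule fps_memI)
  fix i assume i: "i < D"
  have "fps_nth (\<Sum>n\<in>{1..<p}. recip n a * recip n b) i =
      (\<Sum>n\<in>{1..<p}. \<Sum>j\<le>i. (- a) ^ j * (- b) ^ (i - j) * (1 / of_nat n ^ (i + 2)))"
    unfolding fps_sum_nth fps_mult_nth recip_def atMost_atLeast0
    by (intro sum.cong refl) (simp flip: power_add power_Suc)
  also have "\<dots> = (\<Sum>j\<le>i. (- a) ^ j * (- b) ^ (i - j) * (\<Sum>n\<in>{1..<p}. 1 / of_nat n ^ (i + 2)))"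
    unfolding sum_distrib_left by (rule sum.swap)
  also have "\<dots> \<in> padic p 1"
    using assms i D_less
    by (intro R.sum_mem R.mult_mem_left R.power_mem R.uminus_mem power_sum_inverse_mem) auto
  finally show "fps_nth (\<Sum>n\<in>{1..<p}. recip n a * recip n b) i \<in> padic p 1" .
qed

lemma delta_mem: "a \<in> padic p 0 \<Longrightarrow> b \<in> padic p 0 \<Longrightarrow> n < p \<Longrightarrow> delta n a b \<in> fps_padic D p 0"
  unfolding delta_def by (intro F.add_mem F.diff_mem recip_sum_mem R.add_mem R.zero_mem)

lemma correction_mem:
  assumes "a \<in> padic p 0" "b \<in> padic p 0"
  shows "correction a b \<in> fps_padic D p 1"
proof -
  have "correction a b = lin a * lin b * (\<Sum>n\<in>{1..<p}. recip n a * recip n b) +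
      of_nat p * (\<Sum>n\<in>{1..<p}. lin a * lin b * (recip n a * recip n b) * delta n a b)"
    unfolding correction_def sum_distrib_left sum.distrib[symmetric]
    by (intro sum.cong refl) (simp only: distrib_left mult_1_right mult_1_left mult_ac)
  also have "\<dots> \<in> fps_padic D p 1"
  proof (rule F.add_mem)
    show "lin a * lin b * (\<Sum>n\<in>{1..<p}. recip n a * recip n b) \<in> fps_padic D p 1"
      using assms by (intro F.mult_mem_left[OF F.mult_mem_left] sum_recip_recip_mem lin_mem)
    show "of_nat p * (\<Sum>n\<in>{1..<p}. lin a * lin b * (recip n a * recip n b) * delta n a b) \<in> fps_padic D p 1"
      using assms by (intro F.mult_mem_right[OF p_fps_mem] F.sum_mem F.mult_mem_left lin_mem recip_mem delta_mem) auto
  qed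
  finally show ?thesis .
qed

text \<open>
  The prefactor is 1 modulo \<open>p\<close>, and the sum over the terms with \<open>n \<ge> 1\<close> is 0 modulo \<open>p\<close>. So their deviations add up modulo \<open>p\<^sup>2\<close>.
\<close>
lemma whipple_sum_minus_1:
  assumes "a \<in> padic p 0" "b \<in> padic p 0"
  shows "F.eqv 2 (whipple_sum a b - 1) ((E_series (- a) - 1) + (E_series (- b) - 1) + (E_series (a + b) - 1) + correction a b)"
    and "whipple_sum a b - 1 \<in> fps_padic D p 1"
proof -
  have "{..p - 1} = insert 0 {1..<p}"
    using gt_2 by auto
  then have "whipple_sum a b = E_product a b + (\<Sum>n\<in>{1..<p}. scaled_term a b n)"
    by (simp add: whipple_sum_def scaled_term_0)
  also have "F.eqv 2 \<dots> (E_product a b + (\<Sum>n\<in>{1..<p}. E_product a b * (lin a * lin b * (recip n a * recip n b) * (1 + of_nat p * delta n a b))))"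
    using assms by (intro F.eqv_add F.eqv_refl F.eqv_sum scaled_term_eqv)
  also have "\<dots> = E_product a b + E_product a b * correction a b"
    by (simp add: correction_def sum_distrib_left)
  also have "F.eqv 2 \<dots> (1 + ((E_series (- a) - 1) + (E_series (- b) - 1) + (E_series (a + b) - 1)) + correction a b)"
  proof (intro F.eqv_add E_product_minus_1 assms)
    have "(E_product a b - 1) * correction a b \<in> fps_padic D p 2"
      using F.mult_mem[OF E_product_minus_1(2)[OF assms] correction_mem[OF assms]] unfolding one_add_one .
    then show "F.eqv 2 (E_product a b * correction a b) (correction a b)"
      by (simp add: F.eqv_def left_diff_distrib)
  qed
  finally show *: "F.eqv 2 (whipple_sum a b - 1) ((E_series (- a) - 1) + (E_series (- b) - 1) + (E_series (a + b) - 1) + correction a b)"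
    by (simp add: F.eqv_def algebra_simps)
  have "(E_series (- a) - 1) + (E_series (- b) - 1) + (E_series (a + b) - 1) + correction a b \<in> fps_padic D p 1"
    using assms by (intro F.add_mem correction_mem E_series_minus_1_mem R.uminus_mem R.add_mem)
  then show "whipple_sum a b - 1 \<in> fps_padic D p 1"
    using F.eqv_mem[OF F.eqv_antimono[OF *]] by simp
qed

definition double_sum_part :: "rat \<Rightarrow> rat \<Rightarrow> rat \<Rightarrow> rat fps" where
  "double_sum_part a b c = double_sum c a + double_sum c b - double_sum c (a + b) - double_sum c 0"

text \<open>
  Multiplication by \<open>w - z\<close> separates the product of two reciprocals into partial fractions, which
  leaves only single and double sums.
\<close>
lemma difference_correction:
  "(lin b - lin a) * correction a b = lin a * lin b * (single_sum a - single_sum b + of_nat p * (double_sum_part a b a - double_sum_part a b b))"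
proof -
  have recip: "(lin b - lin a) * (recip n a * recip n b) = recip n a - recip n b" if "n \<in> {1..<p}" for n
  proof -
    have "(lin b - lin a) * (recip n a * recip n b) =
        recip n a * (recip n b * (of_nat n + lin b)) - recip n b * (recip n a * (of_nat n + lin a))"
      by (simp only: algebra_simps)
    then show ?thesis
      using that recip_inverse by simp
  qed
  have R: "double_sum c y = (\<Sum>n\<in>{1..<p}. recip n c * recip_sum n y)" for c y
    by (simp add: double_sum_def recip_sum_def sum_distrib_left)
  have Qsum: "(\<Sum>n\<in>{1..<p}. recip n c * delta n a b) = double_sum_part a b c" for c
    unfolding double_sum_part_def R delta_def sum_subtractf[symmetric] sum.distrib[symmetric]
    by (intro sum.cong refl) (simp only: algebra_simps)
  have "(lin b - lin a) * correction a b = lin a * lin b *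
      (\<Sum>n\<in>{1..<p}. (lin b - lin a) * (recip n a * recip n b) * (1 + of_nat p * delta n a b))"
    unfolding correction_def sum_distrib_left by (simp only: mult_ac)
  also have "(\<Sum>n\<in>{1..<p}. (lin b - lin a) * (recip n a * recip n b) * (1 + of_nat p * delta n a b)) =
      (\<Sum>n\<in>{1..<p}. (recip n a - recip n b) * (1 + of_nat p * delta n a b))"
    by (intro sum.cong refl) (simp only: recip)
  also have "\<dots> = (\<Sum>n\<in>{1..<p}. recip n a) - (\<Sum>n\<in>{1..<p}. recip n b) +
      of_nat p * ((\<Sum>n\<in>{1..<p}. recip n a * delta n a b) - (\<Sum>n\<in>{1..<p}. recip n b * delta n a b))"
    unfolding sum_subtractf[symmetric] sum_distrib_left sum.distrib[symmetric]
    by (intro sum.cong refl) (simp only: algebra_simps mult_1_left mult_1_right)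
  finally show ?thesis
    unfolding single_sum_def Qsum .
qed

lemma eqv_scale_p: "F.eqv 1 x y \<Longrightarrow> F.eqv 2 (of_nat p * x) (of_nat p * y)"
  using F.eqv_scale[OF p_fps_mem, of 1 x y] unfolding one_add_one .

text \<open>
  The factors in front of \<open>whipple_sum a b - 1\<close> are those that the evaluations of the single and double sums require. The
  derivative series \<open>beta_theta_series\<close> occur in the single sums and in the double sums
  with a reciprocal of \<open>k\<close>, and cancel.
\<close>
lemma whipple_sum_eqv:
  assumes a: "a \<in> padic p 0" and b: "b \<in> padic p 0"
  defines "z \<equiv> lin a" and "w \<equiv> lin b"
  shows "F.eqv 2 (z * w * (z + w) * (w - z) * (whipple_sum a b - 1))
    (of_nat p * (z * w * (2 * (z - w) * beta_series (a + b) + 2 * (z + w) * beta_series (a - b)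
        - 2 * z * beta_series a + 2 * w * beta_series b)))"
proof -
  define s where "s = z + w"
  define P :: "rat fps" where "P = of_nat p"
  have s: "s = lin (a + b)"
    by (simp add: s_def z_def w_def lin_add)
  have ab: "a + b \<in> padic p 0"
    using a b by (rule R.add_mem)
  have mem: "z \<in> fps_padic D p 0" "w \<in> fps_padic D p 0" "s \<in> fps_padic D p 0"
    unfolding z_def w_def s by (intro lin_mem a b ab)+
  note mems = mem F.mult_mem_left F.add_mem F.diff_mem F.uminus_mem
  have Ez: "F.eqv 2 (z * (E_series (- a) - 1)) (- (P * beta_series a))"
    using F.eqv_minus[OF lin_E_series[OF R.uminus_mem[OF a]]]
    by (simp add: beta_series_uminus lin_uminus z_def P_def)
  have Ew: "F.eqv 2 (w * (E_series (- b) - 1)) (- (P * beta_series b))"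
    using F.eqv_minus[OF lin_E_series[OF R.uminus_mem[OF b]]]
    by (simp add: beta_series_uminus lin_uminus w_def P_def)
  have Es: "F.eqv 2 (s * (E_series (a + b) - 1)) (- (P * beta_series (a + b)))"
    using lin_E_series[OF ab] by (simp add: s P_def)
  have hz: "F.eqv 2 (z\<^sup>2 * single_sum a) (- (P * (beta_theta_series a - beta_series a)))"
    unfolding z_def P_def by (rule lin_single_sum[OF a])
  have hw: "F.eqv 2 (w\<^sup>2 * single_sum b) (- (P * (beta_theta_series b - beta_series b)))"
    unfolding w_def P_def by (rule lin_single_sum[OF b])
  have Raa: "F.eqv 2 (P * (z * z * double_sum a a)) (P * 0)"
    using eqv_scale_p[OF lin_double_sum[OF a a]] by (simp add: z_def P_def beta_series_0)
  have Rbb: "F.eqv 2 (P * (w * w * double_sum b b)) (P * 0)"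
    using eqv_scale_p[OF lin_double_sum[OF b b]] by (simp add: w_def P_def beta_series_0)
  have Rab: "F.eqv 2 (P * (z * w * double_sum a b)) (P * (beta_series (a - b) - beta_series a + beta_series b))"
    using eqv_scale_p[OF lin_double_sum[OF a b]] by (simp add: z_def w_def P_def)
  have Rba: "F.eqv 2 (P * (w * z * double_sum b a)) (P * (- beta_series (a - b) - beta_series b + beta_series a))"
    using eqv_scale_p[OF lin_double_sum[OF b a]] beta_series_uminus[of "a - b"] by (simp add: z_def w_def P_def)
  have Ras: "F.eqv 2 (P * (z * s * double_sum a (a + b))) (P * (- beta_series b - beta_series a + beta_series (a + b)))"
    using eqv_scale_p[OF lin_double_sum[OF a ab]] by (simp add: z_def s P_def beta_series_uminus)
  have Rbs: "F.eqv 2 (P * (w * s * double_sum b (a + b))) (P * (- beta_series a - beta_series b + beta_series (a + b)))"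
    using eqv_scale_p[OF lin_double_sum[OF b ab]] by (simp add: w_def s P_def beta_series_uminus)
  have Ra0: "F.eqv 2 (P * (z\<^sup>2 * double_sum a 0)) (P * (- beta_theta_series a))"
    unfolding z_def P_def by (intro eqv_scale_p lin_double_sum_0 a)
  have Rb0: "F.eqv 2 (P * (w\<^sup>2 * double_sum b 0)) (P * (- beta_theta_series b))"
    unfolding w_def P_def by (intro eqv_scale_p lin_double_sum_0 b)
  \<comment> \<open>The contributions of the prefactor, of the single sums, and of the double sums with outer
    reciprocal \<open>1 / (n + z)\<close> or \<open>1 / (n + w)\<close>.\<close>
  let ?prefix = "w * s * (w - z) * (z * (E_series (- a) - 1)) + z * s * (w - z) * (w * (E_series (- b) - 1))
      + z * w * (w - z) * (s * (E_series (a + b) - 1))"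
  let ?single = "s * w\<^sup>2 * (z\<^sup>2 * single_sum a) - s * z\<^sup>2 * (w\<^sup>2 * single_sum b)"
  let ?Qa = "s * w\<^sup>2 * (P * (z * z * double_sum a a)) + s * z * w * (P * (z * w * double_sum a b))
      - z * w\<^sup>2 * (P * (z * s * double_sum a (a + b))) - s * w\<^sup>2 * (P * (z\<^sup>2 * double_sum a 0))"
  let ?Qb = "s * z * w * (P * (w * z * double_sum b a)) + s * z\<^sup>2 * (P * (w * w * double_sum b b))
      - w * z\<^sup>2 * (P * (w * s * double_sum b (a + b))) - s * z\<^sup>2 * (P * (w\<^sup>2 * double_sum b 0))"
  have "F.eqv 2 (z * w * s * (w - z) * (whipple_sum a b - 1))
      (z * w * s * (w - z) * ((E_series (- a) - 1) + (E_series (- b) - 1) + (E_series (a + b) - 1) + correction a b))"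
    by (intro F.eqv_scale0 whipple_sum_minus_1 a b mems)
  also have "\<dots> = ?prefix + s * z * w * ((w - z) * correction a b)"
    by (simp only: algebra_simps)
  also have "(w - z) * correction a b = z * w * (single_sum a - single_sum b + P * (double_sum_part a b a - double_sum_part a b b))"
    using difference_correction[of b a] by (simp only: z_def w_def P_def)
  also have "?prefix + s * z * w * (z * w * (single_sum a - single_sum b + P * (double_sum_part a b a - double_sum_part a b b))) =
      ?prefix + (?single + (?Qa - ?Qb))"
    unfolding double_sum_part_def by (simp only: algebra_simps power2_eq_square)
  also have "F.eqv 2 \<dots>
     ((w * s * (w - z) * (- (P * beta_series a)) + z * s * (w - z) * (- (P * beta_series b)) + z * w * (w - z) * (- (P * beta_series (a + b))))
      + ((s * w\<^sup>2 * (- (P * (beta_theta_series a - beta_series a))) - s * z\<^sup>2 * (- (P * (beta_theta_series b - beta_series b))))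
      + ((s * w\<^sup>2 * (P * 0) + s * z * w * (P * (beta_series (a - b) - beta_series a + beta_series b))
          - z * w\<^sup>2 * (P * (- beta_series b - beta_series a + beta_series (a + b))) - s * w\<^sup>2 * (P * (- beta_theta_series a)))
       - (s * z * w * (P * (- beta_series (a - b) - beta_series b + beta_series a)) + s * z\<^sup>2 * (P * 0)
          - w * z\<^sup>2 * (P * (- beta_series a - beta_series b + beta_series (a + b))) - s * z\<^sup>2 * (P * (- beta_theta_series b))))))"
    by (intro F.eqv_add F.eqv_diff F.eqv_scale0 Ez Ew Es hz hw Raa Rbb Rab Rba Ras Rbs Ra0 Rb0 mems F.power_mem)
  also have "\<dots> = P * (z * w * (2 * (z - w) * beta_series (a + b) + 2 * s * beta_series (a - b) - 2 * z * beta_series a + 2 * w * beta_series b))"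
    unfolding s_def by (simp add: algebra_simps power2_eq_square)
  finally show ?thesis
    unfolding s_def P_def .
qed

text \<open>
  The divisor is 1 modulo \<open>p\<close>, so division by it subtracts its deviation from 1. This removes the terms
  in \<open>a + b\<close> and \<open>a - b\<close>.
\<close>
lemma star_eqv:
  assumes a: "a \<in> padic p 0" and b: "b \<in> padic p 0" and S: "S \<in> fps_padic D p 0"
    and quotient: "S * (E_series (a + b) * E_series (- (a + b)) * (E_series (a - b) * E_series (- (a - b)))) = whipple_sum a b"
  defines "z \<equiv> lin a" and "w \<equiv> lin b"
  shows "F.eqv 2 (z * w * (z + w) * (w - z) * (S - 1))
    (of_nat p * (z * w * (- 2 * z * beta_series a + 2 * w * beta_series b)))"
proof -
  let ?u = "(E_series (a + b) - 1) + (E_series (- (a + b)) - 1) + ((E_series (a - b) - 1) + (E_series (- (a - b)) - 1))"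
  let ?X = "E_series (a + b) * E_series (- (a + b)) * (E_series (a - b) * E_series (- (a - b)))"
  have mem: "a + b \<in> padic p 0" "a - b \<in> padic p 0"
    using a b R.add_mem R.diff_mem by auto
  have E1: "E_series c - 1 \<in> fps_padic D p 1" "E_series (- c) - 1 \<in> fps_padic D p 1" if "c \<in> padic p 0" for c
    using that by (simp_all only: E_series_minus_1_mem R.uminus_mem)
  have refl: "F.eqv 2 (E_series c) (1 + (E_series c - 1))" for c
    by simp
  have X: "F.eqv 2 ?X (1 + ?u)"
    by (intro F.eqv_one_plus_mult refl E1 mem F.add_mem)
  have u: "?u \<in> fps_padic D p 1"
    by (intro F.add_mem E1 mem)
  have "F.eqv 1 ?X (1 + ?u)"
    using X by (rule F.eqv_antimono) simp
  then have "(?X - (1 + ?u)) + ?u \<in> fps_padic D p 1"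
    using u unfolding F.eqv_def by (rule F.add_mem)
  then have X1: "?X - 1 \<in> fps_padic D p 1"
    by simp
  have "S - 1 = (whipple_sum a b - 1) - S * (?X - 1)"
    unfolding quotient[symmetric] by (simp add: algebra_simps)
  then have S1: "S - 1 \<in> fps_padic D p 1"
    using whipple_sum_minus_1(2)[OF a b] F.mult_mem_left[OF S X1] F.diff_mem by metis
  have "(S - 1) * (?X - 1) \<in> fps_padic D p 2"
    using F.mult_mem[OF S1 X1] unfolding one_add_one .
  moreover have "S - 1 - ((whipple_sum a b - 1) - (?X - 1)) = - ((S - 1) * (?X - 1))"
    unfolding quotient[symmetric] by (simp add: algebra_simps)
  ultimately have "F.eqv 2 (S - 1) ((whipple_sum a b - 1) - (?X - 1))"
    unfolding F.eqv_def using F.uminus_mem by simp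
  also have "F.eqv 2 \<dots> ((whipple_sum a b - 1) - (1 + ?u - 1))"
    by (intro F.eqv_diff X F.eqv_refl)
  also have "(whipple_sum a b - 1) - (1 + ?u - 1) = (whipple_sum a b - 1) - ?u"
    by simp
  finally have S2: "F.eqv 2 (S - 1) ((whipple_sum a b - 1) - ?u)" .
  define s d where "s = z + w" and "d = z - w"
  define P :: "rat fps" where "P = of_nat p"
  have sd: "s = lin (a + b)" "d = lin (a - b)"
    by (simp_all add: s_def d_def z_def w_def lin_add lin_diff)
  have m: "z \<in> fps_padic D p 0" "w \<in> fps_padic D p 0" "s \<in> fps_padic D p 0" "d \<in> fps_padic D p 0"
    unfolding z_def w_def sd by (intro lin_mem a b mem)+
  have Eneg: "F.eqv 2 (lin c * (E_series (- c) - 1)) (- (of_nat p * beta_series c))" if "c \<in> padic p 0" for c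
    using F.eqv_minus[OF lin_E_series[OF R.uminus_mem[OF that]]] by (simp add: beta_series_uminus lin_uminus)
  have Esd: "F.eqv 2 (s * (E_series (a + b) - 1)) (- (P * beta_series (a + b)))"
    "F.eqv 2 (s * (E_series (- (a + b)) - 1)) (- (P * beta_series (a + b)))"
    "F.eqv 2 (d * (E_series (a - b) - 1)) (- (P * beta_series (a - b)))"
    "F.eqv 2 (d * (E_series (- (a - b)) - 1)) (- (P * beta_series (a - b)))"
    unfolding sd P_def by (intro lin_E_series Eneg mem)+
  have "F.eqv 2 (z * w * s * (w - z) * (S - 1)) (z * w * s * (w - z) * ((whipple_sum a b - 1) - ?u))"
    by (intro F.eqv_scale0 S2 F.mult_mem_left F.diff_mem m)
  also have "\<dots> = z * w * s * (w - z) * (whipple_sum a b - 1)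
      + (z * w * d * (s * (E_series (a + b) - 1)) + z * w * d * (s * (E_series (- (a + b)) - 1))
       + (z * w * s * (d * (E_series (a - b) - 1)) + z * w * s * (d * (E_series (- (a - b)) - 1))))"
    unfolding d_def by (simp only: algebra_simps)
  also have "F.eqv 2 \<dots> (P * (z * w * (2 * (z - w) * beta_series (a + b) + 2 * (z + w) * beta_series (a - b)
        - 2 * z * beta_series a + 2 * w * beta_series b))
      + (z * w * d * (- (P * beta_series (a + b))) + z * w * d * (- (P * beta_series (a + b)))
       + (z * w * s * (- (P * beta_series (a - b))) + z * w * s * (- (P * beta_series (a - b))))))"
    unfolding z_def w_def s_def P_def
    by (intro F.eqv_add whipple_sum_eqv a b F.eqv_scale0 F.mult_mem_left Esd[unfolded z_def w_def s_def P_def]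
        m[unfolded z_def w_def s_def])
  also have "\<dots> = P * (z * w * (- 2 * z * beta_series a + 2 * w * beta_series b))"
    unfolding s_def d_def by (simp add: algebra_simps)
  finally show ?thesis
    unfolding s_def P_def .
qed

end

section \<open>Recursions for multiple harmonic sums\<close>

definition index_chains :: "(nat \<Rightarrow> nat \<Rightarrow> bool) \<Rightarrow> nat \<Rightarrow> nat \<Rightarrow> nat list set" where
  "index_chains R N r = {ns. length ns = r \<and> set ns \<subseteq> {1..N} \<and> sorted_wrt R ns}"

definition harmonic_sum :: "(nat \<Rightarrow> nat \<Rightarrow> bool) \<Rightarrow> nat \<Rightarrow> nat list \<Rightarrow> rat" where
  "harmonic_sum R N ks =
     (\<Sum>ns\<in>index_chains R N (length ks). 1 / (\<Prod>i<length ks. of_nat (ns ! i) ^ (ks ! i)))"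

lemma finite_index_chains: "finite (index_chains R N r)"
  by (rule finite_subset[OF _ finite_lists_length_eq[of "{1..N}" r]]) (auto simp: index_chains_def)

lemma harmonic_sum_Nil: "harmonic_sum R N [] = 1"
proof -
  have "index_chains R N 0 = {[]}"
    by (auto simp: index_chains_def)
  then show ?thesis
    by (simp add: harmonic_sum_def)
qed

lemma harmonic_sum_0: "harmonic_sum R 0 (ks @ [k]) = 0"
proof -
  have "index_chains R 0 (Suc r) = {}" for r
    by (auto simp: index_chains_def)
  then show ?thesis
    by (simp add: harmonic_sum_def)
qed

text \<open>
  The strict order belongs to the ordinary sums, the weak order to the star sums. The value \<open>pre N\<close> bounds
  the arguments that may precede the argument \<open>Suc N\<close>.
\<close>
definition step_order :: "(nat \<Rightarrow> nat \<Rightarrow> bool) \<Rightarrow> (nat \<Rightarrow> nat) \<Rightarrow> bool" where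
  "step_order R pre \<longleftrightarrow> (R = (<) \<and> pre = id \<or> R = (\<le>) \<and> pre = Suc)"

lemma step_order_less: "step_order (<) id" and step_order_le: "step_order (\<le>) Suc"
  by (auto simp: step_order_def)

lemma index_chains_Suc:
  assumes "step_order R pre"
  shows "index_chains R (Suc N) (Suc r) = index_chains R N (Suc r) \<union> (\<lambda>ns. ns @ [Suc N]) ` index_chains R (pre N) r"
proof (intro equalityI subsetI)
  fix ns assume ns: "ns \<in> index_chains R (Suc N) (Suc r)"
  then obtain xs x where xs: "ns = xs @ [x]"
    by (metis (mono_tags, lifting) index_chains_def length_Suc_conv_rev mem_Collect_eq)
  show "ns \<in> index_chains R N (Suc r) \<union> (\<lambda>ns. ns @ [Suc N]) ` index_chains R (pre N) r"
  proof (cases "x = Suc N")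
    case True
    then have "xs \<in> index_chains R (pre N) r"
      using ns assms unfolding xs index_chains_def step_order_def
      by (auto simp: sorted_wrt_append subset_iff less_Suc_eq_le)
    then show ?thesis
      using xs True by blast
  next
    case False
    have *: "length xs = r" "set xs \<subseteq> {1..Suc N}" "x \<in> {1..Suc N}" "sorted_wrt R ns" "\<forall>y\<in>set xs. R y x"
      using ns unfolding xs index_chains_def by (auto simp: sorted_wrt_append)
    have R: "y \<le> x" if "R y x" for y
      using that assms by (auto simp: step_order_def)
    have "x \<in> {1..N}"
      using * False by auto
    moreover have "y \<in> {1..N}" if "y \<in> set xs" for y
      using that * R[of y] \<open>x \<in> {1..N}\<close> by auto
    ultimately have "ns \<in> index_chains R N (Suc r)"
      using * unfolding index_chains_def xs by auto
    then show ?thesis ..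
  qed
next
  fix ns assume "ns \<in> index_chains R N (Suc r) \<union> (\<lambda>ns. ns @ [Suc N]) ` index_chains R (pre N) r"
  then show "ns \<in> index_chains R (Suc N) (Suc r)"
    using assms unfolding index_chains_def step_order_def
    by (auto simp: sorted_wrt_append subset_iff less_Suc_eq_le le_Suc_eq)
qed

lemma harmonic_sum_snoc:
  assumes "step_order R pre"
  shows "harmonic_sum R (Suc N) (ks @ [k]) =
    harmonic_sum R N (ks @ [k]) + harmonic_sum R (pre N) ks / of_nat (Suc N) ^ k"
proof -
  let ?r = "length ks"
  let ?t = "\<lambda>ks ns. 1 / (\<Prod>i<length ks. rat_of_nat (ns ! i) ^ (ks ! i))"
  have disj: "index_chains R N (Suc ?r) \<inter> (\<lambda>ns. ns @ [Suc N]) ` index_chains R (pre N) ?r = {}"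
    by (auto simp: index_chains_def)
  have "harmonic_sum R (Suc N) (ks @ [k]) = (\<Sum>ns\<in>index_chains R (Suc N) (Suc ?r). ?t (ks @ [k]) ns)"
    by (simp add: harmonic_sum_def)
  also have "\<dots> = (\<Sum>ns\<in>index_chains R N (Suc ?r). ?t (ks @ [k]) ns) +
      (\<Sum>ns\<in>(\<lambda>ns. ns @ [Suc N]) ` index_chains R (pre N) ?r. ?t (ks @ [k]) ns)"
    unfolding index_chains_Suc[OF assms] using disj by (intro sum.union_disjoint finite_index_chains finite_imageI)
  also have "(\<Sum>ns\<in>index_chains R N (Suc ?r). ?t (ks @ [k]) ns) = harmonic_sum R N (ks @ [k])"
    by (simp add: harmonic_sum_def)
  also have "(\<Sum>ns\<in>(\<lambda>ns. ns @ [Suc N]) ` index_chains R (pre N) ?r. ?t (ks @ [k]) ns) =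
      (\<Sum>ns\<in>index_chains R (pre N) ?r. ?t (ks @ [k]) (ns @ [Suc N]))"
    by (subst sum.reindex) (auto simp: inj_on_def)
  also have "\<dots> = (\<Sum>ns\<in>index_chains R (pre N) ?r. ?t ks ns / of_nat (Suc N) ^ k)"
  proof (intro sum.cong refl)
    fix ns assume "ns \<in> index_chains R (pre N) ?r"
    then have "length ns = ?r" by (simp add: index_chains_def)
    then have "(\<Prod>i<?r. rat_of_nat ((ns @ [Suc N]) ! i) ^ ((ks @ [k]) ! i)) =
        (\<Prod>i<?r. of_nat (ns ! i) ^ (ks ! i))"
      by (intro prod.cong) (auto simp: nth_append)
    then show "?t (ks @ [k]) (ns @ [Suc N]) = ?t ks ns / of_nat (Suc N) ^ k"
      using \<open>length ns = ?r\<close> by (simp add: nth_append del: of_nat_Suc)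
  qed
  also have "\<dots> = harmonic_sum R (pre N) ks / of_nat (Suc N) ^ k"
    by (simp add: harmonic_sum_def sum_divide_distrib)
  finally show ?thesis .
qed

definition odd_entry :: "nat \<Rightarrow> nat" where
  "odd_entry i = (if even i then 1 else 3)"

text \<open>
  The index for an arbitrary number of blocks of 2, so for an arbitrary number of entries 1, 3, 1, ... between them. Cutting off the last
  entry of an index leads out of the indices with as many ones as threes.
\<close>
definition interleave :: "nat list \<Rightarrow> nat list" where
  "interleave ms = replicate (ms ! 0) 2 @
     concat (map (\<lambda>i. odd_entry i # replicate (ms ! Suc i) 2) [0..<length ms - 1])"

lemma interleave_singleton: "interleave [k] = replicate k 2"
  by (simp add: interleave_def)

lemma interleave_snoc:
  assumes "ms \<noteq> []"
  shows "interleave (ms @ [k]) = interleave ms @ odd_entry (length ms - 1) # replicate k 2"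
proof -
  obtain r where r: "length ms = Suc r"
    using assms by (cases ms) auto
  have *: "map (\<lambda>i. odd_entry i # replicate ((ms @ [k]) ! Suc i) 2) [0..<r] =
      map (\<lambda>i. odd_entry i # replicate (ms ! Suc i) 2) [0..<r]"
    using r by (auto simp: nth_append)
  moreover have "(ms @ [k]) ! 0 = ms ! 0" "(ms @ [k]) ! Suc r = k"
    using r by (simp_all add: nth_append)
  ultimately show ?thesis
    unfolding interleave_def length_append_singleton r diff_Suc_1 upt_Suc_append[OF le0]
      map_append concat_append * by simp
qed

lemma index_13_eq_interleave:
  assumes "length ms = 2 * l + 1"
  shows "index_13 l ms = interleave ms"
proof -
  have "concat (map f [0..<2 * l]) = concat (map (\<lambda>i. f (2 * i) @ f (2 * i + 1)) [0..<l])"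
    for f :: "nat \<Rightarrow> nat list"
    by (induction l) auto
  then show ?thesis
    using assms by (simp add: index_13_def interleave_def odd_entry_def)
qed

definition compositions :: "nat \<Rightarrow> nat \<Rightarrow> nat list set" where
  "compositions r m = {ms. length ms = r \<and> sum_list ms = m}"

lemma finite_compositions: "finite (compositions r m)"
  by (rule finite_subset[OF _ finite_lists_length_eq[of "{..m}" r]])
    (auto simp: compositions_def member_le_sum_list)

text \<open>
  Either the last part is positive and can be decreased, or it is 0 and can be removed.
\<close>
lemma sum_compositions_snoc:
  fixes f :: "nat list \<Rightarrow> 'a :: comm_monoid_add"
  shows "(\<Sum>ms\<in>compositions (Suc j) m. f ms) =
    (if m > 0 then \<Sum>ms\<in>compositions (Suc j) (m - 1). f (butlast ms @ [Suc (last ms)]) else 0) +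
    (\<Sum>ms\<in>compositions j m. f (ms @ [0]))"
proof -
  let ?A = "{ms \<in> compositions (Suc j) m. last ms > 0}" and ?B = "{ms \<in> compositions (Suc j) m. last ms = 0}"
  have "(\<Sum>ms\<in>compositions (Suc j) m. f ms) = sum f (?A \<union> ?B)"
    by (intro sum.cong) auto
  also have "\<dots> = sum f ?A + sum f ?B"
    using finite_compositions by (intro sum.union_disjoint) auto
  also have "sum f ?B = (\<Sum>ms\<in>compositions j m. f (ms @ [0]))"
  proof (rule sum.reindex_bij_witness[of _ "\<lambda>ms. ms @ [0]" butlast])
    fix ms assume ms: "ms \<in> ?B"
    then have "ms \<noteq> []" by (auto simp: compositions_def)
    then have eq: "butlast ms @ [0] = ms"
      using ms append_butlast_last_id[of ms] by simp
    then show "butlast ms @ [0] = ms" "f (butlast ms @ [0]) = f ms"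
      by simp_all
    show "butlast ms \<in> compositions j m"
      using ms arg_cong[OF eq, of sum_list] by (auto simp: compositions_def)
  qed (auto simp: compositions_def)
  also have "sum f ?A = (if m > 0 then \<Sum>ms\<in>compositions (Suc j) (m - 1). f (butlast ms @ [Suc (last ms)]) else 0)"
  proof (cases "m > 0")
    case True
    have "sum f ?A = (\<Sum>ms\<in>compositions (Suc j) (m - 1). f (butlast ms @ [Suc (last ms)]))"
    proof (rule sum.reindex_bij_witness[of _ "\<lambda>ms. butlast ms @ [Suc (last ms)]" "\<lambda>ms. butlast ms @ [last ms - 1]"])
      fix ms assume ms: "ms \<in> ?A"
      then have "ms \<noteq> []" by (auto simp: compositions_def)
      then have eq: "butlast ms @ [last ms] = ms"
        by simp
      then show 1: "butlast (butlast ms @ [last ms - 1]) @ [Suc (last (butlast ms @ [last ms - 1]))] = ms"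
        using ms by simp
      then show "f (butlast (butlast ms @ [last ms - 1]) @ [Suc (last (butlast ms @ [last ms - 1]))]) = f ms"
        by simp
      show "butlast ms @ [last ms - 1] \<in> compositions (Suc j) (m - 1)"
        using ms arg_cong[OF eq, of sum_list] by (auto simp: compositions_def)
    next
      fix ms assume ms: "ms \<in> compositions (Suc j) (m - 1)"
      then have "ms \<noteq> []" by (auto simp: compositions_def)
      then have eq: "butlast ms @ [last ms] = ms"
        by simp
      then show "butlast (butlast ms @ [Suc (last ms)]) @ [last (butlast ms @ [Suc (last ms)]) - 1] = ms"
        by simp
      show "butlast ms @ [Suc (last ms)] \<in> ?A"
        using ms True arg_cong[OF eq, of sum_list] by (auto simp: compositions_def)
    qed
    then show ?thesis
      using True by simp
  next
    case False
    have "?A = {}"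
    proof (intro equals0I)
      fix ms assume ms: "ms \<in> ?A"
      then have "last ms \<in> set ms" by (intro last_in_set) (auto simp: compositions_def)
      then show False
        using ms False member_le_sum_list[of "last ms" ms] by (auto simp: compositions_def)
    qed
    show ?thesis
      unfolding \<open>?A = {}\<close> using False by simp
  qed
  finally show ?thesis .
qed

definition word_sum :: "(nat list \<Rightarrow> rat) \<Rightarrow> nat \<Rightarrow> nat \<Rightarrow> rat" where
  "word_sum f j m = (\<Sum>ms\<in>compositions (Suc j) m. f (interleave ms))"

text \<open>
  An index ends in a 2 or in an odd entry, or it is empty.
\<close>
lemma word_sum_rec:
  "word_sum f j m = (if m > 0 then word_sum (\<lambda>ks. f (ks @ [2])) j (m - 1) else 0) +
     (if j > 0 then word_sum (\<lambda>ks. f (ks @ [odd_entry (j - 1)])) (j - 1) m else if m = 0 then f [] else 0)"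
proof -
  have 1: "interleave (butlast ms @ [Suc (last ms)]) = interleave ms @ [2]"
    if "ms \<in> compositions (Suc j) k" for ms k
  proof -
    have ne: "ms \<noteq> []" and len: "length ms = Suc j"
      using that by (auto simp: compositions_def)
    then obtain xs x where ms: "ms = xs @ [x]"
      by (metis append_butlast_last_id)
    show ?thesis
      by (cases "xs = []") (simp_all add: ms interleave_singleton interleave_snoc replicate_append_same)
  qed
  have 2: "(\<Sum>ms\<in>compositions j m. f (interleave (ms @ [0]))) =
     (if j > 0 then word_sum (\<lambda>ks. f (ks @ [odd_entry (j - 1)])) (j - 1) m else if m = 0 then f [] else 0)"
  proof (cases "j > 0")
    case True
    have "(\<Sum>ms\<in>compositions j m. f (interleave (ms @ [0]))) =
        (\<Sum>ms\<in>compositions j m. f (interleave ms @ [odd_entry (j - 1)]))"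
      using True by (intro sum.cong refl) (subst interleave_snoc, auto simp: compositions_def)
    then show ?thesis
      using True by (simp add: word_sum_def)
  next
    case False
    have "compositions 0 m = (if m = 0 then {[]} else {})"
      by (auto simp: compositions_def)
    then show ?thesis
      using False by (simp add: interleave_singleton)
  qed
  have 3: "(\<Sum>ms\<in>compositions (Suc j) (m - 1). f (interleave (butlast ms @ [Suc (last ms)]))) =
      word_sum (\<lambda>ks. f (ks @ [2])) j (m - 1)"
    unfolding word_sum_def by (intro sum.cong refl) (simp add: 1)
  have "word_sum f j m = (\<Sum>ms\<in>compositions (Suc j) m. f (interleave ms))"
    by (simp add: word_sum_def)
  also have "\<dots> = (if m > 0 then word_sum (\<lambda>ks. f (ks @ [2])) j (m - 1) else 0) +
     (if j > 0 then word_sum (\<lambda>ks. f (ks @ [odd_entry (j - 1)])) (j - 1) m else if m = 0 then f [] else 0)"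
    using sum_compositions_snoc[of "\<lambda>ms. f (interleave ms)" j m] unfolding 2 3 .
  finally show ?thesis .
qed

definition interleaved_sum :: "(nat \<Rightarrow> nat \<Rightarrow> bool) \<Rightarrow> nat \<Rightarrow> nat \<Rightarrow> nat \<Rightarrow> rat" where
  "interleaved_sum R N j m = word_sum (harmonic_sum R N) j m"

lemma interleaved_sum_0: "interleaved_sum R 0 j m = (if j = 0 \<and> m = 0 then 1 else 0)"
  unfolding interleaved_sum_def by (subst word_sum_rec) (simp add: harmonic_sum_0 harmonic_sum_Nil word_sum_def)

lemma word_sum_add_scale:
  "word_sum (\<lambda>ks. f ks + g ks / c) j m = word_sum f j m + word_sum g j m / c"
  by (simp add: word_sum_def sum.distrib sum_divide_distrib)

text \<open>
  The largest argument is \<open>Suc N\<close> or not. If it is, the last entry of the index is removed.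
\<close>
lemma interleaved_sum_Suc:
  assumes "step_order R pre"
  shows "interleaved_sum R (Suc N) j m = interleaved_sum R N j m +
    (if m > 0 then interleaved_sum R (pre N) j (m - 1) / of_nat (Suc N) ^ 2 else 0) +
    (if j > 0 then interleaved_sum R (pre N) (j - 1) m / of_nat (Suc N) ^ odd_entry (j - 1) else 0)"
  unfolding interleaved_sum_def word_sum_rec[of "harmonic_sum R (Suc N)"] word_sum_rec[of "harmonic_sum R N"]
  by (simp add: harmonic_sum_snoc[OF assms] word_sum_add_scale harmonic_sum_Nil del: of_nat_Suc)

text \<open>
  The coefficient of \<open>X\<close> to the power \<open>2 M\<close> collects the indices with \<open>j\<close> odd entries and \<open>M - j\<close> entries 2, where \<open>j\<close> is
  even or odd according to \<open>e\<close>. Every entry contributes the square of \<open>X\<close>, because the variables of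
  the generating function are quadratic in \<open>z = a X\<close> and \<open>w = b X\<close>.
\<close>
definition gen_fun :: "(nat \<Rightarrow> nat \<Rightarrow> bool) \<Rightarrow> rat \<Rightarrow> rat \<Rightarrow> bool \<Rightarrow> nat \<Rightarrow> rat fps" where
  "gen_fun R v t e N = Abs_fps (\<lambda>i. if even i then
     (\<Sum>j\<le>i div 2. if even j = e then interleaved_sum R N j (i div 2 - j) * v ^ j * t ^ (i div 2 - j) else 0) else 0)"

lemma gen_fun_0: "gen_fun R v t e 0 = (if e then 1 else 0)"
proof (rule fps_ext)
  fix i
  have "(\<Sum>j\<le>M. if even j = e then interleaved_sum R 0 j (M - j) * v ^ j * t ^ (M - j) else 0) =
      (if M = 0 \<and> e then 1 else 0)" for M
  proof -
    have "(\<Sum>j\<le>M. if even j = e then interleaved_sum R 0 j (M - j) * v ^ j * t ^ (M - j) else 0) =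
        (\<Sum>j\<le>M. if j = 0 then (if M = 0 \<and> e then 1 else 0) else 0)"
      by (intro sum.cong refl) (auto simp: interleaved_sum_0)
    then show ?thesis by simp
  qed
  then show "fps_nth (gen_fun R v t e 0) i = fps_nth (if e then 1 else 0) i"
    by (auto simp: gen_fun_def elim!: evenE)
qed

text \<open>
  One step of the matrix product. The two components are the values of \<open>e\<close>.
\<close>
lemma gen_fun_Suc:
  assumes "step_order R pre"
  shows "gen_fun R v t e (Suc N) = gen_fun R v t e N +
     fps_const (t / of_nat (Suc N) ^ 2) * (fps_X ^ 2 * gen_fun R v t e (pre N)) +
     fps_const (v / of_nat (Suc N) ^ (if e then 3 else 1)) * (fps_X ^ 2 * gen_fun R v t (\<not> e) (pre N))"
proof (rule fps_ext)
  fix i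
  let ?n = "rat_of_nat (Suc N)"
  let ?c = "if e then 3 else 1 :: nat"
  define f where "f N e M = (\<Sum>j\<le>M. if even j = e then interleaved_sum R N j (M - j) * v ^ j * t ^ (M - j) else 0)" for N e M
  have nth: "fps_nth (gen_fun R v t e N) i = (if even i then f N e (i div 2) else 0)" for N e i
    by (simp add: gen_fun_def f_def)
  have f0: "f (Suc N) e 0 = f N e 0"
    unfolding f_def by (intro sum.cong refl) (simp add: interleaved_sum_Suc[OF assms])
  have fSuc: "f (Suc N) e (Suc M) = f N e (Suc M) + t / ?n ^ 2 * f (pre N) e M + v / ?n ^ ?c * f (pre N) (\<not> e) M" for M
  proof -
    let ?g = "\<lambda>j. if even j = e \<and> j \<le> M then interleaved_sum R (pre N) j (M - j) / ?n ^ 2 * v ^ j * t ^ (Suc M - j) else 0"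
    let ?h = "\<lambda>j. if even j = e \<and> j > 0 then interleaved_sum R (pre N) (j - 1) (Suc M - j) / ?n ^ odd_entry (j - 1) * v ^ j * t ^ (Suc M - j) else 0"
    have "f (Suc N) e (Suc M) = (\<Sum>j\<le>Suc M.
        (if even j = e then interleaved_sum R N j (Suc M - j) * v ^ j * t ^ (Suc M - j) else 0) + ?g j + ?h j)"
      unfolding f_def
    proof (intro sum.cong refl)
      fix j assume "j \<in> {..Suc M}"
      then have "(if Suc M - j > 0 then interleaved_sum R (pre N) j (Suc M - j - 1) / ?n ^ 2 else 0) =
          (if j \<le> M then interleaved_sum R (pre N) j (M - j) / ?n ^ 2 else 0)"
        by auto
      then show "(if even j = e then interleaved_sum R (Suc N) j (Suc M - j) * v ^ j * t ^ (Suc M - j) else 0) =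
        (if even j = e then interleaved_sum R N j (Suc M - j) * v ^ j * t ^ (Suc M - j) else 0) + ?g j + ?h j"
        unfolding interleaved_sum_Suc[OF assms] by (simp add: distrib_right del: of_nat_Suc)
    qed
    also have "\<dots> = f N e (Suc M) + (\<Sum>j\<le>Suc M. ?g j) + (\<Sum>j\<le>Suc M. ?h j)"
      unfolding sum.distrib f_def ..
    also have "(\<Sum>j\<le>Suc M. ?g j) = t / ?n ^ 2 * f (pre N) e M"
    proof -
      have "(\<Sum>j\<le>Suc M. ?g j) = (\<Sum>j\<le>M. ?g j)"
        by simp
      also have "\<dots> = t / ?n ^ 2 * f (pre N) e M"
        unfolding f_def sum_distrib_left by (intro sum.cong refl) (auto simp: Suc_diff_le)
      finally show ?thesis .
    qed
    also have "(\<Sum>j\<le>Suc M. ?h j) = v / ?n ^ ?c * f (pre N) (\<not> e) M"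
    proof -
      have "(\<Sum>j\<le>Suc M. ?h j) = (\<Sum>j\<le>M. ?h (Suc j))"
        by (subst sum.atMost_Suc_shift) simp
      also have "\<dots> = v / ?n ^ ?c * f (pre N) (\<not> e) M"
        unfolding f_def sum_distrib_left
        by (intro sum.cong refl) (auto simp: odd_entry_def simp del: of_nat_Suc)
      finally show ?thesis .
    qed
    finally show ?thesis .
  qed
  have X: "fps_nth (fps_const c * (fps_X ^ 2 * g)) i = (if i < 2 then 0 else c * fps_nth g (i - 2))" for c and g :: "rat fps"
    by (simp add: fps_X_power_mult_nth)
  show "fps_nth (gen_fun R v t e (Suc N)) i = fps_nth (gen_fun R v t e N +
     fps_const (t / ?n ^ 2) * (fps_X ^ 2 * gen_fun R v t e (pre N)) +
     fps_const (v / ?n ^ ?c) * (fps_X ^ 2 * gen_fun R v t (\<not> e) (pre N))) i"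
  proof (cases "even i")
    case True
    then obtain M where i: "i = 2 * M" by (elim evenE)
    show ?thesis
    proof (cases M)
      case 0
      then show ?thesis
        unfolding fps_add_nth X nth using i f0 by simp
    next
      case (Suc M')
      then show ?thesis
        unfolding fps_add_nth X nth using i fSuc[of M'] by (simp del: of_nat_Suc)
    qed
  next
    case False
    then show ?thesis
      unfolding fps_add_nth X nth by simp
  qed
qed

section \<open>Generating functions of the interleaved sums\<close>

text \<open>
  Both sides satisfy the same recursion in \<open>N\<close>. Cubes of factorials clear the denominators.
\<close>
lemma gen_fun_eq_whipple:
  fixes a b :: rat
  defines "z \<equiv> fps_const a * fps_X" and "w \<equiv> fps_const b * fps_X"
  defines "A \<equiv> gen_fun (<) (2 * a * b) (- (a ^ 2 + b ^ 2))"
  shows "fact N ^ 3 * A True N = (\<Sum>n\<le>N. whipple_term z w N n)"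
    and "fact N ^ 3 * (z * w * A False N) = (\<Sum>n\<le>N. whipple_term z w N n * whipple_weight z w N n)"
proof -
  have t: "fps_const (- (a ^ 2 + b ^ 2)) * fps_X ^ 2 = - (z ^ 2 + w ^ 2)"
    by (simp add: z_def w_def power_mult_distrib algebra_simps flip: fps_const_power fps_const_neg fps_const_add fps_const_sub)
  have v: "fps_const (2 * a * b) * fps_X ^ 2 = 2 * (z * w)"
    by (simp add: z_def w_def power2_eq_square algebra_simps numeral_fps_const)
  have n: "of_nat (Suc M) * fps_const (x / of_nat (Suc M)) = (fps_const x :: rat fps)" for M x
    unfolding fps_of_nat[symmetric] by (simp del: of_nat_Suc)
  have step: "of_nat (Suc M) ^ 3 * A e (Suc M) = of_nat (Suc M) ^ 3 * A e M
      - of_nat (Suc M) * (z ^ 2 + w ^ 2) * A e M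
      + (if e then 1 else of_nat (Suc M) ^ 2) * (2 * (z * w)) * A (\<not> e) M" for M e
  proof -
    let ?n = "of_nat (Suc M) :: rat fps" and ?t = "- (a ^ 2 + b ^ 2)" and ?v = "2 * a * b"
    have "of_nat (Suc M) ^ 2 * fps_const (x / of_nat (Suc M) ^ 2) = (fps_const x :: rat fps)" for x
      unfolding fps_of_nat[symmetric] by (simp del: of_nat_Suc)
    then have "?n ^ 3 * fps_const (?t / of_nat (Suc M) ^ 2) = ?n * fps_const ?t"
      by (simp only: power3_eq_cube power2_eq_square mult.assoc)
    then have 1: "?n ^ 3 * (fps_const (?t / of_nat (Suc M) ^ 2) * (fps_X ^ 2 * f)) = - (?n * (z ^ 2 + w ^ 2) * f)" for f
    proof -
      have "?n ^ 3 * (fps_const (?t / of_nat (Suc M) ^ 2) * (fps_X ^ 2 * f)) =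
          ?n ^ 3 * fps_const (?t / of_nat (Suc M) ^ 2) * (fps_X ^ 2 * f)"
        by (simp only: mult.assoc)
      also have "\<dots> = ?n * (fps_const ?t * fps_X ^ 2) * f"
        unfolding \<open>?n ^ 3 * fps_const (?t / of_nat (Suc M) ^ 2) = ?n * fps_const ?t\<close>
        by (simp only: mult.assoc)
      also have "\<dots> = - (?n * (z ^ 2 + w ^ 2) * f)"
        unfolding t by (simp only: mult_minus_left mult_minus_right)
      finally show ?thesis .
    qed
    have "of_nat (Suc M) ^ 3 * fps_const (x / of_nat (Suc M) ^ 3) = (fps_const x :: rat fps)" for x
      unfolding fps_of_nat[symmetric] by (simp del: of_nat_Suc)
    then have "?n ^ 3 * fps_const (?v / of_nat (Suc M) ^ (if e then 3 else 1)) =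
        (if e then 1 else ?n ^ 2) * fps_const ?v"
      using n[of M ?v] by (auto simp: power3_eq_cube power2_eq_square mult.assoc simp del: of_nat_Suc)
    then have 2: "?n ^ 3 * (fps_const (?v / of_nat (Suc M) ^ (if e then 3 else 1)) * (fps_X ^ 2 * f)) =
        (if e then 1 else ?n ^ 2) * (2 * (z * w)) * f" for f
      unfolding v[symmetric] by (simp only: mult.assoc[symmetric])
    show ?thesis
      unfolding A_def gen_fun_Suc[OF step_order_less] id_apply distrib_left 1 2 by simp
  qed
  have "fact N ^ 3 * A True N = (\<Sum>n\<le>N. whipple_term z w N n) \<and>
    fact N ^ 3 * (z * w * A False N) = (\<Sum>n\<le>N. whipple_term z w N n * whipple_weight z w N n)"
  proof (induction N)
    case 0
    then show ?case
      by (simp add: A_def gen_fun_0 whipple_term_def whipple_weight_def)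
  next
    case (Suc M)
    let ?n = "of_nat (Suc M) :: rat fps"
    have fact: "fact (Suc M) ^ 3 = (fact M ^ 3 * ?n ^ 3 :: rat fps)"
      by (simp add: power_mult_distrib mult_ac del: of_nat_Suc)
    have "fact (Suc M) ^ 3 * A True (Suc M) = fact M ^ 3 * (?n ^ 3 * A True (Suc M))"
      unfolding fact by (simp only: mult.assoc)
    also have "\<dots> = (?n ^ 3 - (z\<^sup>2 + w\<^sup>2) * ?n) * (fact M ^ 3 * A True M)
        + 2 * (fact M ^ 3 * (z * w * A False M))"
      unfolding step if_True simp_thms by (simp only: algebra_simps mult_1_left)
    also have "\<dots> = (\<Sum>n\<le>Suc M. whipple_term z w (Suc M) n)"
      using Suc unfolding whipple_recurrence_1 by (simp only:)
    finally have 1: "fact (Suc M) ^ 3 * A True (Suc M) = (\<Sum>n\<le>Suc M. whipple_term z w (Suc M) n)" .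
    have "fact (Suc M) ^ 3 * (z * w * A False (Suc M)) = fact M ^ 3 * (z * w) * (?n ^ 3 * A False (Suc M))"
      unfolding fact by (simp only: mult_ac)
    also have "\<dots> = 2 * (z * w)\<^sup>2 * ?n\<^sup>2 * (fact M ^ 3 * A True M) +
        (?n ^ 3 - (z\<^sup>2 + w\<^sup>2) * ?n) * (fact M ^ 3 * (z * w * A False M))"
      unfolding step if_False simp_thms by (simp only: algebra_simps mult_1_left power2_eq_square)
    also have "\<dots> = (\<Sum>n\<le>Suc M. whipple_term z w (Suc M) n * whipple_weight z w (Suc M) n)"
      using Suc unfolding whipple_recurrence_2 by (simp only:)
    finally show ?case
      using 1 by blast
  qed
  then show "fact N ^ 3 * A True N = (\<Sum>n\<le>N. whipple_term z w N n)"
    and "fact N ^ 3 * (z * w * A False N) = (\<Sum>n\<le>N. whipple_term z w N n * whipple_weight z w N n)"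
    by blast+
qed

text \<open>
  For the weak order the recursion is implicit: the new pair of series times \<open>1 - K\<close> is the old
  pair. Multiplying by the adjugate of \<open>1 - K\<close> gives the explicit recursion for the strict order with
  \<open>t\<close> replaced by \<open>- t\<close>, up to the determinant. The factor of the product belonging to \<open>n\<close> is this determinant.
\<close>
lemma gen_fun_star:
  "gen_fun (\<le>) v t e N * (\<Prod>n\<in>{1..<Suc N}. (1 - fps_const (t / of_nat n ^ 2) * fps_X ^ 2) ^ 2 -
      (fps_const (v / of_nat n ^ 2) * fps_X ^ 2) ^ 2) = gen_fun (<) v (- t) e N"
proof (induction N arbitrary: e)
  case (Suc N)
  let ?n = "rat_of_nat (Suc N)"
  define B A where "B = gen_fun (\<le>) v t" and "A = gen_fun (<) v (- t)"
  define \<tau> \<nu> where "\<tau> = fps_const (t / ?n ^ 2) * fps_X ^ 2"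
    and "\<nu> e = fps_const (v / ?n ^ (if e then 3 else 1)) * fps_X ^ 2" for e
  define P where "P = (\<Prod>n\<in>{1..<Suc N}. (1 - fps_const (t / of_nat n ^ 2) * fps_X ^ 2) ^ 2 -
      (fps_const (v / of_nat n ^ 2) * fps_X ^ 2) ^ 2)"
  have IH: "B e N * P = A e N" for e
    using Suc.IH by (simp add: A_def B_def P_def)
  have tau_minus: "fps_const (- t / ?n ^ 2) * (fps_X ^ 2 * f) = - (\<tau> * f)" for f
  proof -
    have "- t / ?n ^ 2 = - (t / ?n ^ 2)" by simp
    then have "fps_const (- t / ?n ^ 2) = - fps_const (t / ?n ^ 2)"
      by (simp only: fps_const_neg)
    then show ?thesis
      by (simp only: \<tau>_def mult_minus_left mult.assoc)
  qed
  have A: "A e (Suc N) = (1 - \<tau>) * A e N + \<nu> e * A (\<not> e) N" for e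
    unfolding A_def gen_fun_Suc[OF step_order_less] id_apply tau_minus
    by (simp only: \<nu>_def left_diff_distrib mult_1_left mult.assoc) simp
  have B: "(1 - \<tau>) * B e (Suc N) = B e N + \<nu> e * B (\<not> e) (Suc N)" for e
  proof -
    have "B e (Suc N) = B e N + \<tau> * B e (Suc N) + \<nu> e * B (\<not> e) (Suc N)"
      unfolding B_def \<tau>_def \<nu>_def by (subst (1) gen_fun_Suc[OF step_order_le]) (simp only: mult.assoc)
    moreover have "(1 - c) * x = y + u" if "x = y + c * x + u" for c x y u :: "rat fps"
      using arg_cong[OF that, of "\<lambda>s. s - c * x"] by (simp add: algebra_simps)
    ultimately show ?thesis
      by blast
  qed
  have \<nu>: "\<nu> e * \<nu> (\<not> e) = (fps_const (v / ?n ^ 2) * fps_X ^ 2) ^ 2" for e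
  proof -
    have "v / ?n ^ (if e then 3 else 1) * (v / ?n ^ (if \<not> e then 3 else 1)) = v / ?n ^ 2 * (v / ?n ^ 2)"
      by (cases e) (simp_all add: power2_eq_square power3_eq_cube del: of_nat_Suc)
    moreover have "fps_const x * f * (fps_const y * f) = fps_const (x * y) * (f * f)" for x y :: rat and f
      by (simp only: fps_const_mult[symmetric] mult_ac)
    ultimately show ?thesis
      unfolding \<nu>_def power2_eq_square[of "fps_const _ * _"] by (simp only:)
  qed
  have "B e (Suc N) * ((1 - \<tau>) ^ 2 - \<nu> e * \<nu> (\<not> e)) = (1 - \<tau>) * ((1 - \<tau>) * B e (Suc N)) - \<nu> e * (\<nu> (\<not> e) * B e (Suc N))"
    by (simp add: algebra_simps power2_eq_square)
  also have "\<nu> (\<not> e) * B e (Suc N) = (1 - \<tau>) * B (\<not> e) (Suc N) - B (\<not> e) N"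
    using B[of "\<not> e"] by simp
  also have "(1 - \<tau>) * B e (Suc N) = B e N + \<nu> e * B (\<not> e) (Suc N)"
    by (rule B)
  finally have "B e (Suc N) * ((1 - \<tau>) ^ 2 - \<nu> e * \<nu> (\<not> e)) = (1 - \<tau>) * B e N + \<nu> e * B (\<not> e) N"
    by (simp add: algebra_simps)
  then have "P * (B e (Suc N) * ((1 - \<tau>) ^ 2 - \<nu> e * \<nu> (\<not> e))) = P * ((1 - \<tau>) * B e N + \<nu> e * B (\<not> e) N)"
    by (simp only:)
  then have "B e (Suc N) * (P * ((1 - \<tau>) ^ 2 - \<nu> e * \<nu> (\<not> e))) = (1 - \<tau>) * (B e N * P) + \<nu> e * (B (\<not> e) N * P)"
    by (simp only: distrib_left mult_ac)
  also have "\<dots> = A e (Suc N)"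
    unfolding IH A ..
  finally show ?case
    unfolding \<nu> \<tau>_def P_def A_def B_def by (simp del: of_nat_Suc)
qed (simp add: gen_fun_0)

context fps_prime
begin

lemma gen_fun_eq_whipple_sum: "gen_fun (<) (2 * a * b) (- (a ^ 2 + b ^ 2)) True (p - 1) = whipple_sum a b"
proof -
  have fact: "(fact (p - 1) :: rat fps) = fps_const (fact (p - 1))"
    by (metis fps_of_nat of_nat_fact)
  have "whipple_sum a b = fps_const (1 / fact (p - 1) ^ 3) *
      (fact (p - 1) ^ 3 * gen_fun (<) (2 * a * b) (- (a ^ 2 + b ^ 2)) True (p - 1))"
    unfolding gen_fun_eq_whipple(1) whipple_sum_def scaled_term_def sum_distrib_left ..
  also have "\<dots> = gen_fun (<) (2 * a * b) (- (a ^ 2 + b ^ 2)) True (p - 1)"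
    unfolding fact mult.assoc[symmetric] by (simp add: fps_const_power)
  finally show ?thesis ..
qed

text \<open>
  For \<open>t = a\<^sup>2 + b\<^sup>2\<close> and \<open>v = 2 a b\<close> the determinant splits into the factors \<open>1 \<plusminus> (a + b) X / n\<close> and \<open>1 \<plusminus> (a - b) X / n\<close>.
\<close>
lemma gen_fun_star_eq_whipple_sum:
  "gen_fun (\<le>) (2 * a * b) (a ^ 2 + b ^ 2) True (p - 1) *
     (E_series (a + b) * E_series (- (a + b)) * (E_series (a - b) * E_series (- (a - b)))) = whipple_sum a b"
proof -
  have "(1 - fps_const ((a ^ 2 + b ^ 2) / of_nat n ^ 2) * fps_X ^ 2) ^ 2 -
      (fps_const (2 * a * b / of_nat n ^ 2) * fps_X ^ 2) ^ 2 =
     (1 + fps_const (1 / of_nat n) * lin (a + b)) * (1 + fps_const (1 / of_nat n) * lin (- (a + b))) *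
     ((1 + fps_const (1 / of_nat n) * lin (a - b)) * (1 + fps_const (1 / of_nat n) * lin (- (a - b))))" for n
  proof -
    define c x y where "c = fps_const (1 / rat_of_nat n)" and "x = lin a" and "y = lin b"
    have 1: "fps_const ((a ^ 2 + b ^ 2) / of_nat n ^ 2) * fps_X ^ 2 = c ^ 2 * (x ^ 2 + y ^ 2)"
      unfolding c_def x_def y_def
      by (simp only: power_mult_distrib fps_const_power distrib_right[symmetric] fps_const_add
          mult.assoc[symmetric] fps_const_mult) (simp add: power_one_over)
    have 2: "fps_const (2 * a * b / of_nat n ^ 2) * fps_X ^ 2 = 2 * c ^ 2 * (x * y)"
      by (simp add: c_def x_def y_def power2_eq_square numeral_fps_const)
    show ?thesis
      unfolding 1 2 lin_add lin_diff lin_uminus c_def[symmetric] x_def[symmetric] y_def[symmetric]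
      by (simp add: algebra_simps power2_eq_square)
  qed
  then have "(\<Prod>n\<in>{1..<p}. (1 - fps_const ((a ^ 2 + b ^ 2) / of_nat n ^ 2) * fps_X ^ 2) ^ 2 -
      (fps_const (2 * a * b / of_nat n ^ 2) * fps_X ^ 2) ^ 2) =
     E_series (a + b) * E_series (- (a + b)) * (E_series (a - b) * E_series (- (a - b)))"
    unfolding E_series_eq_prod prod.distrib by (simp only: prod.distrib)
  moreover have "Suc (p - 1) = p"
    using gt_2 by simp
  ultimately show ?thesis
    using gen_fun_star[of "2 * a * b" "a ^ 2 + b ^ 2" True "p - 1"] unfolding gen_fun_eq_whipple_sum[symmetric] by simp
qed

end

text \<open>
  The coefficient of \<open>X\<close> to the power \<open>2 M\<close> in \<open>gen_fun\<close> for \<open>v = 2 x\<close> and \<open>t = \<epsilon> (1 + x\<^sup>2)\<close>. The sign \<open>\<epsilon>\<close> tells the two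
  orders apart.
\<close>
definition even_part :: "nat \<Rightarrow> (nat \<Rightarrow> rat) \<Rightarrow> rat \<Rightarrow> rat \<Rightarrow> rat" where
  "even_part M s \<epsilon> x = (\<Sum>j\<le>M. if even j then s j * (2 * x) ^ j * (\<epsilon> * (1 + x ^ 2)) ^ (M - j) else 0)"

lemma even_part_diff:
  "even_part M (\<lambda>j. s j - b * c j) \<epsilon> x = even_part M s \<epsilon> x - b * even_part M c \<epsilon> x"
  unfolding even_part_def sum_distrib_left sum_subtractf[symmetric]
  by (intro sum.cong refl) (simp add: left_diff_distrib mult.assoc)

context odd_prime
begin

lemma harmonic_sum_mem: "harmonic_sum R (p - 1) ks \<in> padic p 0"
  unfolding harmonic_sum_def
proof (rule R.sum_mem)
  fix ns assume ns: "ns \<in> index_chains R (p - 1) (length ks)"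
  have "(\<Prod>i<length ks. 1 / rat_of_nat (ns ! i) ^ (ks ! i)) \<in> padic p 0"
  proof (rule R.prod_mem)
    fix i assume "i \<in> {..<length ks}"
    then have "ns ! i \<in> set ns" using ns by (auto simp: index_chains_def)
    then have "ns ! i \<in> {1..p - 1}" using ns by (auto simp: index_chains_def)
    then show "1 / rat_of_nat (ns ! i) ^ (ks ! i) \<in> padic p 0"
      using gt_2 by (intro inverse_power_mem) auto
  qed
  then show "1 / (\<Prod>i<length ks. rat_of_nat (ns ! i) ^ (ks ! i)) \<in> padic p 0"
    by (simp add: prod_dividef)
qed

lemma interleaved_sum_mem: "interleaved_sum R (p - 1) j m \<in> padic p 0"
  unfolding interleaved_sum_def word_sum_def by (intro R.sum_mem harmonic_sum_mem)

end

context fps_prime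
begin

lemma gen_fun_mem: "v \<in> padic p 0 \<Longrightarrow> t \<in> padic p 0 \<Longrightarrow> gen_fun R v t e (p - 1) \<in> fps_padic D p 0"
proof (rule fps_memI)
  fix i assume vt: "v \<in> padic p 0" "t \<in> padic p 0"
  have "(if even j = e then interleaved_sum R (p - 1) j (i div 2 - j) * v ^ j * t ^ (i div 2 - j) else 0) \<in> padic p 0" for j
    using R.mult_mem_left[OF R.mult_mem_left[OF interleaved_sum_mem R.power_mem[OF vt(1)]] R.power_mem[OF vt(2)]] R.zero_mem by simp
  then have "(\<Sum>j\<le>i div 2. if even j = e then interleaved_sum R (p - 1) j (i div 2 - j) * v ^ j * t ^ (i div 2 - j) else 0) \<in> padic p 0"
    by (rule R.sum_mem)
  then show "fps_nth (gen_fun R v t e (p - 1)) i \<in> padic p 0"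
    unfolding gen_fun_def fps_nth_Abs_fps using R.zero_mem by (cases "even i") (simp_all only: if_True if_False)
qed

lemma weight_nth:
  "fps_nth (lin a * lin b * (lin a + lin b) * (lin b - lin a) * f) (i + 4) = a * b * (b ^ 2 - a ^ 2) * fps_nth f i"
proof -
  have "lin a * lin b * (lin a + lin b) * (lin b - lin a) * f = lin a * (lin b * (lin (a + b) * (lin (b - a) * f)))"
    unfolding lin_add[symmetric] lin_diff[symmetric] by (simp only: mult.assoc)
  then show ?thesis
    unfolding lin_mult_nth by (simp only: lin_mult_nth) (simp add: algebra_simps power2_eq_square)
qed

lemma lin_lin_nth: "fps_nth (lin a * (lin b * (lin c * f))) (i + 3) = a * b * c * fps_nth f i"
  by (simp only: lin_mult_nth) (simp add: mult_ac)

text \<open>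
  This is \<open>whipple_sum_eqv\<close> for \<open>z = a X\<close> and \<open>w = X\<close> in degree \<open>2 M + 4\<close>; four degrees are taken by the factors
  \<open>z w (z + w) (w - z)\<close>. For \<open>M > 0\<close> the subtraction of 1 has no effect.
\<close>
lemma gen_fun_less_coefficient:
  fixes a :: rat
  assumes a: "a \<in> padic p 0" and M: "0 < M" "2 * M + 4 < D"
  shows "R.eqv 2
    (a * (1 - a ^ 2) * even_part M (\<lambda>j. interleaved_sum (<) (p - 1) j (M - j)) (-1) a)
    (a * (of_nat p * beta (2 * M + 1)) * (2 * (1 - a ^ (2 * M + 2)) - 2 * (1 - a ^ 2) * ((1 + a) ^ (2 * M) + (1 - a) ^ (2 * M))))"
proof -
  have half: "2 * M div 2 = M" by simp
  let ?W = "2 * M + 1"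
  let ?A = "gen_fun (<) (2 * a * 1) (- (a ^ 2 + 1 ^ 2)) True (p - 1)"
  define P :: "rat fps" where "P = fps_const (of_nat p)"
  let ?lhs = "lin a * lin 1 * (lin a + lin 1) * (lin 1 - lin a) * (?A - 1)"
  let ?rhs = "P * (lin a * lin 1 * (2 * (lin a - lin 1) * beta_series (a + 1) + 2 * (lin a + lin 1) * beta_series (a - 1)
        - 2 * lin a * beta_series a + 2 * lin 1 * beta_series 1))"
  have "F.eqv 2 ?lhs ?rhs"
    unfolding gen_fun_eq_whipple_sum P_def fps_of_nat by (rule whipple_sum_eqv[OF a R.one_mem])
  then have "R.eqv 2 (fps_nth ?lhs (2 * M + 4)) (fps_nth ?rhs (2 * M + 4))"
    using M by (auto simp: F.eqv_def R.eqv_def fps_padic_def)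
  also have "fps_nth ?lhs (2 * M + 4) = a * (1 - a ^ 2) *
      even_part M (\<lambda>j. interleaved_sum (<) (p - 1) j (M - j)) (-1) a"
    unfolding weight_nth fps_sub_nth gen_fun_def fps_nth_Abs_fps half power_one mult_1_right
      add.commute[of "a ^ 2" 1] even_part_def mult_minus1 mult_1_left using M by simp
  also have "fps_nth ?rhs (2 * M + 4) = a * (of_nat p * beta ?W) *
     (2 * (1 - a ^ (2 * M + 2)) - 2 * (1 - a ^ 2) * ((1 + a) ^ (2 * M) + (1 - a) ^ (2 * M)))"
  proof -
    have "?rhs = fps_const (of_nat p) * (fps_const 2 * (lin a * (lin 1 * (lin (a - 1) * beta_series (a + 1)))
        + lin a * (lin 1 * (lin (a + 1) * beta_series (a - 1))) - lin a * (lin 1 * (lin a * beta_series a))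
        + lin a * (lin 1 * (lin 1 * beta_series 1))))"
      unfolding P_def lin_add lin_diff numeral_fps_const[symmetric] by (simp only: algebra_simps)
    moreover have "2 * M + 4 = ?W + 3" by simp
    moreover have nth: "fps_nth (beta_series c) ?W = beta ?W * c ^ ?W" for c
      using M by (simp add: beta_series_def)
    ultimately have rhs: "fps_nth ?rhs (2 * M + 4) = of_nat p * (2 *
        (a * 1 * (a - 1) * (beta ?W * (a + 1) ^ ?W) + a * 1 * (a + 1) * (beta ?W * (a - 1) ^ ?W)
         - a * 1 * a * (beta ?W * a ^ ?W) + a * 1 * 1 * (beta ?W * 1 ^ ?W)))"
      by (simp only: fps_mult_left_const_nth fps_add_nth fps_sub_nth lin_lin_nth nth)
    have "(a - 1) ^ (2 * M) = (1 - a) ^ (2 * M)"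
      by (simp add: power_mult power2_commute[of a 1])
    then have "(a - 1) ^ ?W = (a - 1) * (1 - a) ^ (2 * M)"
      by simp
    then show ?thesis
      unfolding rhs \<open>(a - 1) ^ ?W = (a - 1) * (1 - a) ^ (2 * M)\<close>
      by (simp add: algebra_simps power2_eq_square)
  qed
  finally show ?thesis .
qed

lemma gen_fun_le_coefficient:
  fixes a :: rat
  assumes a: "a \<in> padic p 0" and M: "0 < M" "2 * M + 4 < D"
  shows "R.eqv 2
    (a * (1 - a ^ 2) * even_part M (\<lambda>j. interleaved_sum (\<le>) (p - 1) j (M - j)) 1 a)
    (a * (of_nat p * beta (2 * M + 1)) * (2 * (1 - a ^ (2 * M + 2))))"
proof -
  have half: "2 * M div 2 = M" by simp
  let ?W = "2 * M + 1"
  let ?A = "gen_fun (\<le>) (2 * a * 1) (a ^ 2 + 1 ^ 2) True (p - 1)"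
  define P :: "rat fps" where "P = fps_const (of_nat p)"
  let ?lhs = "lin a * lin 1 * (lin a + lin 1) * (lin 1 - lin a) * (?A - 1)"
  let ?rhs = "P * (lin a * lin 1 * (- 2 * lin a * beta_series a + 2 * lin 1 * beta_series 1))"
  have two: "(2 :: rat) \<in> padic p 0"
    using R.of_nat_mem[of 2] by simp
  have "?A \<in> fps_padic D p 0"
    by (intro gen_fun_mem R.mult_mem_left R.add_mem R.power_mem a R.one_mem two)
  then have "F.eqv 2 ?lhs ?rhs"
    unfolding P_def fps_of_nat by (rule star_eqv[OF a R.one_mem _ gen_fun_star_eq_whipple_sum])
  then have "R.eqv 2 (fps_nth ?lhs (2 * M + 4)) (fps_nth ?rhs (2 * M + 4))"
    using M by (auto simp: F.eqv_def R.eqv_def fps_padic_def)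
  also have "fps_nth ?lhs (2 * M + 4) = a * (1 - a ^ 2) *
      even_part M (\<lambda>j. interleaved_sum (\<le>) (p - 1) j (M - j)) 1 a"
    unfolding weight_nth fps_sub_nth gen_fun_def fps_nth_Abs_fps half power_one mult_1_right
      add.commute[of "a ^ 2" 1] even_part_def mult_minus1 mult_1_left using M by simp
  also have "fps_nth ?rhs (2 * M + 4) = a * (of_nat p * beta ?W) * (2 * (1 - a ^ (2 * M + 2)))"
  proof -
    have "?rhs = fps_const (of_nat p) * (fps_const 2 * (lin a * (lin 1 * (lin 1 * beta_series 1))
        - lin a * (lin 1 * (lin a * beta_series a))))"
      unfolding P_def numeral_fps_const[symmetric]
      by (simp only: algebra_simps mult_minus_left mult_minus_right) simp
    moreover have "2 * M + 4 = ?W + 3" by simp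
    moreover have nth: "fps_nth (beta_series c) ?W = beta ?W * c ^ ?W" for c
      using M by (simp add: beta_series_def)
    ultimately have "fps_nth ?rhs (2 * M + 4) = of_nat p * (2 *
        (a * 1 * 1 * (beta ?W * 1 ^ ?W) - a * 1 * a * (beta ?W * a ^ ?W)))"
      by (simp only: fps_mult_left_const_nth fps_add_nth fps_sub_nth lin_lin_nth nth)
    then show ?thesis
      by (simp add: algebra_simps power2_eq_square)
  qed
  finally show ?thesis .
qed

end

section \<open>Coefficient extraction\<close>

text \<open>
  The sum is a Chebyshev polynomial of the second kind in disguise: its three-term recursion has the
  characteristic roots \<open>x\<close> and \<open>y\<close>.
\<close>
lemma chebyshev_sum:
  fixes x y :: "'a :: idom"
  shows "(x - y) * (\<Sum>l\<le>M. of_nat ((M - l) choose l) * (- (x * y)) ^ l * (x + y) ^ (M - 2 * l)) = x ^ Suc M - y ^ Suc M"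
proof -
  define U where "U M = (\<Sum>l\<le>M. of_nat ((M - l) choose l) * (- (x * y)) ^ l * (x + y) ^ (M - 2 * l))" for M
  have rec: "U (Suc (Suc M)) = (x + y) * U (Suc M) - x * y * U M" for M
  proof -
    let ?q = "- (x * y)" and ?s = "x + y"
    have "U (Suc (Suc M)) = ?s ^ Suc (Suc M) + (\<Sum>l\<le>Suc M. of_nat ((Suc M - l) choose Suc l) * ?q ^ Suc l * ?s ^ (M - 2 * l))"
      unfolding U_def by (subst sum.atMost_Suc_shift) simp
    also have "(\<Sum>l\<le>Suc M. of_nat ((Suc M - l) choose Suc l) * ?q ^ Suc l * ?s ^ (M - 2 * l)) =
        (\<Sum>l\<le>M. of_nat ((Suc M - l) choose Suc l) * ?q ^ Suc l * ?s ^ (M - 2 * l))"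
      by simp
    also have "\<dots> = (\<Sum>l\<le>M. ?q * (of_nat ((M - l) choose l) * ?q ^ l * ?s ^ (M - 2 * l)) +
        ?s * (of_nat ((M - l) choose Suc l) * ?q ^ Suc l * ?s ^ (M - Suc (2 * l))))"
    proof (intro sum.cong refl)
      fix l assume "l \<in> {..M}"
      then have "(Suc M - l) choose Suc l = ((M - l) choose l) + ((M - l) choose Suc l)"
        by (simp add: Suc_diff_le)
      moreover have "of_nat ((M - l) choose Suc l) * ?s ^ (M - 2 * l) =
          ?s * (of_nat ((M - l) choose Suc l) * ?s ^ (M - Suc (2 * l)))"
      proof (cases "2 * l < M")
        case True
        then have "M - 2 * l = Suc (M - Suc (2 * l))" by simp
        then show ?thesis by (simp only: power_Suc mult_ac)
      next
        case False
        then have "(M - l) choose Suc l = 0"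
          by (intro binomial_eq_0) simp
        then show ?thesis by (simp only: of_nat_0 mult_zero_left mult_zero_right)
      qed
      moreover have "c * q ^ Suc l * P = q * (A * q ^ l * P) + s * (B * q ^ Suc l * P')"
        if "c = A + B" "B * P = s * (B * P')" for A B c q s P P' :: 'a
      proof -
        have "c * q ^ Suc l * P = q * (A * q ^ l * P) + q ^ Suc l * (B * P)"
          by (simp add: \<open>c = A + B\<close> algebra_simps)
        then show ?thesis
          unfolding \<open>B * P = s * (B * P')\<close> by (simp only: mult_ac)
      qed
      ultimately show "of_nat ((Suc M - l) choose Suc l) * ?q ^ Suc l * ?s ^ (M - 2 * l) =
          ?q * (of_nat ((M - l) choose l) * ?q ^ l * ?s ^ (M - 2 * l)) +
          ?s * (of_nat ((M - l) choose Suc l) * ?q ^ Suc l * ?s ^ (M - Suc (2 * l)))"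
        by (simp only: of_nat_add)
    qed
    also have "\<dots> = ?q * U M + ?s * (\<Sum>l\<le>M. of_nat ((M - l) choose Suc l) * ?q ^ Suc l * ?s ^ (M - Suc (2 * l)))"
      unfolding U_def sum.distrib sum_distrib_left ..
    also have "(\<Sum>l\<le>M. of_nat ((M - l) choose Suc l) * ?q ^ Suc l * ?s ^ (M - Suc (2 * l))) = U (Suc M) - ?s ^ Suc M"
      unfolding U_def by (subst sum.atMost_Suc_shift) simp
    finally show ?thesis
      by (simp add: algebra_simps)
  qed
  have "(x - y) * U M = x ^ Suc M - y ^ Suc M \<and> (x - y) * U (Suc M) = x ^ Suc (Suc M) - y ^ Suc (Suc M)" for M
  proof (induction M)
    case 0
    have "{..Suc 0} = {0, 1}" by auto
    then show ?case
      by (simp add: U_def algebra_simps power2_eq_square)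
  next
    case (Suc M)
    have "(x - y) * U (Suc (Suc M)) = (x + y) * ((x - y) * U (Suc M)) - x * y * ((x - y) * U M)"
      unfolding rec by (simp add: algebra_simps)
    also have "\<dots> = x ^ Suc (Suc (Suc M)) - y ^ Suc (Suc (Suc M))"
      unfolding conjunct1[OF Suc] conjunct2[OF Suc] by (simp add: algebra_simps)
    finally show ?case
      using Suc by blast
  qed
  then show ?thesis
    unfolding U_def by blast
qed

lemma sum_even_atMost:
  fixes f :: "nat \<Rightarrow> 'a :: comm_monoid_add"
  assumes "\<And>l. 2 * l > M \<Longrightarrow> g l = 0" "\<And>l. 2 * l \<le> M \<Longrightarrow> f (2 * l) = g l"
  shows "(\<Sum>j\<le>M. if even j then f j else 0) = (\<Sum>l\<le>M. g l)"
proof -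
  have "(\<Sum>j\<le>M. if even j then f j else 0) = (\<Sum>j\<in>{j. j \<le> M \<and> even j}. f j)"
    by (subst sum.inter_filter[symmetric]) (auto intro: sum.cong)
  also have "\<dots> = (\<Sum>l\<in>{l. 2 * l \<le> M}. g l)"
    by (rule sum.reindex_bij_witness[of _ "\<lambda>l. 2 * l" "\<lambda>j. j div 2"]) (auto simp: assms(2)[symmetric])
  also have "\<dots> = (\<Sum>l\<le>M. g l)"
    by (rule sum.mono_neutral_left) (auto simp: assms(1))
  finally show ?thesis .
qed

text \<open>
  The coefficients of the theorem in terms of \<open>j = 2 l\<close> and \<open>M = 2 l + m\<close>. In this way they are indexed like the
  coefficients of the generating functions.
\<close>
definition coefficient_le :: "nat \<Rightarrow> nat \<Rightarrow> rat" where
  "coefficient_le M j = 2 * (-1) ^ (j div 2) * of_nat ((M - j div 2) choose (j div 2)) / 2 ^ j"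

definition coefficient_less :: "nat \<Rightarrow> nat \<Rightarrow> rat" where
  "coefficient_less M j = (-1) ^ (M - j) * (coefficient_le M j - 4 * of_nat (M choose j))"

lemma coefficient_le_sum:
  "(1 - a ^ 2) * even_part M (coefficient_le M) 1 a = 2 * (1 - a ^ (2 * M + 2))"
proof -
  let ?g = "\<lambda>l. of_nat ((M - l) choose l) * (- (1 * a ^ 2)) ^ l * (1 + a ^ 2) ^ (M - 2 * l)"
  have "even_part M (coefficient_le M) 1 a = (\<Sum>l\<le>M. 2 * ?g l)"
    unfolding even_part_def mult_1_left
  proof (rule sum_even_atMost)
    fix l
    have "(- (a ^ 2)) ^ l = (-1) ^ l * a ^ (2 * l)"
      by (simp add: power_minus[of "a ^ 2"] power_mult)
    then show "coefficient_le M (2 * l) * (2 * a) ^ (2 * l) * (1 + a ^ 2) ^ (M - 2 * l) =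
        2 * (of_nat ((M - l) choose l) * (- (a ^ 2)) ^ l * (1 + a ^ 2) ^ (M - 2 * l))"
      by (simp add: coefficient_le_def power_mult_distrib)
  next
    fix l assume "2 * l > M"
    then have "M - l < l" by linarith
    then show "2 * (of_nat ((M - l) choose l) * (- (a ^ 2)) ^ l * (1 + a ^ 2) ^ (M - 2 * l)) = 0"
      by (simp add: binomial_eq_0)
  qed
  then have "(1 - a ^ 2) * even_part M (coefficient_le M) 1 a = 2 * ((1 - a ^ 2) * (\<Sum>l\<le>M. ?g l))"
    by (simp flip: sum_distrib_left)
  also have "\<dots> = 2 * (1 - a ^ (2 * M + 2))"
  proof -
    have "(a ^ 2) ^ Suc M = a ^ (2 * M + 2)"
      unfolding power_mult[symmetric] by simp
    then show ?thesis
      unfolding chebyshev_sum by (simp only: power_one)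
  qed
  finally show ?thesis .
qed

text \<open>
  The even part in \<open>a\<close> of the binomial expansion of \<open>((1 + a)\<^sup>2)\<close> to the power \<open>M\<close>, with \<open>(1 + a)\<^sup>2 = 2 a + (1 + a\<^sup>2)\<close>.
\<close>
lemma even_binomial_sum:
  "even_part M (\<lambda>j. of_nat (M choose j)) 1 a = ((1 + a) ^ (2 * M) + (1 - a) ^ (2 * M)) / 2"
proof -
  let ?t = "\<lambda>x j. of_nat (M choose j) * x ^ j * (1 + a ^ 2) ^ (M - j)"
  have "2 * a + (1 + a ^ 2) = (1 + a) ^ 2" "- (2 * a) + (1 + a ^ 2) = (1 - a) ^ 2"
    by (simp_all add: power2_eq_square algebra_simps)
  then have "(1 + a) ^ (2 * M) + (1 - a) ^ (2 * M) = (2 * a + (1 + a ^ 2)) ^ M + (- (2 * a) + (1 + a ^ 2)) ^ M"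
    by (simp only: power_mult)
  also have "\<dots> = (\<Sum>j\<le>M. ?t (2 * a) j + ?t (- (2 * a)) j)"
    unfolding binomial_ring sum.distrib ..
  also have "\<dots> = (\<Sum>j\<le>M. 2 * (if even j then ?t (2 * a) j else 0))"
    by (intro sum.cong refl) (auto simp: power_minus_odd)
  also have "\<dots> = 2 * even_part M (\<lambda>j. of_nat (M choose j)) 1 a"
    unfolding even_part_def mult_1_left by (simp only: sum_distrib_left)
  finally show ?thesis
    by simp
qed

lemma coefficient_less_sum:
  "(1 - a ^ 2) * even_part M (coefficient_less M) (-1) a =
    2 * (1 - a ^ (2 * M + 2)) - 2 * (1 - a ^ 2) * ((1 + a) ^ (2 * M) + (1 - a) ^ (2 * M))"
proof -
  have sign: "(-1) ^ k * x * y * (- 1 * z) ^ k = x * y * (1 * z) ^ k" for k and x y z :: rat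
  proof -
    have "(-1) ^ k * (- 1 * z) ^ k = z ^ k"
      by (subst power_mult_distrib[symmetric]) simp
    then show ?thesis
      by (metis mult.assoc mult.commute mult_1_left)
  qed
  have "even_part M (coefficient_less M) (-1) a = even_part M (\<lambda>j. coefficient_le M j - 4 * of_nat (M choose j)) 1 a"
    unfolding even_part_def coefficient_less_def sign ..
  also have "\<dots> = even_part M (coefficient_le M) 1 a - 4 * (((1 + a) ^ (2 * M) + (1 - a) ^ (2 * M)) / 2)"
    unfolding even_part_diff even_binomial_sum ..
  finally have *: "even_part M (coefficient_less M) (-1) a =
      even_part M (coefficient_le M) 1 a - 4 * (((1 + a) ^ (2 * M) + (1 - a) ^ (2 * M)) / 2)" .
  have "(1 - a ^ 2) * (x - 4 * (y / 2)) = (1 - a ^ 2) * x - 2 * (1 - a ^ 2) * y" for x y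
    by (simp add: algebra_simps)
  then show ?thesis
    unfolding * coefficient_le_sum[symmetric] .
qed

context odd_prime
begin

lemma coeffs_mult_mem:
  assumes "\<And>i. coeff f i \<in> padic p 0" "\<And>i. coeff g i \<in> padic p 0"
  shows "coeff (f * g) i \<in> padic p 0"
  unfolding coeff_mult using assms by (intro R.sum_mem R.mult_mem_left) auto

lemma coeffs_power_mem:
  assumes "\<And>i. coeff f i \<in> padic p 0"
  shows "coeff (f ^ n) i \<in> padic p 0"
proof (induction n arbitrary: i)
  case (Suc n)
  then show ?case
    using coeffs_mult_mem[of f "f ^ n"] assms by simp
qed (auto simp: R.one_mem R.zero_mem)

text \<open>
  The polynomials multiplying the \<open>d j\<close> have degree at most \<open>2 M + 3\<close>, so their combination has
  coefficients in \<open>padic p k\<close>. The one with index \<open>j\<close> starts with a unit times the monomial of degree \<open>j + 1\<close>,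
  so the \<open>d j\<close> follow one after the other.
\<close>
lemma extract_coefficients:
  fixes d :: "nat \<Rightarrow> rat" and \<epsilon> :: rat
  assumes d: "\<And>j. j \<le> M \<Longrightarrow> d j \<in> padic p 0" and \<epsilon>: "\<epsilon> ^ 2 = 1" and M: "2 * M + 6 \<le> p"
    and vanish: "\<And>n. n \<in> {1..<p} \<Longrightarrow> of_nat n * (1 - of_nat n ^ 2) *
       (\<Sum>j\<le>M. d j * (2 * of_nat n) ^ j * (\<epsilon> * (1 + of_nat n ^ 2)) ^ (M - j)) \<in> padic p k"
    and j: "j \<le> M"
  shows "d j \<in> padic p k"
proof -
  \<comment> \<open>The \<open>j\<close>-th polynomial without the monomial of degree \<open>j + 1\<close>.\<close>
  define r where "r j = smult (2 ^ j) ([:1, 0, -1:] * smult \<epsilon> [:1, 0, 1:] ^ (M - j))" for j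
  define Q where "Q = (\<Sum>j\<le>M. smult (d j) (monom 1 (Suc j) * r j))"
  have \<epsilon>': "\<epsilon> = 1 \<or> \<epsilon> = -1"
    using \<epsilon> by (simp add: power2_eq_1_iff)
  have r_mem: "coeff (r j) i \<in> padic p 0" for i j
  proof -
    have "\<epsilon> \<in> padic p 0"
      using \<epsilon>' R.one_mem R.uminus_mem by auto
    then have "coeff (smult \<epsilon> [:1, 0, 1:]) i \<in> padic p 0" for i
      using R.zero_mem by (auto simp: coeff_pCons split: nat.split)
    moreover have "coeff [:1, 0, - 1 :: rat:] i \<in> padic p 0" for i
      using R.zero_mem R.one_mem R.uminus_mem by (auto simp: coeff_pCons split: nat.split)
    ultimately have "coeff ([:1, 0, -1:] * smult \<epsilon> [:1, 0, 1:] ^ (M - j)) i \<in> padic p 0"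
      by (intro coeffs_mult_mem coeffs_power_mem)
    moreover have "(2 :: rat) ^ j \<in> padic p 0"
      using R.of_nat_mem[of "2 ^ j"] by simp
    ultimately show ?thesis
      unfolding r_def coeff_smult by (intro R.mult_mem_left)
  qed
  have coeff_Q: "coeff Q i = (\<Sum>j\<le>M. d j * (if i < Suc j then 0 else coeff (r j) (i - Suc j)))" for i
    unfolding Q_def coeff_sum coeff_smult coeff_monom_mult mult_1_left ..
  have "degree (smult (d j) (monom 1 (Suc j) * r j)) \<le> 2 * M + 3" if "j \<le> M" for j
  proof -
    have "degree (smult \<epsilon> [:1, 0, 1:] ^ (M - j)) \<le> degree (smult \<epsilon> [:1, 0, 1:]) * (M - j)"
      by (rule degree_power_le)
    also have "\<dots> \<le> 2 * (M - j)"
      by (intro mult_right_mono) auto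
    finally have "degree (r j) \<le> 2 + 2 * (M - j)"
      unfolding r_def by (intro order_trans[OF degree_smult_le] order_trans[OF degree_mult_le] add_mono) auto
    then have "degree (monom (1 :: rat) (Suc j) * r j) \<le> Suc j + (2 + 2 * (M - j))"
      by (intro order_trans[OF degree_mult_le] add_mono) (auto simp: degree_monom_eq)
    then show ?thesis
      using that by (intro order_trans[OF degree_smult_le]) simp
  qed
  then have deg: "degree Q \<le> 2 * M + 3"
    unfolding Q_def by (intro degree_sum_le) auto
  have Q_mem: "coeff Q i \<in> padic p k" if "i \<le> 2 * M + 3" for i
  proof (rule polynomial_vanish[where D = "2 * M + 3"])
    show "coeff Q i \<in> padic p 0" for i
      unfolding coeff_Q using r_mem d by (intro R.sum_mem R.mult_mem_left) (auto simp: R.zero_mem)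
    show "(\<Sum>i\<le>2 * M + 3. coeff Q i * of_nat n ^ i) \<in> padic p k" if "n \<in> {1..<p}" for n
    proof -
      have "(\<Sum>i\<le>2 * M + 3. coeff Q i * of_nat n ^ i) = poly Q (of_nat n)"
        using deg unfolding poly_altdef
        by (intro sum.mono_neutral_right) (auto simp: coeff_eq_0)
      also have "\<dots> = of_nat n * (1 - of_nat n ^ 2) *
         (\<Sum>j\<le>M. d j * (2 * of_nat n) ^ j * (\<epsilon> * (1 + of_nat n ^ 2)) ^ (M - j))"
        unfolding Q_def r_def poly_sum sum_distrib_left
        by (intro sum.cong refl) (simp add: poly_monom power_mult_distrib power2_eq_square algebra_simps)
      finally show ?thesis
        using vanish[OF that] by simp
    qed
  qed (use that M in auto)
  show ?thesis
    using j
  proof (induction j rule: less_induct)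
    case (less j)
    have "coeff Q (Suc j) = (\<Sum>i\<le>M. if i = j then d j * coeff (r j) 0 else if i < j then d i * coeff (r i) (j - i) else 0)"
      unfolding coeff_Q by (intro sum.cong refl) auto
    also have "\<dots> = (\<Sum>i\<le>M. (if i = j then d j * coeff (r j) 0 else 0) + (if i < j then d i * coeff (r i) (j - i) else 0))"
      by (intro sum.cong refl) auto
    also have "\<dots> = d j * coeff (r j) 0 + (\<Sum>i\<le>M. if i < j then d i * coeff (r i) (j - i) else 0)"
      unfolding sum.distrib using less.prems by simp
    finally have "d j * coeff (r j) 0 = coeff Q (Suc j) - (\<Sum>i\<le>M. if i < j then d i * coeff (r i) (j - i) else 0)"
      by simp
    also have "\<dots> \<in> padic p k"
    proof (rule R.diff_mem)
      show "coeff Q (Suc j) \<in> padic p k"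
        using less.prems by (intro Q_mem) simp
      have "(if i < j then d i * coeff (r i) (j - i) else 0) \<in> padic p k" for i
        using less R.mult_mem_right[OF _ r_mem] R.zero_mem by simp
      then show "(\<Sum>i\<le>M. if i < j then d i * coeff (r i) (j - i) else 0) \<in> padic p k"
        by (rule R.sum_mem)
    qed
    also have "coeff (r j) 0 = 2 ^ j * \<epsilon> ^ (M - j)"
      by (simp add: r_def flip: poly_0_coeff_0)
    finally have "d j * (2 ^ j * \<epsilon> ^ (M - j)) \<in> padic p k" .
    moreover have "\<epsilon> ^ (M - j) / 2 ^ j \<in> padic p 0"
    proof -
      have "1 / of_nat 2 ^ j \<in> padic p 0"
        using gt_2 by (intro inverse_power_mem) auto
      moreover have "\<epsilon> ^ (M - j) \<in> padic p 0"
        using \<epsilon>' by (intro R.power_mem) (auto intro: R.one_mem R.uminus_mem)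
      ultimately show ?thesis
        using R.mult_mem_left by fastforce
    qed
    ultimately have "d j * (2 ^ j * \<epsilon> ^ (M - j)) * (\<epsilon> ^ (M - j) / 2 ^ j) \<in> padic p k"
      by (rule R.mult_mem_right)
    moreover have "d j * (2 ^ j * \<epsilon> ^ (M - j)) * (\<epsilon> ^ (M - j) / 2 ^ j) = d j * (\<epsilon> ^ (M - j) * \<epsilon> ^ (M - j))"
      by simp
    moreover have "\<epsilon> ^ (M - j) * \<epsilon> ^ (M - j) = 1"
      using \<epsilon>' by auto
    ultimately show ?case
      by simp
  qed
qed

lemma coefficient_le_mem: "coefficient_le M j \<in> padic p 0"
proof -
  have "1 / of_nat 2 ^ j \<in> padic p 0"
    using gt_2 by (intro inverse_power_mem) auto
  moreover have "2 * (-1) ^ (j div 2) * of_nat ((M - j div 2) choose (j div 2)) \<in> padic p 0"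
    using R.of_nat_mem[of 2] by (intro R.mult_mem_left R.power_mem R.of_nat_mem R.uminus_mem R.one_mem) simp
  ultimately show ?thesis
    unfolding coefficient_le_def using R.mult_mem_left by fastforce
qed

lemma coefficient_less_mem: "coefficient_less M j \<in> padic p 0"
  unfolding coefficient_less_def using R.of_nat_mem[of 4]
  by (intro R.mult_mem_left R.power_mem R.of_nat_mem R.uminus_mem R.one_mem R.diff_mem coefficient_le_mem) simp

text \<open>
  The generating polynomials of both sides in \<open>a\<close>, multiplied by \<open>a (1 - a\<^sup>2)\<close>, agree at all residues, by
  \<open>gen_fun_less_coefficient\<close> and \<open>coefficient_less_sum\<close>, or their analogues for the weak order.
\<close>
lemma interleaved_sum_eqv:
  assumes M: "0 < M" "2 * M + 12 \<le> p" and j: "even j" "j \<le> M"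
  shows "R.eqv 2 (interleaved_sum (<) (p - 1) j (M - j)) (of_nat p * beta (2 * M + 1) * coefficient_less M j)"
    and "R.eqv 2 (interleaved_sum (\<le>) (p - 1) j (M - j)) (of_nat p * beta (2 * M + 1) * coefficient_le M j)"
proof -
  \<comment> \<open>The coefficients are compared in degree \<open>2 M + 4\<close>.\<close>
  interpret fps_prime p "2 * M + 5"
    by unfold_locales (use M in simp)
  define b where "b = of_nat p * beta (2 * M + 1)"
  have b: "b \<in> padic p 0"
    unfolding b_def using M by (intro R.mult_mem_left R.of_nat_mem beta_mem) auto
  have main: "R.eqv 2 (s j) (b * c j)"
    if mem: "\<And>j. s j \<in> padic p 0" "\<And>j. c j \<in> padic p 0" and \<epsilon>: "\<epsilon> ^ 2 = 1"
      and eqv: "\<And>n. R.eqv 2 (of_nat n * (1 - of_nat n ^ 2) * even_part M s \<epsilon> (of_nat n))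
        (of_nat n * b * ((1 - of_nat n ^ 2) * even_part M c \<epsilon> (of_nat n)))"
    for s c :: "nat \<Rightarrow> rat" and \<epsilon> :: rat
  proof -
    define d where "d j = (if even j then s j - b * c j else 0)" for j
    have "d j \<in> padic p 2"
    proof (rule extract_coefficients[where M = M and \<epsilon> = \<epsilon>])
      show "d j \<in> padic p 0" for j
        unfolding d_def using mem b R.zero_mem by (auto intro: R.diff_mem R.mult_mem_left)
      fix n
      have "(\<Sum>j\<le>M. d j * (2 * of_nat n) ^ j * (\<epsilon> * (1 + of_nat n ^ 2)) ^ (M - j)) =
          even_part M (\<lambda>j. s j - b * c j) \<epsilon> (of_nat n)"
        unfolding d_def even_part_def by (intro sum.cong) auto
      moreover have "u * v * (x - b * y) = u * v * x - u * b * (v * y)" for u v x y :: rat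
        by (simp add: algebra_simps)
      ultimately show "of_nat n * (1 - of_nat n ^ 2) *
          (\<Sum>j\<le>M. d j * (2 * of_nat n) ^ j * (\<epsilon> * (1 + of_nat n ^ 2)) ^ (M - j)) \<in> padic p 2"
        using eqv[of n] by (simp only: R.eqv_def even_part_diff)
    qed (use M j \<epsilon> in auto)
    then show ?thesis
      using j by (simp add: d_def R.eqv_def)
  qed
  show "R.eqv 2 (interleaved_sum (<) (p - 1) j (M - j)) (of_nat p * beta (2 * M + 1) * coefficient_less M j)"
    unfolding b_def[symmetric]
  proof (rule main[where \<epsilon> = "-1" and s = "\<lambda>j. interleaved_sum (<) (p - 1) j (M - j)" and c = "coefficient_less M"])
    fix n
    show "R.eqv 2
        (of_nat n * (1 - of_nat n ^ 2) * even_part M (\<lambda>j. interleaved_sum (<) (p - 1) j (M - j)) (-1) (of_nat n))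
        (of_nat n * b * ((1 - of_nat n ^ 2) * even_part M (coefficient_less M) (-1) (of_nat n)))"
      unfolding b_def coefficient_less_sum by (rule gen_fun_less_coefficient[OF R.of_nat_mem M(1)]) simp
    show "interleaved_sum (<) (p - 1) j (M - j) \<in> padic p 0" "coefficient_less M j \<in> padic p 0" for j
      by (rule interleaved_sum_mem coefficient_less_mem)+
  qed simp
  show "R.eqv 2 (interleaved_sum (\<le>) (p - 1) j (M - j)) (of_nat p * beta (2 * M + 1) * coefficient_le M j)"
    unfolding b_def[symmetric]
  proof (rule main[where \<epsilon> = "1" and s = "\<lambda>j. interleaved_sum (\<le>) (p - 1) j (M - j)" and c = "coefficient_le M"])
    fix n
    show "R.eqv 2
        (of_nat n * (1 - of_nat n ^ 2) * even_part M (\<lambda>j. interleaved_sum (\<le>) (p - 1) j (M - j)) 1 (of_nat n))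
        (of_nat n * b * ((1 - of_nat n ^ 2) * even_part M (coefficient_le M) 1 (of_nat n)))"
      unfolding b_def coefficient_le_sum by (rule gen_fun_le_coefficient[OF R.of_nat_mem M(1)]) simp
    show "interleaved_sum (\<le>) (p - 1) j (M - j) \<in> padic p 0" "coefficient_le M j \<in> padic p 0" for j
      by (rule interleaved_sum_mem coefficient_le_mem)+
  qed simp
qed

end

section \<open>Passage to the ring of families modulo squares of primes\<close>

context odd_prime
begin

text \<open>
  So congruences of the integers \<open>rat_mod\<close> are congruences of the rationals that they represent.
\<close>
lemma rat_mod_eqv:
  assumes "x \<in> padic p 0"
  shows "R.eqv 2 (of_int (rat_mod x ((int p)\<^sup>2))) x"
proof -
  obtain a b where x: "x = of_int a / of_int b" and b: "\<not> int p dvd b"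
    using assms unfolding padic_def by auto
  then have b0: "b \<noteq> 0" by auto
  let ?r = "rat_mod x ((int p)\<^sup>2)"
  have "coprime b ((int p)\<^sup>2)"
    using b prime prime_imp_coprime[of "int p" b] by (simp add: coprime_commute)
  then have "[a = ?r * b] (mod (int p)\<^sup>2)"
    using rat_mod_cong_iff[OF x b0, of "(int p)\<^sup>2" ?r] by simp
  then obtain k where k: "a - ?r * b = (int p)\<^sup>2 * k"
    by (metis cong_iff_dvd_diff dvd_def)
  have "x - of_int ?r = of_int (a - ?r * b) / of_int b"
    using b0 by (simp add: x field_simps)
  also have "\<dots> = of_int k / of_int b * of_nat p ^ 2"
    unfolding k by simp
  finally have "R.eqv 2 x (of_int ?r)"
    unfolding R.eqv_def by (rule padicI[OF _ b])
  then show ?thesis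
    by (rule R.eqv_sym)
qed

end

lemma A2_eqI:
  assumes "\<And>p. prime p \<Longrightarrow> p > B \<Longrightarrow> [f p = g p] (mod (int p)\<^sup>2)"
  shows "A2_eq f g"
  unfolding A2_eq_def
  by (rule finite_subset[of _ "{..B}"]) (use assms in \<open>auto simp: not_less[symmetric]\<close>)

lemma A2_of_rats_eqI:
  assumes "B \<ge> 2" and x: "\<And>p. prime p \<Longrightarrow> p > B \<Longrightarrow> x p \<in> padic p 0"
    and y: "\<And>p. prime p \<Longrightarrow> p > B \<Longrightarrow> x p - y p \<in> padic p 2"
  shows "A2_of_rats x = A2_of_rats y"
proof -
  have "A2_eq (\<lambda>p. rat_mod (x p) ((int p)\<^sup>2)) (\<lambda>p. rat_mod (y p) ((int p)\<^sup>2))"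
  proof (rule A2_eqI[of B])
    fix p assume p: "prime p" "p > B"
    interpret odd_prime p
      by unfold_locales (use p assms(1) in auto)
    have xy: "R.eqv 2 (x p) (y p)"
      using y[OF p] by (simp add: R.eqv_def)
    have "y p \<in> padic p 0"
      using R.eqv_mem[OF R.eqv_sym[OF R.eqv_antimono[OF xy, of 0]]] x[OF p] by simp
    then have "R.eqv 2 (of_int (rat_mod (x p) ((int p)\<^sup>2))) (of_int (rat_mod (y p) ((int p)\<^sup>2)))"
      using rat_mod_eqv xy x[OF p] R.eqv_trans R.eqv_sym by blast
    then show "[rat_mod (x p) ((int p)\<^sup>2) = rat_mod (y p) ((int p)\<^sup>2)] (mod (int p)\<^sup>2)"
      unfolding of_int_eqv_iff .
  qed
  then show ?thesis
    by (simp add: A2_of_rats.abs_eq A2.abs_eq_iff)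
qed

lemma A2_of_rats_mult:
  assumes "B \<ge> 2" and x: "\<And>p. prime p \<Longrightarrow> p > B \<Longrightarrow> x p \<in> padic p 0"
    and y: "\<And>p. prime p \<Longrightarrow> p > B \<Longrightarrow> y p \<in> padic p 0"
  shows "A2_of_rats x * A2_of_rats y = A2_of_rats (\<lambda>p. x p * y p)"
proof -
  have "A2_eq (\<lambda>p. rat_mod (x p) ((int p)\<^sup>2) * rat_mod (y p) ((int p)\<^sup>2)) (\<lambda>p. rat_mod (x p * y p) ((int p)\<^sup>2))"
  proof (rule A2_eqI[of B])
    fix p assume p: "prime p" "p > B"
    interpret odd_prime p
      by unfold_locales (use p assms(1) in auto)
    have "R.eqv 2 (of_int (rat_mod (x p) ((int p)\<^sup>2)) * of_int (rat_mod (y p) ((int p)\<^sup>2))) (x p * y p)"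
      by (intro R.eqv_mult rat_mod_eqv x y p R.of_int_mem)
    also have "R.eqv 2 \<dots> (of_int (rat_mod (x p * y p) ((int p)\<^sup>2)))"
      by (intro R.eqv_sym[OF rat_mod_eqv] R.mult_mem_left x y p)
    finally have "R.eqv 2 (of_int (rat_mod (x p) ((int p)\<^sup>2) * rat_mod (y p) ((int p)\<^sup>2)))
        (of_int (rat_mod (x p * y p) ((int p)\<^sup>2)))"
      by simp
    then show "[rat_mod (x p) ((int p)\<^sup>2) * rat_mod (y p) ((int p)\<^sup>2) = rat_mod (x p * y p) ((int p)\<^sup>2)] (mod (int p)\<^sup>2)"
      unfolding of_int_eqv_iff .
  qed
  then show ?thesis
    by (simp add: A2_of_rats.abs_eq times_A2.abs_eq A2.abs_eq_iff)
qed

lemma A2_of_rats_add: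
  assumes "B \<ge> 2" and x: "\<And>p. prime p \<Longrightarrow> p > B \<Longrightarrow> x p \<in> padic p 0"
    and y: "\<And>p. prime p \<Longrightarrow> p > B \<Longrightarrow> y p \<in> padic p 0"
  shows "A2_of_rats x + A2_of_rats y = A2_of_rats (\<lambda>p. x p + y p)"
proof -
  have "A2_eq (\<lambda>p. rat_mod (x p) ((int p)\<^sup>2) + rat_mod (y p) ((int p)\<^sup>2)) (\<lambda>p. rat_mod (x p + y p) ((int p)\<^sup>2))"
  proof (rule A2_eqI[of B])
    fix p assume p: "prime p" "p > B"
    interpret odd_prime p
      by unfold_locales (use p assms(1) in auto)
    have "R.eqv 2 (of_int (rat_mod (x p) ((int p)\<^sup>2)) + of_int (rat_mod (y p) ((int p)\<^sup>2))) (x p + y p)"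
      by (intro R.eqv_add rat_mod_eqv x y p)
    also have "R.eqv 2 \<dots> (of_int (rat_mod (x p + y p) ((int p)\<^sup>2)))"
      by (intro R.eqv_sym[OF rat_mod_eqv] R.add_mem x y p)
    finally have "R.eqv 2 (of_int (rat_mod (x p) ((int p)\<^sup>2) + rat_mod (y p) ((int p)\<^sup>2)))
        (of_int (rat_mod (x p + y p) ((int p)\<^sup>2)))"
      by simp
    then show "[rat_mod (x p) ((int p)\<^sup>2) + rat_mod (y p) ((int p)\<^sup>2) = rat_mod (x p + y p) ((int p)\<^sup>2)] (mod (int p)\<^sup>2)"
      unfolding of_int_eqv_iff .
  qed
  then show ?thesis
    by (simp add: A2_of_rats.abs_eq plus_A2.abs_eq A2.abs_eq_iff)
qed

lemma A2_of_rats_sum: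
  assumes "finite I" "\<And>i p. prime p \<Longrightarrow> p > 2 \<Longrightarrow> x i p \<in> padic p 0"
  shows "(\<Sum>i\<in>I. A2_of_rats (x i)) = A2_of_rats (\<lambda>p. \<Sum>i\<in>I. x i p)"
  using assms(1)
proof (induction I rule: finite_induct)
  case empty
  have "A2_of_rats (\<lambda>_. 0) = 0"
    using A2_of_rats_const_add[of 0 0] by simp
  then show ?case by simp
next
  case (insert i I)
  have "A2_of_rats (x i) + A2_of_rats (\<lambda>p. \<Sum>i\<in>I. x i p) = A2_of_rats (\<lambda>p. x i p + (\<Sum>i\<in>I. x i p))"
  proof (rule A2_of_rats_add[of 2])
    fix p :: nat assume p: "prime p" "p > 2"
    interpret odd_prime p by unfold_locales (use p in auto)
    show "x i p \<in> padic p 0" "(\<Sum>i\<in>I. x i p) \<in> padic p 0"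
      using assms(2)[OF p] by (auto intro: R.sum_mem)
  qed simp
  then show ?case
    using insert by simp
qed

text \<open>
  The common part of both equalities: everything is expressed by families of rationals, and it
  suffices to compare these for all large primes.
\<close>
lemma A2_sum_eq:
  assumes lm: "(l, m) \<noteq> (0, 0)"
    and z: "\<And>ks. z ks = A2_of_rats (\<lambda>p. harmonic_sum R (p - 1) ks)"
    and c: "\<And>p. prime p \<Longrightarrow> p > 2 \<Longrightarrow> c \<in> padic p 0"
    and eqv: "\<And>p. prime p \<Longrightarrow> p \<ge> 2 * (2 * l + m) + 12 \<Longrightarrow>
      interleaved_sum R (p - 1) (2 * l) m - of_nat p * (bernoulli (p - (4 * l + 2 * m + 1)) / of_nat (4 * l + 2 * m + 1)) * c \<in> padic p 2"
  shows "(\<Sum>ms | length ms = 2 * l + 1 \<and> sum_list ms = m. z (index_13 l ms)) =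
    c *\<^sub>Q (beta_A2 (4 * l + 2 * m + 1) * p_A2)"
proof -
  let ?W = "4 * l + 2 * m + 1" and ?B = "2 * (2 * l + m) + 11"
  have "(\<Sum>ms | length ms = 2 * l + 1 \<and> sum_list ms = m. z (index_13 l ms)) =
      (\<Sum>ms\<in>compositions (Suc (2 * l)) m. A2_of_rats (\<lambda>p. harmonic_sum R (p - 1) (interleave ms)))"
    unfolding z compositions_def by (intro sum.cong) (auto simp: index_13_eq_interleave)
  also have "\<dots> = A2_of_rats (\<lambda>p. interleaved_sum R (p - 1) (2 * l) m)"
    unfolding interleaved_sum_def word_sum_def
  proof (rule A2_of_rats_sum[OF finite_compositions])
    fix ms and p :: nat assume "prime p" "p > 2"
    then interpret odd_prime p by unfold_locales
    show "harmonic_sum R (p - 1) (interleave ms) \<in> padic p 0"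
      by (rule harmonic_sum_mem)
  qed
  also have "\<dots> = A2_of_rats (\<lambda>p. c * (bernoulli (p - ?W) / of_nat ?W * of_nat p))"
  proof (rule A2_of_rats_eqI[of ?B])
    fix p :: nat assume p: "prime p" "p > ?B"
    then interpret odd_prime p by unfold_locales auto
    show "interleaved_sum R (p - 1) (2 * l) m \<in> padic p 0"
      by (rule interleaved_sum_mem)
    show "interleaved_sum R (p - 1) (2 * l) m - c * (bernoulli (p - ?W) / of_nat ?W * of_nat p) \<in> padic p 2"
      using eqv[OF p(1)] p(2) by (simp add: mult_ac)
  qed simp
  also have "\<dots> = A2_of_rats (\<lambda>_. c) * (A2_of_rats (\<lambda>p. bernoulli (p - ?W) / of_nat ?W) * A2_of_rats of_nat)"
  proof -
    have mem: "c \<in> padic p 0" "bernoulli (p - ?W) / of_nat ?W \<in> padic p 0" "(of_nat p :: rat) \<in> padic p 0"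
      if p: "prime p" "p > ?B" for p
    proof -
      interpret odd_prime p by unfold_locales (use p in auto)
      show "c \<in> padic p 0"
        using c p by simp
      show "bernoulli (p - ?W) / of_nat ?W \<in> padic p 0"
        using beta_mem[of ?W] p lm unfolding beta_def by auto
      show "(of_nat p :: rat) \<in> padic p 0"
        by (rule R.of_nat_mem)
    qed
    have "A2_of_rats (\<lambda>p. bernoulli (p - ?W) / of_nat ?W) * A2_of_rats of_nat =
        A2_of_rats (\<lambda>p. bernoulli (p - ?W) / of_nat ?W * of_nat p)"
      by (rule A2_of_rats_mult[of ?B]) (use mem in auto)
    moreover have "A2_of_rats (\<lambda>_. c) * A2_of_rats (\<lambda>p. bernoulli (p - ?W) / of_nat ?W * of_nat p) =
        A2_of_rats (\<lambda>p. c * (bernoulli (p - ?W) / of_nat ?W * of_nat p))"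
    proof (rule A2_of_rats_mult[of ?B])
      fix p :: nat assume p: "prime p" "p > ?B"
      then interpret odd_prime p by unfold_locales auto
      show "c \<in> padic p 0"
        by (rule mem(1)[OF p])
      show "bernoulli (p - ?W) / of_nat ?W * of_nat p \<in> padic p 0"
        by (rule R.mult_mem_left[OF mem(2)[OF p] mem(3)[OF p]])
    qed simp
    ultimately show ?thesis by simp
  qed
  finally show ?thesis
    by (simp only: scaleQ_def beta_A2_def p_A2_def)
qed

theorem theorem1p3:
  fixes l m :: nat
  assumes "(l, m) \<noteq> (0, 0)"
  shows "(\<Sum>ms | length ms = 2 * l + 1 \<and> sum_list ms = m. zeta_A2 (index_13 l ms)) =
           ((-1) ^ m *
             ((-1) ^ l * 2 powi (1 - 2 * int l) * of_nat ((l + m) choose l)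
               - 4 * of_nat ((2 * l + m) choose (2 * l))))
           *\<^sub>Q (beta_A2 (4 * l + 2 * m + 1) * p_A2)
       \<and> (\<Sum>ms | length ms = 2 * l + 1 \<and> sum_list ms = m. zeta_star_A2 (index_13 l ms)) =
           ((-1) ^ l * 2 powi (1 - 2 * int l) * of_nat ((l + m) choose l))
           *\<^sub>Q (beta_A2 (4 * l + 2 * m + 1) * p_A2)"
proof
  let ?M = "2 * l + m"
  have "2 powi (1 - 2 * int l) = (2 :: rat) / 2 ^ (2 * l)"
    using power_int_diff[of "2 :: rat" 1 "int (2 * l)"] by (simp only: power_int_of_nat) simp
  then have le: "(-1) ^ l * 2 powi (1 - 2 * int l) * of_nat ((l + m) choose l) = coefficient_le ?M (2 * l)"
    by (simp add: coefficient_le_def)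
  then have less: "(-1) ^ m * ((-1) ^ l * 2 powi (1 - 2 * int l) * of_nat ((l + m) choose l)
      - 4 * of_nat ((2 * l + m) choose (2 * l))) = coefficient_less ?M (2 * l)"
    by (simp add: coefficient_less_def)
  let ?b = "\<lambda>p. of_nat p * (bernoulli (p - (4 * l + 2 * m + 1)) / of_nat (4 * l + 2 * m + 1))"
  have eqv: "interleaved_sum (<) (p - 1) (2 * l) m - ?b p * coefficient_less ?M (2 * l) \<in> padic p 2"
    "interleaved_sum (\<le>) (p - 1) (2 * l) m - ?b p * coefficient_le ?M (2 * l) \<in> padic p 2"
    if p: "prime p" "p \<ge> 2 * ?M + 12" for p
  proof -
    interpret odd_prime p by unfold_locales (use p in auto)
    have M: "0 < ?M" "even (2 * l)" "2 * l \<le> ?M"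
      using assms by auto
    have W: "?M - 2 * l = m" "2 * ?M + 1 = 4 * l + 2 * m + 1"
      by auto
    show "interleaved_sum (<) (p - 1) (2 * l) m - ?b p * coefficient_less ?M (2 * l) \<in> padic p 2"
      "interleaved_sum (\<le>) (p - 1) (2 * l) m - ?b p * coefficient_le ?M (2 * l) \<in> padic p 2"
      using interleaved_sum_eqv[OF M(1) p(2) M(2,3)] unfolding R.eqv_def beta_def W by this+
  qed
  show "(\<Sum>ms | length ms = 2 * l + 1 \<and> sum_list ms = m. zeta_A2 (index_13 l ms)) =
           ((-1) ^ m *
             ((-1) ^ l * 2 powi (1 - 2 * int l) * of_nat ((l + m) choose l)
               - 4 * of_nat ((2 * l + m) choose (2 * l))))
           *\<^sub>Q (beta_A2 (4 * l + 2 * m + 1) * p_A2)"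
    unfolding less
  proof (rule A2_sum_eq[OF assms, where R = "(<)"])
    show "zeta_A2 ks = A2_of_rats (\<lambda>p. harmonic_sum (<) (p - 1) ks)" for ks
      unfolding zeta_A2_def harmonic_sum_def index_chains_def ..
    show "coefficient_less ?M (2 * l) \<in> padic p 0" if "prime p" "p > 2" for p
      using that odd_prime.coefficient_less_mem[of p] by (simp add: odd_prime_def)
  qed (rule eqv)
  show "(\<Sum>ms | length ms = 2 * l + 1 \<and> sum_list ms = m. zeta_star_A2 (index_13 l ms)) =
           ((-1) ^ l * 2 powi (1 - 2 * int l) * of_nat ((l + m) choose l))
           *\<^sub>Q (beta_A2 (4 * l + 2 * m + 1) * p_A2)"
    unfolding le
  proof (rule A2_sum_eq[OF assms, where R = "(\<le>)"])
    show "zeta_star_A2 ks = A2_of_rats (\<lambda>p. harmonic_sum (\<le>) (p - 1) ks)" for ks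
      unfolding zeta_star_A2_def harmonic_sum_def index_chains_def ..
    show "coefficient_le ?M (2 * l) \<in> padic p 0" if "prime p" "p > 2" for p
      using that odd_prime.coefficient_le_mem[of p] by (simp add: odd_prime_def)
  qed (rule eqv)
qed

end
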